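(* Let $\alpha$ be a continuous $\|\cdot\|_1$-dominating normalized gauge norm, let $B$ be a finite Blaschke product with $n$ zeros, and let $\mathcal{M}$ be an $\alpha$-closed linear subspace of $H^{\alpha}$ invariant under $T_B$. Then there exist $B$-inner functions $J_1,\ldots,J_r$ ($r\le n$) such that \[\mathcal{M}=\big[J_1M_{\alpha}(B)\oplus\cdots\oplus J_rM_{\alpha}(B)\big]_{\alpha},\] where $\oplus$ denotes a direct sum.
   Context: $\mathbb T$ is the unit circle with normalized Lebesgue measure $m$; $L^p,H^p$ are the classical Lebesgue and Hardy spaces on $\mathbb T$. A norm $\alpha$ on $L^\infty$ is a $\|\cdot\|_1$-dominating normalized gauge norm if $\alpha(1)=1$, $\alpha(|f|)=\alpha(f)$ and $\alpha(f)\ge\|f\|_1$ for all $f\in L^\infty$; it is continuous if $\alpha(\chi_E)\to0$ as $m(E)\to0^+$. It is extended to all measurable $f$ by $\alpha(f)=\sup\{\alpha(s): s \text{ simple}, 0\le s\le|f|\}$. $L^\alpha$ is the $\alpha$-closure of $L^\infty$ and $H^\alpha$ the $\alpha$-closure of $H^\infty$. For a set $S$, $[S]_\alpha$ denotes its $\alpha$-closure. $B(z)=\prod_{i=1}^n\frac{z-a_i}{1-\overline{a_i}z}$ with $a_i$ in the open unit disc (the paper takes $a_1=0$). $T_B$ is multiplication by $B$ on $H^\alpha$; $\mathcal M$ is invariant under it if $B\mathcal M\subset\mathcal M$. $H^\infty(B)=\{f\circ B: f\in H^\infty\}$ and $M_\alpha(B)=[H^\infty(B)]_\alpha$. A function $\varphi\in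 H^\infty$ is $B$-inner if $\{B^m\varphi: m=0,1,2,\ldots\}$ is an orthonormal set in $H^2$. *)

theory Defs
  imports "HOL-Analysis.Analysis"
begin

text \<open>Normalized Lebesgue measure m on the unit circle T, realised as a
  probability measure on the complex plane (concentrated on T), namely the
  image of Lebesgue measure on [0,1] under t \<mapsto> exp(2 pi i t).
  Functions on T are functions complex \<Rightarrow> complex (only values on T matter,
  and only up to m-a.e. equality).\<close>
definition mT :: "complex measure" where
  "mT = distr (restrict_space lborel {0..1::real}) borel (\<lambda>t. cis (2 * pi * t))"

definition Linf :: "(complex \<Rightarrow> complex) set" where
  "Linf = {f \<in> borel_measurable mT. \<exists>C. AE z in mT. cmod (f z) \<le> C}"

definition Hinf :: "(complex \<Rightarrow> complex) set" where
  "Hinf = {f \<in> Linf. \<forall>n::nat. n \<ge> 1 \<longrightarrow> integral\<^sup>L mT (\<lambda>z. f z * z ^ n) = 0}"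

definition L1norm :: "(complex \<Rightarrow> complex) \<Rightarrow> real" where
  "L1norm f = integral\<^sup>L mT (\<lambda>z. cmod (f z))"

definition dominating_gauge_norm :: "((complex \<Rightarrow> complex) \<Rightarrow> real) \<Rightarrow> bool" where
  "dominating_gauge_norm \<alpha> \<longleftrightarrow>
     (\<forall>f\<in>Linf. \<forall>g\<in>Linf. (AE z in mT. f z = g z) \<longrightarrow> \<alpha> f = \<alpha> g) \<and>
     (\<forall>f\<in>Linf. 0 \<le> \<alpha> f) \<and>
     (\<forall>f\<in>Linf. \<forall>g\<in>Linf. \<alpha> (\<lambda>z. f z + g z) \<le> \<alpha> f + \<alpha> g) \<and>
     (\<forall>f\<in>Linf. \<forall>c::complex. \<alpha> (\<lambda>z. c * f z) = cmod c * \<alpha> f) \<and>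
     (\<forall>f\<in>Linf. \<alpha> f = 0 \<longrightarrow> (AE z in mT. f z = 0)) \<and>
     \<alpha> (\<lambda>z. 1) = 1 \<and>
     (\<forall>f\<in>Linf. \<alpha> (\<lambda>z. complex_of_real (cmod (f z))) = \<alpha> f) \<and>
     (\<forall>f\<in>Linf. L1norm f \<le> \<alpha> f)"

definition continuous_gauge :: "((complex \<Rightarrow> complex) \<Rightarrow> real) \<Rightarrow> bool" where
  "continuous_gauge \<alpha> \<longleftrightarrow>
     (\<forall>e>0. \<exists>d>0. \<forall>E\<in>sets mT. measure mT E < d \<longrightarrow>
        \<alpha> (\<lambda>z. complex_of_real (indicator E z)) < e)"

definition alpha_ext :: "((complex \<Rightarrow> complex) \<Rightarrow> real) \<Rightarrow> (complex \<Rightarrow> complex) \<Rightarrow> ennreal" where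
  "alpha_ext \<alpha> f = (SUP s \<in> {s :: complex \<Rightarrow> real. simple_function mT s \<and> (\<forall>z. 0 \<le> s z) \<and>
                                  (AE z in mT. s z \<le> cmod (f z))}.
                        ennreal (\<alpha> (\<lambda>z. complex_of_real (s z))))"

definition aclosure :: "((complex \<Rightarrow> complex) \<Rightarrow> real) \<Rightarrow> (complex \<Rightarrow> complex) set \<Rightarrow> (complex \<Rightarrow> complex) set" where
  "aclosure \<alpha> S = {f \<in> borel_measurable mT. \<forall>e>0. \<exists>g\<in>S. alpha_ext \<alpha> (\<lambda>z. f z - g z) < ennreal e}"

definition Lalpha where "Lalpha \<alpha> = aclosure \<alpha> Linf"
definition Halpha where "Halpha \<alpha> = aclosure \<alpha> Hinf"

definition blaschke :: "complex list \<Rightarrow> complex \<Rightarrow> complex" where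
  "blaschke a z = (\<Prod>i<length a. (z - a ! i) / (1 - cnj (a ! i) * z))"

definition Hinf_B :: "(complex \<Rightarrow> complex) \<Rightarrow> (complex \<Rightarrow> complex) set" where
  "Hinf_B B = {(\<lambda>z. f (B z)) | f. f \<in> Hinf}"

definition M_alpha :: "((complex \<Rightarrow> complex) \<Rightarrow> real) \<Rightarrow> (complex \<Rightarrow> complex) \<Rightarrow> (complex \<Rightarrow> complex) set" where
  "M_alpha \<alpha> B = aclosure \<alpha> (Hinf_B B)"

definition B_inner :: "(complex \<Rightarrow> complex) \<Rightarrow> (complex \<Rightarrow> complex) \<Rightarrow> bool" where
  "B_inner B \<phi> \<longleftrightarrow> \<phi> \<in> Hinf \<and>
     (\<forall>m k::nat. integral\<^sup>L mT (\<lambda>z. (B z ^ m * \<phi> z) * cnj (B z ^ k * \<phi> z))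
                 = (if m = k then 1 else 0))"

definition linear_subspace :: "(complex \<Rightarrow> complex) set \<Rightarrow> bool" where
  "linear_subspace M \<longleftrightarrow> (\<lambda>z. 0) \<in> M \<and>
     (\<forall>f\<in>M. \<forall>g\<in>M. (\<lambda>z. f z + g z) \<in> M) \<and> (\<forall>f\<in>M. \<forall>c::complex. (\<lambda>z. c * f z) \<in> M)"

definition sum_space :: "((complex \<Rightarrow> complex) \<Rightarrow> real) \<Rightarrow> (complex \<Rightarrow> complex) \<Rightarrow> nat \<Rightarrow> (nat \<Rightarrow> complex \<Rightarrow> complex) \<Rightarrow> (complex \<Rightarrow> complex) set" where
  "sum_space \<alpha> B r J = {(\<lambda>z. \<Sum>i<r. J i z * g i z) | g. \<forall>i<r. g i \<in> M_alpha \<alpha> B}"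

definition is_direct_sum :: "((complex \<Rightarrow> complex) \<Rightarrow> real) \<Rightarrow> (complex \<Rightarrow> complex) \<Rightarrow> nat \<Rightarrow> (nat \<Rightarrow> complex \<Rightarrow> complex) \<Rightarrow> bool" where
  "is_direct_sum \<alpha> B r J \<longleftrightarrow>
     (\<forall>g. (\<forall>i<r. g i \<in> M_alpha \<alpha> B) \<longrightarrow> (AE z in mT. (\<Sum>i<r. J i z * g i z) = 0) \<longrightarrow>
        (\<forall>i<r. AE z in mT. J i z * g i z = 0))"

end

theory Submission
  imports Defs
begin

text \<open>Write \<open>u\<close> for the Blaschke product on the circle and \<open>K\<close> for the \<open>L2\<close>-closure of the bounded
  elements of \<open>M\<close>. The Takenaka functions times the integer powers of \<open>u\<close> form an orthonormal basis of
  \<open>L2\<close>, so functions can be approximated by Fejer means along \<open>u\<close>. By the Wold decomposition \<open>K\<close> is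
  spanned by the powers of \<open>u\<close> times an orthonormal basis \<open>J\<close> of the orthogonal complement
  \<open>W\<close> of \<open>u K\<close> in \<open>K\<close>. For \<open>w\<close> in \<open>W\<close> the function \<open>|w|^2\<close> is orthogonal to all nontrivial powers of \<open>u\<close>; Cauchy-Schwarz against the Fejer kernel
  then bounds the Fejer means of \<open>w\<close>, so \<open>w\<close> is bounded. Comparing expansion coefficients with the
  Takenaka system shows that \<open>J\<close> has at most \<open>n\<close> elements.

  Bounded \<open>L2\<close>-convergence implies \<open>\<alpha>\<close>-convergence because \<open>\<alpha>\<close> is continuous. To pass from unbounded
  to bounded convergence, a Szego extremal problem yields, for each integrable \<open>F\<close>, bounded functions
  \<open>q\<close> of \<open>u\<close> close to 1 for which \<open>|q|^2 F\<close> is bounded. With their help the bounded elements are seen to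
  be \<open>\<alpha>\<close>-dense in \<open>M\<close>, and the bounded elements of \<open>K\<close> to lie in \<open>M\<close>.\<close>

section \<open>The circle measure and its square integrable functions\<close>

text \<open>The gauge norm merely dominates the L1 norm, so elements of \<open>M\<close> need not be
  square integrable: Hilbert space arguments see only the bounded ones, and much of the work lies in
  moving between the two topologies. Boundedness of the wandering functions makes the
  \<open>J i\<close> multipliers and keeps their Fejer expansions uniformly bounded. A uniform bound
  independent of the accuracy demanded recurs in every approximation, because continuity of \<alpha>
  turns L1 smallness into \<alpha> smallness only under such a bound. Nothing is extended into the
  disc. Membership in H2 is the vanishing of moments on the circle, evaluation at a point is a
  pairing with the Szego kernel, and divisibility by the Blaschke product is the removal of one zero
  after another. The zero at the origin gives its powers mean zero, so the product preserves the
  measure and its integer powers are orthonormal. Directness of the sum does not follow from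
  orthogonality in L2 alone, since elements of \<open>M_alpha\<close> are in general only
  integrable; Fourier coefficients along the Blaschke product are compared instead.\<close>

lemma cis_measurable [measurable]: "(\<lambda>t::real. cis (2 * pi * t)) \<in> borel_measurable borel"
  by (intro borel_measurable_continuous_onI continuous_intros)

lemma sets_mT [simp, measurable_cong]: "sets mT = sets borel"
  by (simp add: mT_def)

lemma space_mT [simp]: "space mT = UNIV"
  by (simp add: mT_def)

lemma measurable_mT_iff [simp]: "borel_measurable mT = borel_measurable borel"
  by (rule measurable_cong_sets) auto

lemma cis_measurable_restrict:
  "(\<lambda>t::real. cis (2 * pi * t)) \<in> measurable (restrict_space lborel {0..1}) borel"
  by (rule measurable_restrict_space1) simp

lemma emeasure_mT: "emeasure mT UNIV = 1"
  unfolding mT_def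
  by (subst emeasure_distr[OF cis_measurable_restrict])
     (auto simp: emeasure_restrict_space space_restrict_space)

interpretation mT: finite_measure mT
  by standard (simp add: emeasure_mT)

lemma measure_mT [simp]: "measure mT UNIV = 1"
  by (simp add: measure_def emeasure_mT)

lemma AE_mT_cmod: "AE z in mT. cmod z = 1"
proof -
  have "{z::complex. cmod z = 1} \<in> sets borel" by measurable
  then show ?thesis
    unfolding mT_def by (subst AE_distr_iff[OF cis_measurable_restrict]) auto
qed

lemma AE_mT: "(\<And>z. cmod z = 1 \<Longrightarrow> P z) \<Longrightarrow> AE z in mT. P z"
  using AE_mT_cmod by eventually_elim simp

lemma integral_mT_power:
  assumes "k \<ge> 1" shows "integral\<^sup>L mT (\<lambda>z. z ^ k) = 0"
proof -
  define c where "c = 2 * pi * real k"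
  have c: "c \<noteq> 0" using assms by (simp add: c_def)
  define F where "F t = exp (\<i> * c * complex_of_real t) / (\<i> * complex_of_real c)" for t
  have F: "(F has_vector_derivative cis (c * t)) (at t within {0..1})" for t
    unfolding F_def
    by (rule has_vector_derivative_real_field[where f="\<lambda>w. exp (\<i> * c * w) / (\<i> * complex_of_real c)"])
       (auto intro!: derivative_eq_intros simp: c cis_conv_exp mult.assoc)
  have "integral\<^sup>L mT (\<lambda>z. z ^ k) = (\<integral>t. cis (2 * pi * t) ^ k \<partial>restrict_space lborel {0..1})"
    unfolding mT_def by (subst integral_distr[OF cis_measurable_restrict]) auto
  also have "\<dots> = (\<integral>t. indicator {0..1} t *\<^sub>R cis (2 * pi * t) ^ k \<partial>lborel)"
    by (subst integral_restrict_space) auto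
  also have "\<dots> = (\<integral>t. indicator {0..1} t *\<^sub>R cis (c * t) \<partial>lborel)"
    by (simp add: c_def Complex.DeMoivre mult_ac)
  also have "\<dots> = F 1 - F 0"
    by (rule integral_FTC_Icc) (auto intro!: F continuous_intros)
  also have "\<dots> = 0"
  proof -
    \<comment> \<open>\<open>c\<close> is a multiple of \<open>2 * pi\<close>, so the antiderivative
      takes equal values at both ends.\<close>
    have "cis c = cis (2 * pi) ^ k" by (simp add: c_def Complex.DeMoivre mult_ac)
    then show ?thesis by (simp add: F_def cis_conv_exp mult_ac)
  qed
  finally show ?thesis .
qed

lemma integral_mT_const [simp]: "integral\<^sup>L mT (\<lambda>z. c) = (c::'a::{banach,second_countable_topology})"
  by simp

section \<open>Inner product, norm and completeness of L2\<close>

definition L2 :: "(complex \<Rightarrow> complex) set" where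
  "L2 = {f \<in> borel_measurable borel. integrable mT (\<lambda>z. (cmod (f z))\<^sup>2)}"

definition ip :: "(complex \<Rightarrow> complex) \<Rightarrow> (complex \<Rightarrow> complex) \<Rightarrow> complex" where
  "ip f g = integral\<^sup>L mT (\<lambda>z. f z * cnj (g z))"

definition n2 :: "(complex \<Rightarrow> complex) \<Rightarrow> real" where
  "n2 f = sqrt (integral\<^sup>L mT (\<lambda>z. (cmod (f z))\<^sup>2))"

text \<open>Functions are not identified up to null sets; for \<open>S\<close> inside
  \<open>L2\<close> the closure therefore also contains every measurable a.e. modification of its
  elements.\<close>

definition cl2 :: "(complex \<Rightarrow> complex) set \<Rightarrow> (complex \<Rightarrow> complex) set" where
  "cl2 S = {f \<in> L2. \<forall>e>0. \<exists>g\<in>S. n2 (\<lambda>z. f z - g z) < e}"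

lemma cnj_measurable [measurable]: "f \<in> borel_measurable M \<Longrightarrow> (\<lambda>z. cnj (f z)) \<in> borel_measurable M"
  by (rule borel_measurable_continuous_on[where f=cnj]) (auto intro: continuous_intros)

lemma L2_measurable [measurable_dest]: "f \<in> L2 \<Longrightarrow> f \<in> borel_measurable borel"
  by (simp add: L2_def)

lemma L2_sq_integrable: "f \<in> L2 \<Longrightarrow> integrable mT (\<lambda>z. (cmod (f z))\<^sup>2)"
  by (simp add: L2_def)

lemma two_mult_le_squares: "2 * (a * b) \<le> a\<^sup>2 + b\<^sup>2" for a b :: real
  using sum_squares_bound[of a b] by simp

lemma L2_mult_integrable:
  assumes [measurable]: "f \<in> L2" "g \<in> L2"
  shows "integrable mT (\<lambda>z. f z * g z)" "integrable mT (\<lambda>z. f z * cnj (g z))"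
    "integrable mT (\<lambda>z. cmod (f z) * cmod (g z))"
proof -
  have b: "cmod (f z) * cmod (g z) \<le> (cmod (f z))\<^sup>2 + (cmod (g z))\<^sup>2" for z
    using two_mult_le_squares[of "cmod (f z)" "cmod (g z)"] mult_nonneg_nonneg[of "cmod (f z)" "cmod (g z)"]
      norm_ge_zero[of "f z"] norm_ge_zero[of "g z"] by linarith
  have i: "integrable mT (\<lambda>z. (cmod (f z))\<^sup>2 + (cmod (g z))\<^sup>2)"
    by (intro Bochner_Integration.integrable_add L2_sq_integrable assms)
  show "integrable mT (\<lambda>z. f z * g z)"
    by (rule Bochner_Integration.integrable_bound[OF i]) (use b in \<open>auto simp: norm_mult\<close>)
  show "integrable mT (\<lambda>z. f z * cnj (g z))"
    by (rule Bochner_Integration.integrable_bound[OF i]) (use b in \<open>auto simp: norm_mult\<close>)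
  show "integrable mT (\<lambda>z. cmod (f z) * cmod (g z))"
    by (rule Bochner_Integration.integrable_bound[OF i]) (use b in \<open>auto simp: norm_mult\<close>)
qed

lemma L2_add:
  assumes [measurable]: "f \<in> L2" "g \<in> L2"
  shows "(\<lambda>z. f z + g z) \<in> L2"
proof -
  have b: "(cmod (f z + g z))\<^sup>2 \<le> 2 * (cmod (f z))\<^sup>2 + 2 * (cmod (g z))\<^sup>2" for z
  proof -
    have "(cmod (f z + g z))\<^sup>2 \<le> (cmod (f z) + cmod (g z))\<^sup>2"
      by (intro power_mono norm_triangle_ineq) auto
    also have "\<dots> = (cmod (f z))\<^sup>2 + (cmod (g z))\<^sup>2 + 2 * (cmod (f z) * cmod (g z))"
      by (simp add: power2_eq_square algebra_simps)
    finally show ?thesis using two_mult_le_squares[of "cmod (f z)" "cmod (g z)"] by linarith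
  qed
  have "integrable mT (\<lambda>z. 2 * (cmod (f z))\<^sup>2 + 2 * (cmod (g z))\<^sup>2)"
    using L2_sq_integrable[OF assms(1)] L2_sq_integrable[OF assms(2)] by auto
  then have "integrable mT (\<lambda>z. (cmod (f z + g z))\<^sup>2)"
    by (rule Bochner_Integration.integrable_bound) (use b in auto)
  then show ?thesis by (simp add: L2_def)
qed

lemma L2_mult_bounded:
  assumes [measurable]: "f \<in> L2" "b \<in> borel_measurable borel" and b: "AE z in mT. cmod (b z) \<le> C"
  shows "(\<lambda>z. b z * f z) \<in> L2"
proof -
  have "integrable mT (\<lambda>z. C\<^sup>2 * (cmod (f z))\<^sup>2)"
    using L2_sq_integrable[OF assms(1)] by auto
  then have "integrable mT (\<lambda>z. (cmod (b z * f z))\<^sup>2)"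
    by (rule Bochner_Integration.integrable_bound)
       (use b in \<open>auto simp: norm_mult power_mult_distrib intro!: mult_right_mono power_mono
          elim!: eventually_mono\<close>)
  then show ?thesis by (simp add: L2_def)
qed

lemma L2_const: "(\<lambda>z. c) \<in> L2"
  by (simp add: L2_def)

lemma L2_cmult: "f \<in> L2 \<Longrightarrow> (\<lambda>z. c * f z) \<in> L2"
  by (rule L2_mult_bounded[where C="cmod c"]) auto

lemma L2_diff: "f \<in> L2 \<Longrightarrow> g \<in> L2 \<Longrightarrow> (\<lambda>z. f z - g z) \<in> L2"
  using L2_add[of f "\<lambda>z. (-1) * g z"] L2_cmult[of g "-1"] by simp

lemma L2_bounded:
  assumes [measurable]: "b \<in> borel_measurable borel" and "AE z in mT. cmod (b z) \<le> C"
  shows "b \<in> L2"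
  using L2_mult_bounded[OF L2_const[of 1] assms] by simp

lemma L2_sum: "finite I \<Longrightarrow> (\<And>i. i \<in> I \<Longrightarrow> f i \<in> L2) \<Longrightarrow> (\<lambda>z. \<Sum>i\<in>I. f i z) \<in> L2"
  by (induction I rule: finite_induct) (auto intro: L2_add L2_const)

lemma L2_integrable: "f \<in> L2 \<Longrightarrow> integrable mT f"
  using L2_mult_integrable(1)[OF _ L2_const[of 1]] by simp

lemma Linf_L2: "f \<in> Linf \<Longrightarrow> f \<in> L2"
  by (auto simp: Linf_def intro: L2_bounded)

lemma L2_cong_AE:
  assumes "f \<in> L2" "g \<in> borel_measurable borel" "AE z in mT. f z = g z"
  shows "g \<in> L2"
proof -
  have [measurable]: "f \<in> borel_measurable borel" using assms by (simp add: L2_def)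
  note [measurable] = assms(2)
  have "integrable mT (\<lambda>z. (cmod (f z))\<^sup>2) \<longleftrightarrow> integrable mT (\<lambda>z. (cmod (g z))\<^sup>2)"
    by (rule integrable_cong_AE) (use assms(3) in \<open>auto elim!: eventually_mono\<close>)
  then show ?thesis using assms by (simp add: L2_def)
qed

lemma n2_nonneg [simp]: "0 \<le> n2 f"
  by (simp add: n2_def)

lemma n2_sq: "(n2 f)\<^sup>2 = integral\<^sup>L mT (\<lambda>z. (cmod (f z))\<^sup>2)"
  by (simp add: n2_def)

lemma n2_sq_ip: "complex_of_real ((n2 f)\<^sup>2) = ip f f"
  unfolding n2_sq ip_def integral_complex_of_real[symmetric]
  by (simp only: complex_norm_square)

lemma n2_cong_AE:
  assumes "f \<in> borel_measurable borel" "g \<in> borel_measurable borel" "AE z in mT. f z = g z"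
  shows "n2 f = n2 g"
proof -
  note [measurable] = assms(1,2)
  have "integral\<^sup>L mT (\<lambda>z. (cmod (f z))\<^sup>2) = integral\<^sup>L mT (\<lambda>z. (cmod (g z))\<^sup>2)"
    by (rule integral_cong_AE) (use assms(3) in \<open>auto elim!: eventually_mono\<close>)
  then show ?thesis by (simp add: n2_def)
qed

lemma ip_add_left: "f \<in> L2 \<Longrightarrow> g \<in> L2 \<Longrightarrow> h \<in> L2 \<Longrightarrow> ip (\<lambda>z. f z + g z) h = ip f h + ip g h"
  unfolding ip_def by (simp add: algebra_simps L2_mult_integrable)

lemma ip_diff_left: "f \<in> L2 \<Longrightarrow> g \<in> L2 \<Longrightarrow> h \<in> L2 \<Longrightarrow> ip (\<lambda>z. f z - g z) h = ip f h - ip g h"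
  unfolding ip_def by (simp add: algebra_simps L2_mult_integrable)

lemma ip_cmult_left: "ip (\<lambda>z. c * f z) h = c * ip f h"
  unfolding ip_def by (simp add: mult.assoc)

lemma ip_cnj: "ip g f = cnj (ip f g)"
  unfolding ip_def
  by (subst Bochner_Integration.integral_cnj[symmetric])
     (simp add: mult.commute del: Bochner_Integration.integral_cnj)

lemma ip_add_right: "f \<in> L2 \<Longrightarrow> g \<in> L2 \<Longrightarrow> h \<in> L2 \<Longrightarrow> ip h (\<lambda>z. f z + g z) = ip h f + ip h g"
  by (subst (1 2 3) ip_cnj) (simp add: ip_add_left)

lemma ip_diff_right: "f \<in> L2 \<Longrightarrow> g \<in> L2 \<Longrightarrow> h \<in> L2 \<Longrightarrow> ip h (\<lambda>z. f z - g z) = ip h f - ip h g"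
  by (subst (1 2 3) ip_cnj) (simp add: ip_diff_left)

lemma ip_cmult_right: "ip h (\<lambda>z. c * f z) = cnj c * ip h f"
  by (subst (1 2) ip_cnj) (simp add: ip_cmult_left)

lemma ip_zero [simp]: "ip (\<lambda>z. 0) f = 0" "ip f (\<lambda>z. 0) = 0"
  by (simp_all add: ip_def)

lemma ip_sum_left:
  "finite I \<Longrightarrow> (\<And>i. i \<in> I \<Longrightarrow> f i \<in> L2) \<Longrightarrow> h \<in> L2 \<Longrightarrow> ip (\<lambda>z. \<Sum>i\<in>I. f i z) h = (\<Sum>i\<in>I. ip (f i) h)"
  by (induction I rule: finite_induct) (auto simp: ip_add_left L2_sum)

lemma L2_Cauchy_Schwarz_abs:
  assumes [measurable]: "f \<in> L2" "g \<in> L2"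
  shows "integral\<^sup>L mT (\<lambda>z. cmod (f z) * cmod (g z)) \<le> n2 f * n2 g"
proof -
  let ?I = "integral\<^sup>L mT (\<lambda>z. cmod (f z) * cmod (g z))"
  have nn: "(\<integral>\<^sup>+z. ennreal (h z) \<partial>mT) = ennreal (integral\<^sup>L mT h)"
    if "integrable mT h" "\<And>z. 0 \<le> h z" for h :: "complex \<Rightarrow> real"
    using that by (intro nn_integral_eq_integral) auto
  have "(\<integral>\<^sup>+z. ennreal (cmod (f z)) * ennreal (cmod (g z)) \<partial>mT)\<^sup>2
      \<le> (\<integral>\<^sup>+z. (ennreal (cmod (f z)))\<^sup>2 \<partial>mT) * (\<integral>\<^sup>+z. (ennreal (cmod (g z)))\<^sup>2 \<partial>mT)"
    by (rule Cauchy_Schwarz_nn_integral) auto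
  then have "(ennreal ?I)\<^sup>2 \<le> ennreal ((n2 f)\<^sup>2) * ennreal ((n2 g)\<^sup>2)"
    by (simp add: ennreal_mult[symmetric] ennreal_power nn L2_mult_integrable assms L2_sq_integrable n2_sq)
  then have "?I\<^sup>2 \<le> (n2 f * n2 g)\<^sup>2"
    by (simp add: ennreal_mult[symmetric] ennreal_power power_mult_distrib)
  then show ?thesis by (rule power2_le_imp_le) simp
qed

lemma L2_Cauchy_Schwarz:
  assumes "f \<in> L2" "g \<in> L2"
  shows "cmod (ip f g) \<le> n2 f * n2 g"
proof -
  have "cmod (ip f g) \<le> integral\<^sup>L mT (\<lambda>z. cmod (f z * cnj (g z)))"
    unfolding ip_def by (rule integral_norm_bound)
  also have "\<dots> \<le> n2 f * n2 g" using L2_Cauchy_Schwarz_abs[OF assms] by (simp add: norm_mult)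
  finally show ?thesis .
qed

lemma n2_const [simp]: "n2 (\<lambda>z. c) = cmod c"
  by (simp add: n2_def)

lemma L1_le_n2: "f \<in> L2 \<Longrightarrow> integral\<^sup>L mT (\<lambda>z. cmod (f z)) \<le> n2 f"
  using L2_Cauchy_Schwarz_abs[OF _ L2_const[of 1], of f] by simp

lemma n2_cmult: "n2 (\<lambda>z. c * f z) = cmod c * n2 f"
  by (simp add: n2_def norm_mult power_mult_distrib real_sqrt_mult)

lemma n2_sq_add:
  assumes "f \<in> L2" "g \<in> L2"
  shows "(n2 (\<lambda>z. f z + g z))\<^sup>2 = (n2 f)\<^sup>2 + 2 * Re (ip f g) + (n2 g)\<^sup>2"
proof -
  have "complex_of_real ((n2 (\<lambda>z. f z + g z))\<^sup>2) = ip f f + ip f g + cnj (ip f g) + ip g g"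
    unfolding n2_sq_ip
    by (simp add: ip_add_left ip_add_right L2_add assms) (simp add: ip_cnj[of g f])
  also have "\<dots> = complex_of_real ((n2 f)\<^sup>2 + 2 * Re (ip f g) + (n2 g)\<^sup>2)"
    by (simp add: n2_sq_ip[symmetric] complex_eq_iff)
  finally show ?thesis using of_real_eq_iff by blast
qed

lemma n2_minus: "n2 (\<lambda>z. - f z) = n2 f"
  by (simp add: n2_def)

lemma n2_sq_diff:
  assumes "f \<in> L2" "g \<in> L2"
  shows "(n2 (\<lambda>z. f z - g z))\<^sup>2 = (n2 f)\<^sup>2 - 2 * Re (ip f g) + (n2 g)\<^sup>2"
  using n2_sq_add[OF assms(1) L2_cmult[OF assms(2), of "-1"]]
  by (simp add: ip_cmult_right n2_minus) (simp add: ip_def)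

lemma n2_triangle:
  assumes "f \<in> L2" "g \<in> L2"
  shows "n2 (\<lambda>z. f z + g z) \<le> n2 f + n2 g"
proof (rule power2_le_imp_le)
  have "Re (ip f g) \<le> n2 f * n2 g"
    using complex_Re_le_cmod L2_Cauchy_Schwarz[OF assms] order_trans by blast
  then show "(n2 (\<lambda>z. f z + g z))\<^sup>2 \<le> (n2 f + n2 g)\<^sup>2"
    unfolding n2_sq_add[OF assms] by (simp add: power2_eq_square algebra_simps)
qed simp

lemma n2_diff_commute: "n2 (\<lambda>z. f z - g z) = n2 (\<lambda>z. g z - f z)"
  by (simp add: n2_def norm_minus_commute)

lemma n2_triangle3:
  assumes "f \<in> L2" "g \<in> L2" "h \<in> L2"
  shows "n2 (\<lambda>z. f z - h z) \<le> n2 (\<lambda>z. f z - g z) + n2 (\<lambda>z. g z - h z)"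
  using n2_triangle[OF L2_diff[OF assms(1,2)] L2_diff[OF assms(2,3)]] by simp

lemma n2_sum:
  "finite I \<Longrightarrow> (\<And>i. i \<in> I \<Longrightarrow> f i \<in> L2) \<Longrightarrow> n2 (\<lambda>z. \<Sum>i\<in>I. f i z) \<le> (\<Sum>i\<in>I. n2 (f i))"
proof (induction I rule: finite_induct)
  case (insert i I)
  then have "n2 (\<lambda>z. \<Sum>i\<in>insert i I. f i z) \<le> n2 (f i) + n2 (\<lambda>z. \<Sum>i\<in>I. f i z)"
    using n2_triangle[of "f i" "\<lambda>z. \<Sum>i\<in>I. f i z"] by (simp add: L2_sum)
  then show ?case using insert by force
qed simp

lemma n2_mono:
  assumes "f \<in> borel_measurable borel" "g \<in> L2" "AE z in mT. cmod (f z) \<le> cmod (g z)"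
  shows "n2 f \<le> n2 g"
proof -
  note [measurable] = assms(1)
  have "integral\<^sup>L mT (\<lambda>z. (cmod (f z))\<^sup>2) \<le> integral\<^sup>L mT (\<lambda>z. (cmod (g z))\<^sup>2)"
    by (rule integral_mono_AE')
       (use assms(3) in \<open>auto intro: L2_sq_integrable[OF assms(2)] power_mono elim!: eventually_mono\<close>)
  then show ?thesis by (simp add: n2_def)
qed

lemma n2_mult_bounded:
  assumes "f \<in> L2" "b \<in> borel_measurable borel" "AE z in mT. cmod (b z) \<le> C" "0 \<le> C"
  shows "n2 (\<lambda>z. b z * f z) \<le> C * n2 f"
proof -
  note [measurable] = L2_measurable[OF assms(1)] assms(2)
  have "n2 (\<lambda>z. b z * f z) \<le> n2 (\<lambda>z. complex_of_real C * f z)"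
    by (rule n2_mono)
       (use assms(3,4) in \<open>auto intro: L2_cmult[OF assms(1)] mult_right_mono simp: norm_mult elim!:
           eventually_mono\<close>)
  then show ?thesis using assms(4) by (simp add: n2_cmult)
qed

lemma n2_zero_AE:
  assumes "f \<in> L2" "n2 f = 0"
  shows "AE z in mT. f z = 0"
proof -
  have "integral\<^sup>L mT (\<lambda>z. (cmod (f z))\<^sup>2) = 0" using assms(2) by (simp add: n2_def)
  then show ?thesis
    using integral_nonneg_eq_0_iff_AE[OF L2_sq_integrable[OF assms(1)]] by simp
qed

text \<open>Riesz-Fischer. As \<open>mT\<close> has mass one, the sequence is also Cauchy in L1 and
  has a subsequence converging almost everywhere; Fatou's lemma along it bounds the distance to the
  pointwise limit by the Cauchy bound.\<close>

lemma L2_complete: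
  assumes s: "\<And>k. s k \<in> L2"
    and C: "\<And>e. e > 0 \<Longrightarrow> \<exists>N. \<forall>i\<ge>N. \<forall>j\<ge>N. n2 (\<lambda>z. s i z - s j z) < e"
  shows "\<exists>p\<in>L2. (\<lambda>k. n2 (\<lambda>z. s k z - p z)) \<longlonglongrightarrow> 0"
proof -
  note [measurable] = L2_measurable[OF s]
  have "\<exists>N. \<forall>i\<ge>N. \<forall>j\<ge>N. LINT x|mT. norm (s i x - s j x) < e" if "e > 0" for e
    using C[OF that] L1_le_n2[OF L2_diff[OF s s]] by (meson le_less_trans)
  with L2_integrable[OF s] obtain r where r: "strict_mono r" "AE x in mT. Cauchy (\<lambda>i. s (r i) x)"
    by (rule cauchy_L1_AE_cauchy_subseq)
  \<comment> \<open>On the null set of divergence \<open>lim\<close> is an unspecified value;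
    measurability holds all the same.\<close>
  define p where "p z = lim (\<lambda>i. s (r i) z)" for z
  have [measurable]: "p \<in> borel_measurable borel" unfolding p_def by measurable
  have AEp: "AE z in mT. (\<lambda>i. s (r i) z) \<longlonglongrightarrow> p z"
    using r(2) by eventually_elim (simp add: p_def convergent_LIMSEQ_iff[symmetric] Cauchy_convergent)
  have key: "(\<lambda>z. s k z - p z) \<in> L2 \<and> n2 (\<lambda>z. s k z - p z) \<le> e"
    if e: "e > 0" and N: "\<forall>i\<ge>N. \<forall>j\<ge>N. n2 (\<lambda>z. s i z - s j z) < e" and k: "k \<ge> N" for e N k
  proof -
    have "(\<integral>\<^sup>+z. ennreal ((cmod (s k z - p z))\<^sup>2) \<partial>mT)
        = (\<integral>\<^sup>+z. liminf (\<lambda>i. ennreal ((cmod (s k z - s (r i) z))\<^sup>2)) \<partial>mT)"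
    proof (rule nn_integral_cong_AE, use AEp in eventually_elim)
      case (elim z)
      then have "(\<lambda>i. ennreal ((cmod (s k z - s (r i) z))\<^sup>2)) \<longlonglongrightarrow> ennreal ((cmod (s k z - p z))\<^sup>2)"
        by (intro tendsto_intros tendsto_ennrealI)
      then show ?case by (rule lim_imp_Liminf[OF sequentially_bot, symmetric])
    qed
    also have "\<dots> \<le> liminf (\<lambda>i. \<integral>\<^sup>+z. ennreal ((cmod (s k z - s (r i) z))\<^sup>2) \<partial>mT)"
      by (rule nn_integral_liminf) auto
    also have "\<dots> \<le> liminf (\<lambda>i. ennreal (e\<^sup>2))"
    proof (rule Liminf_mono, rule eventually_mono[OF eventually_ge_at_top[of N]])
      fix i assume "i \<ge> N"
      then have "r i \<ge> N" using strict_mono_imp_increasing[OF r(1)] order_trans by blast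
      then have "(n2 (\<lambda>z. s k z - s (r i) z))\<^sup>2 \<le> e\<^sup>2"
        using N k by (intro power_mono) (auto simp: less_imp_le)
      then show "(\<integral>\<^sup>+z. ennreal ((cmod (s k z - s (r i) z))\<^sup>2) \<partial>mT) \<le> ennreal (e\<^sup>2)"
        using L2_sq_integrable[OF L2_diff[OF s s]]
        by (subst nn_integral_eq_integral) (auto simp: n2_sq)
    qed
    finally have le: "(\<integral>\<^sup>+z. ennreal ((cmod (s k z - p z))\<^sup>2) \<partial>mT) \<le> ennreal (e\<^sup>2)"
      by (simp add: Liminf_const)
    have "(\<integral>\<^sup>+z. ennreal ((cmod (s k z - p z))\<^sup>2) \<partial>mT) < \<infinity>"
      using le by (rule le_less_trans) simp
    then have i: "integrable mT (\<lambda>z. (cmod (s k z - p z))\<^sup>2)"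
      by (rule integrableI_nonneg[rotated 2]) simp_all
    then have "ennreal ((n2 (\<lambda>z. s k z - p z))\<^sup>2) \<le> ennreal (e\<^sup>2)"
      using le by (simp add: nn_integral_eq_integral n2_sq)
    then have "(n2 (\<lambda>z. s k z - p z))\<^sup>2 \<le> e\<^sup>2" by simp
    then have "n2 (\<lambda>z. s k z - p z) \<le> e" by (rule power2_le_imp_le) (use e in simp)
    then show ?thesis using i by (simp add: L2_def)
  qed
  have p: "p \<in> L2"
  proof -
    obtain N where "\<forall>i\<ge>N. \<forall>j\<ge>N. n2 (\<lambda>z. s i z - s j z) < 1" using C[of 1] by auto
    then have "(\<lambda>z. s N z - p z) \<in> L2" using key[of 1 N N] by simp
    then have "(\<lambda>z. s N z - (s N z - p z)) \<in> L2" by (rule L2_diff[OF s])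
    then show ?thesis by simp
  qed
  moreover have "(\<lambda>k. n2 (\<lambda>z. s k z - p z)) \<longlonglongrightarrow> 0"
  proof (rule LIMSEQ_I)
    fix e :: real assume "e > 0"
    then obtain N where "\<forall>i\<ge>N. \<forall>j\<ge>N. n2 (\<lambda>z. s i z - s j z) < e/2" using C[of "e/2"] by auto
    then have "norm (n2 (\<lambda>z. s k z - p z) - 0) < e" if "k \<ge> N" for k
      using key[of "e/2" N k] \<open>e > 0\<close> that by auto
    then show "\<exists>no. \<forall>k\<ge>no. norm (n2 (\<lambda>z. s k z - p z) - 0) < e" by blast
  qed
  ultimately show ?thesis by blast
qed

section \<open>Linear subspaces and orthogonal projection\<close>

lemma linear_subspaceD:
  assumes "linear_subspace S"
  shows "(\<lambda>z. 0) \<in> S" "f \<in> S \<Longrightarrow> g \<in> S \<Longrightarrow> (\<lambda>z. f z + g z) \<in> S" "f \<in> S \<Longrightarrow> (\<lambda>z. c * f z) \<in> S"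
    "f \<in> S \<Longrightarrow> g \<in> S \<Longrightarrow> (\<lambda>z. f z - g z) \<in> S"
proof -
  show a: "f \<in> S \<Longrightarrow> g \<in> S \<Longrightarrow> (\<lambda>z. f z + g z) \<in> S" for f g
    using assms by (simp add: linear_subspace_def)
  show b: "f \<in> S \<Longrightarrow> (\<lambda>z. c * f z) \<in> S" for f c using assms by (simp add: linear_subspace_def)
  show "(\<lambda>z. 0) \<in> S" using assms by (simp add: linear_subspace_def)
  show "f \<in> S \<Longrightarrow> g \<in> S \<Longrightarrow> (\<lambda>z. f z - g z) \<in> S" using a[of f "\<lambda>z. (-1) * g z"] b[of g "-1"] by simp
qed

lemma linear_subspace_sum:
  assumes "linear_subspace S"
  shows "finite I \<Longrightarrow> (\<And>i. i \<in> I \<Longrightarrow> f i \<in> S) \<Longrightarrow> (\<lambda>z. \<Sum>i\<in>I. f i z) \<in> S"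
  by (induction I rule: finite_induct) (auto intro: linear_subspaceD[OF assms])

lemma ex_nonneg_real_approx_Inf:
  fixes D :: "real set"
  assumes "D \<noteq> {}" "\<And>x. x \<in> D \<Longrightarrow> 0 \<le> x"
  shows "\<exists>x\<in>D. x < Inf D + 1 / real (Suc k)"
proof -
  have "bdd_below D" using assms(2) by (auto simp: bdd_below_def)
  then show ?thesis using cInf_less_iff[OF assms(1), of "Inf D + 1 / real (Suc k)"] by simp
qed

text \<open>Minimising sequences for the distance to \<open>S\<close> are Cauchy by the
  parallelogram law. \<open>S\<close> is not assumed closed, so the nearest point lies in
  \<open>cl2 S\<close> only.\<close>

lemma L2_projection:
  assumes S: "linear_subspace S" "S \<subseteq> L2" and f: "f \<in> L2"
  shows "\<exists>p\<in>cl2 S. \<forall>g\<in>S. ip (\<lambda>z. f z - p z) g = 0"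
proof -
  define D where "D = (\<lambda>s. (n2 (\<lambda>z. f z - s z))\<^sup>2) ` S"
  define d where "d = Inf D"
  have D: "D \<noteq> {}" "\<And>x. x \<in> D \<Longrightarrow> 0 \<le> x" using linear_subspaceD(1)[OF S(1)] by (auto simp: D_def)
  have dle: "d \<le> (n2 (\<lambda>z. f z - s z))\<^sup>2" if "s \<in> S" for s
    unfolding d_def by (rule cInf_lower) (use that D in \<open>auto simp: D_def bdd_below_def\<close>)
  have "\<exists>s\<in>S. (n2 (\<lambda>z. f z - s z))\<^sup>2 < d + 1 / real (Suc k)" for k
    using ex_nonneg_real_approx_Inf[OF D, of k] by (auto simp: D_def d_def)
  then obtain s where s: "\<And>k. s k \<in> S" and sd: "\<And>k. (n2 (\<lambda>z. f z - s k z))\<^sup>2 < d + 1 / real (Suc k)"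
    by metis
  have sL: "s k \<in> L2" for k using s S by auto
  \<comment> \<open>The midpoint of \<open>s i\<close> and \<open>s j\<close> lies in
    \<open>S\<close>, so its squared distance to \<open>f\<close> is at least
    \<open>d\<close>.\<close>
  have par: "(n2 (\<lambda>z. s i z - s j z))\<^sup>2 \<le> 2 / real (Suc i) + 2 / real (Suc j)" for i j
  proof -
    let ?a = "\<lambda>z. f z - s i z" and ?b = "\<lambda>z. f z - s j z"
    have a: "?a \<in> L2" and b: "?b \<in> L2" using L2_diff f sL by auto
    have "(n2 (\<lambda>z. ?b z - ?a z))\<^sup>2 + (n2 (\<lambda>z. ?b z + ?a z))\<^sup>2 = 2 * (n2 ?a)\<^sup>2 + 2 * (n2 ?b)\<^sup>2"
      unfolding n2_sq_diff[OF b a] n2_sq_add[OF b a] by simp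
    moreover have "(n2 (\<lambda>z. ?b z - ?a z))\<^sup>2 = (n2 (\<lambda>z. s i z - s j z))\<^sup>2" by simp
    moreover have "(n2 (\<lambda>z. ?b z + ?a z))\<^sup>2 \<ge> 4 * d"
    proof -
      have "(\<lambda>z. 1/2 * (s i z + s j z)) \<in> S"
        by (intro linear_subspaceD[OF S(1)] s)
      from dle[OF this]
      have "4 * d \<le> (cmod 2 * n2 (\<lambda>z. f z - 1/2 * (s i z + s j z)))\<^sup>2"
        by (simp add: power_mult_distrib)
      also have "cmod 2 * n2 (\<lambda>z. f z - 1/2 * (s i z + s j z)) = n2 (\<lambda>z. ?b z + ?a z)"
        unfolding n2_cmult[symmetric] by (simp add: algebra_simps)
      finally show ?thesis .
    qed
    moreover have "2 / real (Suc i) = 2 * (1 / real (Suc i))" "2 / real (Suc j) = 2 * (1 / real (Suc j))"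
      by simp_all
    ultimately show ?thesis using sd[of i] sd[of j] by linarith
  qed
  have "\<exists>N. \<forall>i\<ge>N. \<forall>j\<ge>N. n2 (\<lambda>z. s i z - s j z) < e" if "e > 0" for e
  proof -
    obtain N where N: "1 / real (Suc N) < e\<^sup>2 / 4"
      using reals_Archimedean[of "e\<^sup>2/4"] \<open>e > 0\<close> by (auto simp: inverse_eq_divide)
    have "n2 (\<lambda>z. s i z - s j z) < e" if "i \<ge> N" "j \<ge> N" for i j
    proof -
      have "1 / real (Suc i) \<le> 1 / real (Suc N)" "1 / real (Suc j) \<le> 1 / real (Suc N)"
        using that by (auto simp: field_simps)
      then have "(n2 (\<lambda>z. s i z - s j z))\<^sup>2 < e\<^sup>2" using par[of i j] N by simp
      then show ?thesis using \<open>e > 0\<close> by (simp add: power2_less_imp_less)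
    qed
    then show ?thesis by blast
  qed
  from L2_complete[OF sL this] obtain p where p: "p \<in> L2" "(\<lambda>k. n2 (\<lambda>z. s k z - p z)) \<longlonglongrightarrow> 0" by auto
  have pcl: "p \<in> cl2 S"
    unfolding cl2_def
  proof (intro CollectI conjI allI impI p)
    fix e :: real assume "e > 0"
    then have "eventually (\<lambda>k. n2 (\<lambda>z. s k z - p z) < e) sequentially"
      by (rule order_tendstoD(2)[OF p(2)])
    then obtain k where "n2 (\<lambda>z. s k z - p z) < e" by (auto simp: eventually_sequentially)
    then show "\<exists>g\<in>S. n2 (\<lambda>z. p z - g z) < e" using s n2_diff_commute by metis
  qed
  let ?h = "\<lambda>z. f z - p z"
  have h: "?h \<in> L2" using f p L2_diff by auto
  have lim: "(\<lambda>k. 1 / real (Suc k)) \<longlonglongrightarrow> 0"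
    using LIMSEQ_inverse_real_of_nat by (simp add: inverse_eq_divide)
  have hd: "(n2 ?h)\<^sup>2 \<le> d"
  proof (rule LIMSEQ_le_const)
    have d0: "d \<ge> 0" unfolding d_def by (rule cInf_greatest) (use D in auto)
    show "(\<lambda>k. (sqrt (d + 1 / real (Suc k)) + n2 (\<lambda>z. s k z - p z))\<^sup>2) \<longlonglongrightarrow> d"
      by (rule tendsto_eq_intros p lim refl | simp add: d0)+
    have "(n2 ?h)\<^sup>2 \<le> (sqrt (d + 1 / real (Suc k)) + n2 (\<lambda>z. s k z - p z))\<^sup>2" for k
    proof (rule power_mono)
      have "n2 (\<lambda>z. f z - s k z) \<le> sqrt (d + 1 / real (Suc k))"
        using sd[of k] by (intro real_le_rsqrt) simp
      then show "n2 ?h \<le> sqrt (d + 1 / real (Suc k)) + n2 (\<lambda>z. s k z - p z)"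
        using n2_triangle3[OF f sL[of k] p(1)] by linarith
    qed simp
    then show "\<exists>N. \<forall>k\<ge>N. (n2 ?h)\<^sup>2 \<le> (sqrt (d + 1 / real (Suc k)) + n2 (\<lambda>z. s k z - p z))\<^sup>2" by blast
  qed
  have dh: "d \<le> (n2 (\<lambda>z. ?h z - g z))\<^sup>2" if g: "g \<in> S" for g
  proof (rule LIMSEQ_le_const)
    show "(\<lambda>k. (n2 (\<lambda>z. ?h z - g z) + n2 (\<lambda>z. s k z - p z))\<^sup>2) \<longlonglongrightarrow> (n2 (\<lambda>z. ?h z - g z))\<^sup>2"
      by (rule tendsto_eq_intros p refl | simp)+
    have gL: "g \<in> L2" using g S by auto
    have "d \<le> (n2 (\<lambda>z. ?h z - g z) + n2 (\<lambda>z. s k z - p z))\<^sup>2" for k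
    proof -
      have "d \<le> (n2 (\<lambda>z. f z - (s k z + g z)))\<^sup>2"
        by (intro dle linear_subspaceD[OF S(1)] s g)
      also have "\<dots> \<le> (n2 (\<lambda>z. ?h z - g z) + n2 (\<lambda>z. s k z - p z))\<^sup>2"
      proof (rule power_mono)
        have "n2 (\<lambda>z. (?h z - g z) + (p z - s k z)) \<le> n2 (\<lambda>z. ?h z - g z) + n2 (\<lambda>z. p z - s k z)"
          by (intro n2_triangle L2_diff h gL p sL)
        moreover have "(\<lambda>z. (?h z - g z) + (p z - s k z)) = (\<lambda>z. f z - (s k z + g z))"
          by (auto simp: algebra_simps)
        ultimately show "n2 (\<lambda>z. f z - (s k z + g z)) \<le> n2 (\<lambda>z. ?h z - g z) + n2 (\<lambda>z. s k z - p z)"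
          using n2_diff_commute[of p "s k"] by simp
      qed simp
      finally show ?thesis .
    qed
    then show "\<exists>N. \<forall>k\<ge>N. d \<le> (n2 (\<lambda>z. ?h z - g z) + n2 (\<lambda>z. s k z - p z))\<^sup>2" by blast
  qed
  have "ip ?h g = 0" if g: "g \<in> S" for g
  proof -
    have gL: "g \<in> L2" using g S by auto
    \<comment> \<open>With x the squared modulus of the pairing, subtracting \<open>c * g\<close>
      changes the squared distance by -2 t x + t^2 x (n2 g)^2. This \<open>t\<close> makes the
      second term at most t x; the \<open>+ 1\<close> covers \<open>n2 g = 0\<close>.\<close>
    define t where "t = 1 / ((n2 g)\<^sup>2 + 1)"
    have t0: "t > 0" "t * (n2 g)\<^sup>2 \<le> 1"
      by (auto simp: t_def field_simps add_pos_nonneg)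
    define c where "c = complex_of_real t * ip ?h g"
    have "(n2 ?h)\<^sup>2 \<le> (n2 (\<lambda>z. ?h z - c * g z))\<^sup>2"
      using hd dh[OF linear_subspaceD(3)[OF S(1) g, of c]] by (rule order_trans)
    also have "\<dots> = (n2 ?h)\<^sup>2 - 2 * Re (cnj c * ip ?h g) + (cmod c * n2 g)\<^sup>2"
      by (simp only: n2_sq_diff[OF h L2_cmult[OF gL]] ip_cmult_right n2_cmult)
    also have "Re (cnj c * ip ?h g) = t * (cmod (ip ?h g))\<^sup>2"
      by (simp only: cmod_power2) (simp add: c_def mult.assoc power2_eq_square algebra_simps)
    also have "(cmod c * n2 g)\<^sup>2 = t * (cmod (ip ?h g))\<^sup>2 * (t * (n2 g)\<^sup>2)"
      using t0 by (simp add: c_def norm_mult power2_eq_square)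
    finally have "2 * (t * (cmod (ip ?h g))\<^sup>2) \<le> t * (cmod (ip ?h g))\<^sup>2 * (t * (n2 g)\<^sup>2)" by simp
    also have "\<dots> \<le> t * (cmod (ip ?h g))\<^sup>2 * 1"
      using t0 by (intro mult_left_mono) auto
    finally have "t * (cmod (ip ?h g))\<^sup>2 \<le> 0" by simp
    then show ?thesis using t0 by (simp add: mult_le_0_iff)
  qed
  then show ?thesis using pcl by auto
qed

section \<open>L2-closures and linear spans\<close>

lemma cl2I: "f \<in> L2 \<Longrightarrow> (\<And>e. e > 0 \<Longrightarrow> \<exists>g\<in>S. n2 (\<lambda>z. f z - g z) < e) \<Longrightarrow> f \<in> cl2 S"
  by (simp add: cl2_def)

lemma cl2_L2: "f \<in> cl2 S \<Longrightarrow> f \<in> L2"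
  by (simp add: cl2_def)

lemma cl2D: "f \<in> cl2 S \<Longrightarrow> e > 0 \<Longrightarrow> \<exists>g\<in>S. n2 (\<lambda>z. f z - g z) < e"
  by (simp add: cl2_def)

lemma subset_cl2: "S \<subseteq> L2 \<Longrightarrow> S \<subseteq> cl2 S"
  by (auto simp: cl2_def intro!: bexI)

lemma cl2_mono: "S \<subseteq> S' \<Longrightarrow> cl2 S \<subseteq> cl2 S'"
  unfolding cl2_def by blast

lemma cl2_AE:
  assumes "f \<in> cl2 S" "g \<in> borel_measurable borel" "AE z in mT. f z = g z" "S \<subseteq> L2"
  shows "g \<in> cl2 S"
proof (rule cl2I)
  have f: "f \<in> L2" using assms cl2_L2 by auto
  then show "g \<in> L2" using L2_cong_AE assms by blast
  fix e :: real assume "e > 0"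
  then obtain h where h: "h \<in> S" "n2 (\<lambda>z. f z - h z) < e" using cl2D[OF assms(1)] by blast
  have "n2 (\<lambda>z. g z - h z) = n2 (\<lambda>z. f z - h z)"
    by (rule n2_cong_AE) (use assms h f in \<open>auto elim: eventually_mono dest!: L2_measurable\<close>)
  then show "\<exists>h\<in>S. n2 (\<lambda>z. g z - h z) < e" using h by (intro bexI[of _ h]) simp_all
qed

lemma cl2_cl2:
  assumes S: "S \<subseteq> L2" shows "cl2 (cl2 S) = cl2 S"
proof
  show "cl2 S \<subseteq> cl2 (cl2 S)" by (rule subset_cl2) (auto simp: cl2_L2)
  show "cl2 (cl2 S) \<subseteq> cl2 S"
  proof
    fix f assume f: "f \<in> cl2 (cl2 S)"
    show "f \<in> cl2 S"
    proof (rule cl2I)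
      show fL: "f \<in> L2" using f cl2_L2 by blast
      fix e :: real assume e: "e > 0"
      then obtain g where g: "g \<in> cl2 S" "n2 (\<lambda>z. f z - g z) < e/2" using cl2D[OF f, of "e/2"] by auto
      then obtain h where h: "h \<in> S" "n2 (\<lambda>z. g z - h z) < e/2" using cl2D[OF g(1), of "e/2"] e by auto
      have "n2 (\<lambda>z. f z - h z) \<le> n2 (\<lambda>z. f z - g z) + n2 (\<lambda>z. g z - h z)"
        by (rule n2_triangle3) (use fL g h S cl2_L2 in auto)
      then show "\<exists>h\<in>S. n2 (\<lambda>z. f z - h z) < e" using g h by (intro bexI[of _ h]) auto
    qed
  qed
qed

lemma cl2_mult:
  assumes f: "f \<in> cl2 S" and S: "S \<subseteq> L2" and b: "b \<in> borel_measurable borel" "AE z in mT. cmod (b z) \<le> C"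
    and SS: "\<And>g. g \<in> S \<Longrightarrow> (\<lambda>z. b z * g z) \<in> S'"
  shows "(\<lambda>z. b z * f z) \<in> cl2 S'"
proof (rule cl2I)
  have fL: "f \<in> L2" using f cl2_L2 by blast
  show "(\<lambda>z. b z * f z) \<in> L2" using L2_mult_bounded[OF fL b] .
  fix e :: real assume e: "e > 0"
  \<comment> \<open>Enlarged to be positive, since it serves as a divisor.\<close>
  define C' where "C' = \<bar>C\<bar> + 1"
  have C': "C' > 0" "AE z in mT. cmod (b z) \<le> C'"
    using b(2) by (auto simp: C'_def elim!: eventually_mono)
  obtain g where g: "g \<in> S" "n2 (\<lambda>z. f z - g z) < e / C'" using cl2D[OF f, of "e/C'"] e C' by auto
  have "n2 (\<lambda>z. b z * (f z - g z)) \<le> C' * n2 (\<lambda>z. f z - g z)"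
    by (rule n2_mult_bounded) (use fL g S b C' L2_diff in auto)
  also have "\<dots> < e" using g C' by (simp add: field_simps)
  finally have "n2 (\<lambda>z. b z * f z - b z * g z) < e" by (simp add: algebra_simps)
  then show "\<exists>h\<in>S'. n2 (\<lambda>z. b z * f z - h z) < e" using SS[OF g(1)] by auto
qed

lemma cl2_subspace:
  assumes S: "linear_subspace S" "S \<subseteq> L2" shows "linear_subspace (cl2 S)"
  unfolding linear_subspace_def
proof (intro conjI ballI allI)
  show "(\<lambda>z. 0) \<in> cl2 S" using subset_cl2[OF S(2)] linear_subspaceD(1)[OF S(1)] by auto
  show "(\<lambda>z. c * f z) \<in> cl2 S" if "f \<in> cl2 S" for f c
    by (rule cl2_mult[OF that S(2), where C="cmod c"]) (auto intro: linear_subspaceD[OF S(1)])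
  fix f g assume fg: "f \<in> cl2 S" "g \<in> cl2 S"
  then have L: "f \<in> L2" "g \<in> L2" using cl2_L2 by auto
  show "(\<lambda>z. f z + g z) \<in> cl2 S"
  proof (rule cl2I)
    show "(\<lambda>z. f z + g z) \<in> L2" using L by (rule L2_add)
    fix e :: real assume e: "e > 0"
    obtain a where a: "a \<in> S" "n2 (\<lambda>z. f z - a z) < e/2" using cl2D[OF fg(1), of "e/2"] e by auto
    obtain b where b: "b \<in> S" "n2 (\<lambda>z. g z - b z) < e/2" using cl2D[OF fg(2), of "e/2"] e by auto
    have "n2 (\<lambda>z. (f z - a z) + (g z - b z)) \<le> n2 (\<lambda>z. f z - a z) + n2 (\<lambda>z. g z - b z)"
      by (intro n2_triangle L2_diff) (use L a b S in auto)
    then have "n2 (\<lambda>z. (f z + g z) - (a z + b z)) < e" using a b by (simp add: algebra_simps)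
    then show "\<exists>h\<in>S. n2 (\<lambda>z. f z + g z - h z) < e" using linear_subspaceD(2)[OF S(1) a(1) b(1)] by auto
  qed
qed

lemma cl2_ip_zero:
  assumes f: "f \<in> cl2 S" and S: "S \<subseteq> L2" and h: "h \<in> L2" and z: "\<And>g. g \<in> S \<Longrightarrow> ip g h = 0"
  shows "ip f h = 0"
proof -
  have fL: "f \<in> L2" using f cl2_L2 by blast
  have "cmod (ip f h) \<le> 0 + e" if e: "e > 0" for e
  proof -
    obtain g where g: "g \<in> S" "n2 (\<lambda>z. f z - g z) < e / (n2 h + 1)"
      using cl2D[OF f, of "e / (n2 h + 1)"] e by (auto simp: add_nonneg_pos)
    then have gL: "g \<in> L2" using S by auto
    have "ip f h = ip (\<lambda>z. f z - g z) h" using z[OF g(1)] by (simp add: ip_diff_left fL gL h)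
    then have "cmod (ip f h) \<le> n2 (\<lambda>z. f z - g z) * n2 h"
      using L2_Cauchy_Schwarz[OF L2_diff[OF fL gL] h] by simp
    also have "\<dots> \<le> e / (n2 h + 1) * (n2 h + 1)" using g e by (intro mult_mono) auto
    also have "\<dots> = e" using add_nonneg_pos[OF n2_nonneg[of h] zero_less_one] by simp
    finally show ?thesis by simp
  qed
  then have "cmod (ip f h) \<le> 0" by (rule field_le_epsilon)
  then show ?thesis by simp
qed

text \<open>The complex linear span, built by adding one scaled generator at a time: each induction
  step for a linear statement then concerns a single generator.\<close>

inductive_set cspan :: "(complex \<Rightarrow> complex) set \<Rightarrow> (complex \<Rightarrow> complex) set" for G where
  zero: "(\<lambda>z. 0) \<in> cspan G"
| add: "f \<in> cspan G \<Longrightarrow> g \<in> G \<Longrightarrow> (\<lambda>z. f z + c * g z) \<in> cspan G"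

lemma cspan_base: "g \<in> G \<Longrightarrow> g \<in> cspan G"
  using cspan.add[OF cspan.zero, of g G 1] by simp

lemma cspan_subspace: "linear_subspace (cspan G)"
  unfolding linear_subspace_def
proof (intro conjI ballI allI)
  show "(\<lambda>z. 0) \<in> cspan G" by (rule cspan.zero)
  show "(\<lambda>z. f z + g z) \<in> cspan G" if "f \<in> cspan G" "g \<in> cspan G" for f g
    using that(2)
  proof induction
    case (add h g c)
    have "(\<lambda>z. (f z + h z) + c * g z) \<in> cspan G" by (rule cspan.add) (use add in auto)
    then show ?case by (simp add: add.assoc)
  qed (use that in simp)
  show "(\<lambda>z. c * f z) \<in> cspan G" if "f \<in> cspan G" for f c
    using that
  proof induction
    case (add f g d)
    have "(\<lambda>z. c * f z + (c * d) * g z) \<in> cspan G" by (rule cspan.add) (use add in auto)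
    then show ?case by (simp add: algebra_simps)
  qed (simp add: cspan.zero)
qed

lemma cspan_least: "linear_subspace S \<Longrightarrow> G \<subseteq> S \<Longrightarrow> cspan G \<subseteq> S"
proof
  fix f assume "linear_subspace S" "G \<subseteq> S" "f \<in> cspan G"
  from this(3,1,2) show "f \<in> S"
  proof induction
    case (add f g c)
    then have "f \<in> S" "(\<lambda>z. c * g z) \<in> S" using linear_subspaceD(3) by auto
    then show ?case using linear_subspaceD(2)[OF add(4)] by auto
  qed (simp add: linear_subspaceD)
qed

lemma cspan_mult_image:
  assumes "f \<in> cspan G" "linear_subspace S" "\<And>g. g \<in> G \<Longrightarrow> (\<lambda>z. b z * g z) \<in> S"
  shows "(\<lambda>z. b z * f z) \<in> S"
  using assms(1)
proof induction
  case (add f g c)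
  have "(\<lambda>z. b z * f z + c * (b z * g z)) \<in> S"
    using linear_subspaceD(2)[OF assms(2) add.IH linear_subspaceD(3)[OF assms(2) assms(3)[OF add(2)]]] .
  then show ?case by (simp add: algebra_simps)
qed (simp add: linear_subspaceD[OF assms(2)])

lemma cspan_mult_closed:
  assumes "f \<in> cspan G" "h \<in> cspan G" "\<And>g g'. g \<in> G \<Longrightarrow> g' \<in> G \<Longrightarrow> (\<lambda>z. g z * g' z) \<in> cspan G"
  shows "(\<lambda>z. f z * h z) \<in> cspan G"
proof (rule cspan_mult_image[OF assms(2) cspan_subspace])
  fix g assume g: "g \<in> G"
  have "(\<lambda>z. g z * f z) \<in> cspan G"
    by (rule cspan_mult_image[OF assms(1) cspan_subspace]) (rule assms(3)[OF g])
  then show "(\<lambda>z. f z * g z) \<in> cspan G" by (simp add: mult.commute)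
qed

lemma L2_subspace: "linear_subspace L2"
  using L2_const[of 0] L2_add L2_cmult by (simp add: linear_subspace_def)

lemma cspan_L2: "G \<subseteq> L2 \<Longrightarrow> cspan G \<subseteq> L2"
  by (rule cspan_least[OF L2_subspace])

section \<open>Uniqueness of Fourier coefficients\<close>

definition trig_monomials :: "(complex \<Rightarrow> complex) set" where
  "trig_monomials = {\<lambda>z. z ^ j * cnj z ^ k | j k. True}"

text \<open>\<open>Re\<close> and \<open>Im\<close> are combinations of z and its conjugate, and the
  monomials are closed under products. This makes the Stone-Weierstrass theorem for real polynomials
  applicable to moment conditions.\<close>

lemma real_polynomial_function_trig:
  "real_polynomial_function p \<Longrightarrow> (\<lambda>z. complex_of_real (p z)) \<in> cspan trig_monomials"
proof (induction rule: real_polynomial_function.induct)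
  have m: "(\<lambda>z. z ^ j * cnj z ^ k) \<in> cspan trig_monomials" for j k
    by (rule cspan_base) (auto simp: trig_monomials_def)
  note sub = linear_subspaceD[OF cspan_subspace]
  {
    case (linear f)
    then interpret bounded_linear f .
    have "complex_of_real (f z) =
      (f 1 / 2 - \<i> * f \<i> / 2) * (z ^ 1 * cnj z ^ 0) + (f 1 / 2 + \<i> * f \<i> / 2) * (z ^ 0 * cnj z ^ 1)" for z
    proof -
      have "f z = f (Re z *\<^sub>R 1 + Im z *\<^sub>R \<i>)"
        by (rule arg_cong[of _ _ f]) (simp add: complex_eq_iff)
      also have "\<dots> = Re z * f 1 + Im z * f \<i>" by (simp only: add scaleR real_scaleR_def)
      finally show ?thesis by (simp add: complex_eq_iff field_simps)
    qed
    then have "(\<lambda>z. complex_of_real (f z)) = (\<lambda>z.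
      (f 1 / 2 - \<i> * f \<i> / 2) * (z ^ 1 * cnj z ^ 0) + (f 1 / 2 + \<i> * f \<i> / 2) * (z ^ 0 * cnj z ^ 1))"
      by (rule ext)
    then show ?case
      using sub(2)[OF sub(3)[OF m[of 1 0], of "f 1 / 2 - \<i> * f \<i> / 2"] sub(3)[OF m[of 0 1], of "f 1 / 2 + \<i>
          * f \<i> / 2"]]
      by metis
  next
    case (const c)
    show ?case using sub(3)[OF m[of 0 0], of "complex_of_real c"] by simp
  next
    case (add f g)
    then show ?case using sub(2) by simp
  next
    case (mult f g)
    have "(\<lambda>z. complex_of_real (f z) * complex_of_real (g z)) \<in> cspan trig_monomials"
    proof (rule cspan_mult_closed[OF mult.IH])
      fix g g' assume "g \<in> trig_monomials" "g' \<in> trig_monomials"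
      then obtain j k j' k' where "g = (\<lambda>z. z ^ j * cnj z ^ k)" "g' = (\<lambda>z. z ^ j' * cnj z ^ k')"
        by (auto simp: trig_monomials_def)
      then have "(\<lambda>z. g z * g' z) = (\<lambda>z. z ^ (j + j') * cnj z ^ (k + k'))"
        by (simp add: power_add mult_ac)
      then show "(\<lambda>z. g z * g' z) \<in> cspan trig_monomials" by (simp only: m)
    qed
    then show ?case by simp
  }
qed

definition circle_bounded :: "(complex \<Rightarrow> complex) \<Rightarrow> bool" where
  "circle_bounded f \<longleftrightarrow> f \<in> borel_measurable borel \<and> (\<exists>C. \<forall>z. cmod z = 1 \<longrightarrow> cmod (f z) \<le> C)"

text \<open>Stated for an abstract functional, so that it applies both to a density against the circle
  measure and to the difference of the circle measure and an image of it.\<close>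

lemma functional_zero_on_indicators:
  fixes \<Lambda> :: "(complex \<Rightarrow> complex) \<Rightarrow> complex"
  assumes add: "\<And>f g. circle_bounded f \<Longrightarrow> circle_bounded g \<Longrightarrow> \<Lambda> (\<lambda>z. f z + g z) = \<Lambda> f + \<Lambda> g"
    and cmult: "\<And>f c. circle_bounded f \<Longrightarrow> \<Lambda> (\<lambda>z. c * f z) = c * \<Lambda> f"
    and conv: "\<And>F f C. (\<And>k. F k \<in> borel_measurable borel) \<Longrightarrow> f \<in> borel_measurable borel \<Longrightarrow>
       (\<And>k z. cmod z = 1 \<Longrightarrow> cmod (F k z) \<le> C) \<Longrightarrow>
       (\<And>z. cmod z = 1 \<Longrightarrow> (\<lambda>k::nat. F k z) \<longlonglongrightarrow> f z) \<Longrightarrow> (\<lambda>k. \<Lambda> (F k)) \<longlonglongrightarrow> \<Lambda> f"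
    and moments: "\<And>j k. \<Lambda> (\<lambda>z. z ^ j * cnj z ^ k) = 0"
    and A: "A \<in> sets borel"
  shows "\<Lambda> (indicator A) = 0"
proof -
  have m_bd: "circle_bounded g" if "g \<in> trig_monomials" for g
    using that by (auto simp: trig_monomials_def circle_bounded_def norm_mult norm_power)
  have zero: "\<Lambda> (\<lambda>z. 0) = 0" using cmult[of "\<lambda>z. 0" 0] by (auto simp: circle_bounded_def)
  have bd_add: "circle_bounded (\<lambda>z. f z + g z)" if "circle_bounded f" "circle_bounded g" for f g
  proof -
    from that obtain C D where "\<forall>z. cmod z = 1 \<longrightarrow> cmod (f z) \<le> C" "\<forall>z. cmod z = 1 \<longrightarrow> cmod (g z) \<le> D"
      by (auto simp: circle_bounded_def)
    then have "\<forall>z. cmod z = 1 \<longrightarrow> cmod (f z + g z) \<le> C + D" by (meson norm_triangle_mono)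
    then show ?thesis using that by (auto simp: circle_bounded_def)
  qed
  have bd_cmult: "circle_bounded (\<lambda>z. c * f z)" if "circle_bounded f" for f c
  proof -
    from that obtain C where "\<forall>z. cmod z = 1 \<longrightarrow> cmod (f z) \<le> C"
      by (auto simp: circle_bounded_def)
    then have "\<forall>z. cmod z = 1 \<longrightarrow> cmod (c * f z) \<le> cmod c * C" by (auto simp: norm_mult mult_left_mono)
    then show ?thesis using that by (auto simp: circle_bounded_def)
  qed
  have trig: "circle_bounded f \<and> \<Lambda> f = 0" if "f \<in> cspan trig_monomials" for f
    using that
  proof induction
    case zero
    then show ?case using \<open>\<Lambda> (\<lambda>z. 0) = 0\<close> by (auto simp: circle_bounded_def)
  next
    case (add f g c)
    have "\<Lambda> g = 0" using add(2) moments by (auto simp: trig_monomials_def)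
    then show ?case using add m_bd[OF add(2)] bd_add[OF _ bd_cmult] \<open>\<And>f g. _ \<Longrightarrow> _ \<Longrightarrow> \<Lambda> (\<lambda>z. f z + g z)
        = _\<close> cmult bd_cmult
      by auto
  qed
  \<comment> \<open>Polynomial approximation is uniform only on the circle, which is all that the
    hypothesis \<open>conv\<close> looks at.\<close>
  have cont: "\<Lambda> (\<lambda>z. complex_of_real (\<phi> z)) = 0" if c: "continuous_on UNIV \<phi>" for \<phi> :: "complex \<Rightarrow> real"
  proof -
    have cs: "continuous_on (sphere 0 1) \<phi>" using c continuous_on_subset by blast
    have "\<exists>p. real_polynomial_function p \<and> (\<forall>z. cmod z = 1 \<longrightarrow> \<bar>\<phi> z - p z\<bar> < inverse (real (Suc k)))" for k
      by (rule Stone_Weierstrass_real_polynomial_function[OF compact_sphere cs, of "inverse (real (Suc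
          k))"]) auto
    then obtain p where p: "\<And>k. real_polynomial_function (p k)"
      and pb: "\<And>k z. cmod z = 1 \<Longrightarrow> \<bar>\<phi> z - p k z\<bar> < inverse (real (Suc k))" by metis
    obtain C where "\<forall>x\<in>\<phi> ` sphere 0 1. norm x \<le> C"
      using compact_imp_bounded[OF compact_continuous_image[OF cs compact_sphere]] unfolding bounded_iff ..
    then have C: "\<bar>\<phi> z\<bar> \<le> C" if "cmod z = 1" for z using that by simp
    have mp: "p k \<in> borel_measurable borel" for k
      by (rule borel_measurable_continuous_onI)
         (use continuous_on_polymonial_function p real_polynomial_function_eq in blast)
    have "(\<lambda>k. \<Lambda> (\<lambda>z. complex_of_real (p k z))) \<longlonglongrightarrow> \<Lambda> (\<lambda>z. complex_of_real (\<phi> z))"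
    proof (rule conv[where C="C+1"])
      show "(\<lambda>z. complex_of_real (\<phi> z)) \<in> borel_measurable borel"
        using borel_measurable_continuous_onI[OF c] by measurable
      show "(\<lambda>z. complex_of_real (p k z)) \<in> borel_measurable borel" for k
        using mp[of k] by measurable
      show "cmod (complex_of_real (p k z)) \<le> C + 1" if "cmod z = 1" for k z
      proof -
        have "inverse (real (Suc k)) \<le> 1" by (simp add: inverse_eq_divide)
        then show ?thesis using pb[OF that, of k] C[OF that] by (simp only: norm_of_real)
      qed
      show "(\<lambda>k. complex_of_real (p k z)) \<longlonglongrightarrow> complex_of_real (\<phi> z)" if "cmod z = 1" for z
      proof (intro tendsto_of_real)
        have "(\<lambda>k. p k z - \<phi> z) \<longlonglongrightarrow> 0"
          by (rule Lim_null_comparison[OF _ LIMSEQ_inverse_real_of_nat])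
             (use pb[OF that] in \<open>auto simp: abs_minus_commute less_imp_le\<close>)
        then show "(\<lambda>k. p k z) \<longlonglongrightarrow> \<phi> z" by (simp add: LIM_zero_iff)
      qed
    qed
    moreover have "\<Lambda> (\<lambda>z. complex_of_real (p k z)) = 0" for k
      using trig real_polynomial_function_trig[OF p] by blast
    ultimately show ?thesis by (simp add: LIMSEQ_const_iff)
  qed
  \<comment> \<open>The continuous cutoffs \<open>1 - k * infdist z A\<close>, truncated at 0,
    decrease to the indicator.\<close>
  have closed: "\<Lambda> (indicator A) = 0" if A: "closed A" for A
  proof (cases "A = {}")
    case True
    have "(indicator {} :: complex \<Rightarrow> complex) = (\<lambda>z. 0)" by auto
    then show ?thesis using True zero by simp
  next
    case False
    let ?\<phi> = "\<lambda>k z. max 0 (1 - real k * infdist z A)"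
    have "(\<lambda>k. \<Lambda> (\<lambda>z. complex_of_real (?\<phi> k z))) \<longlonglongrightarrow> \<Lambda> (indicator A)"
    proof (rule conv[where C=1])
      show "(\<lambda>z. complex_of_real (?\<phi> k z)) \<in> borel_measurable borel" for k
        by (intro borel_measurable_continuous_onI continuous_intros)
      show "indicator A \<in> borel_measurable borel" using borel_closed[OF A]
          by (rule borel_measurable_indicator)
      show "cmod (complex_of_real (?\<phi> k z)) \<le> 1" for k z
        using infdist_nonneg[of z A] by (auto simp: abs_if max_def)
      show "(\<lambda>k. complex_of_real (?\<phi> k z)) \<longlonglongrightarrow> indicator A z" for z
      proof (cases "z \<in> A")
        case True
        then show ?thesis using False A by simp
      next
        case z: False
        then have pos: "infdist z A > 0"
          using in_closed_iff_infdist_zero[OF A False] infdist_nonneg[of z A] by (metis less_eq_real_def)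
        have "eventually (\<lambda>k. complex_of_real (?\<phi> k z) = 0) sequentially"
        proof -
          obtain N where N: "real N * infdist z A > 1" using reals_Archimedean3[OF pos] by blast
          have "complex_of_real (?\<phi> k z) = 0" if "k \<ge> N" for k
          proof -
            have "real N * infdist z A \<le> real k * infdist z A" using that pos by (intro mult_right_mono) auto
            then show ?thesis using N by simp
          qed
          then show ?thesis by (auto simp: eventually_sequentially)
        qed
        then show ?thesis using z by (simp add: tendsto_eventually)
      qed
    qed
    moreover have "\<Lambda> (\<lambda>z. complex_of_real (?\<phi> k z)) = 0" for k
      by (intro cont continuous_intros)
    ultimately show ?thesis by (simp only: LIMSEQ_const_iff)
  qed
  have ind_bd: "circle_bounded (indicator A)" if "A \<in> sets borel" for A
    using that by (auto simp: circle_bounded_def indicator_def intro!: exI[of _ 1])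
  have sb: "sigma_sets UNIV {A :: complex set. closed A} = sets borel" by (simp add: borel_eq_closed)
  \<comment> \<open>Closed sets form an intersection-stable generator, so complements and disjoint
    unions reach every Borel set.\<close>
  have "Int_stable {A :: complex set. closed A}" "{A :: complex set. closed A} \<subseteq> Pow UNIV"
    "A \<in> sigma_sets UNIV {A. closed A}"
    using A by (auto simp: Int_stable_def sb)
  then show ?thesis
  proof (induction rule: sigma_sets_induct_disjoint)
    case (basic A)
    then show ?case using closed by simp
  next
    case empty
    show ?case by (rule closed) simp
  next
    case (compl A)
    have "\<Lambda> (indicator UNIV) = \<Lambda> (\<lambda>z. indicator A z + indicator (UNIV - A) z)"
      by (rule arg_cong[of _ _ \<Lambda>]) (auto simp: indicator_def fun_eq_iff)
    also have "\<dots> = \<Lambda> (indicator A) + \<Lambda> (indicator (UNIV - A))"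
      by (rule add) (use compl sb in \<open>auto intro!: ind_bd\<close>)
    finally show ?case using compl closed[of UNIV] by simp
  next
    case (union A)
    have Ab[measurable]: "A i \<in> sets borel" for i using union(2) sb by auto
    have "(\<lambda>k. \<Lambda> (\<lambda>z. \<Sum>i<k. indicator (A i) z)) \<longlonglongrightarrow> \<Lambda> (indicator (\<Union>i. A i))"
    proof (rule conv[where C=1])
      show "(\<lambda>z. \<Sum>i<k. indicator (A i) z :: complex) \<in> borel_measurable borel" for k
          by (intro borel_measurable_sum borel_measurable_indicator Ab)
      show "indicator (\<Union>i. A i) \<in> borel_measurable borel" by measurable
      have eq: "(\<Sum>i<k. indicator (A i) z) = (indicator (\<Union>i<k. A i) z :: complex)" for k z
        using union(1) by (subst indicator_UN_disjoint) (auto simp: disjoint_family_on_def)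
      show "cmod (\<Sum>i<k. indicator (A i) z) \<le> 1" for k z by (simp only: eq) (simp add: indicator_def)
      show "(\<lambda>k. \<Sum>i<k. indicator (A i) z) \<longlonglongrightarrow> (indicator (\<Union>i. A i) z :: complex)" for z
        unfolding eq by (rule LIMSEQ_indicator_UN)
    qed
    moreover have "circle_bounded (\<lambda>z. \<Sum>i<k. indicator (A i) z) \<and> \<Lambda> (\<lambda>z. \<Sum>i<k. indicator (A i) z) = 0" for k
    proof (induction k)
      case 0
      then show ?case using zero by (auto simp: circle_bounded_def)
    next
      case (Suc k)
      then show ?case using add[of _ "indicator (A k)"] bd_add ind_bd[OF Ab[of k]] union(3)[of k] by auto
    qed
    ultimately show ?case by (simp add: LIMSEQ_const_iff)
  qed
qed

lemma integrable_mult_circle_bounded: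
  assumes f: "integrable mT f" and g: "circle_bounded g"
  shows "integrable mT (\<lambda>z. f z * g z)"
proof -
  obtain C where C: "\<And>z. cmod z = 1 \<Longrightarrow> cmod (g z) \<le> C" using g by (auto simp: circle_bounded_def)
  have [measurable]: "g \<in> borel_measurable borel" "f \<in> borel_measurable borel"
    using g borel_measurable_integrable[OF f] by (auto simp: circle_bounded_def)
  have "integrable mT (\<lambda>z. C * cmod (f z))" using f by auto
  then show ?thesis
    by (rule Bochner_Integration.integrable_bound)
       (auto intro!: AE_mT simp: norm_mult mult.commute[of "cmod (f _)"] intro: order_trans[OF
           mult_right_mono[OF C]])
qed

text \<open>Uniqueness of Fourier coefficients in L1. Vanishing moments force vanishing integrals
  over all Borel sets; real and imaginary part are then tested on the sets where they have a fixed
  sign.\<close>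

lemma AE_zero_if_moments_zero:
  assumes f: "integrable mT f"
    and m: "\<And>j k. integral\<^sup>L mT (\<lambda>z. f z * (z ^ j * cnj z ^ k)) = 0"
  shows "AE z in mT. f z = 0"
proof -
  have [measurable]: "f \<in> borel_measurable borel" using borel_measurable_integrable[OF f] by simp
  have ind: "integral\<^sup>L mT (\<lambda>z. f z * indicator A z) = 0" if "A \<in> sets borel" for A
  proof (rule functional_zero_on_indicators[where \<Lambda>="\<lambda>\<phi>. integral\<^sup>L mT (\<lambda>z. f z * \<phi> z)"])
    fix F :: "nat \<Rightarrow> complex \<Rightarrow> complex" and g C
    assume [measurable]: "\<And>k. F k \<in> borel_measurable borel" "g \<in> borel_measurable borel"
      and b: "\<And>k z. cmod z = 1 \<Longrightarrow> cmod (F k z) \<le> C"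
      and l: "\<And>z. cmod z = 1 \<Longrightarrow> (\<lambda>k. F k z) \<longlonglongrightarrow> g z"
    show "(\<lambda>k. integral\<^sup>L mT (\<lambda>z. f z * F k z)) \<longlonglongrightarrow> integral\<^sup>L mT (\<lambda>z. f z * g z)"
      by (rule integral_dominated_convergence[where w="\<lambda>z. cmod (f z) * C"])
         (use f b l in \<open>auto intro!: AE_mT tendsto_intros mult_left_mono simp: norm_mult\<close>)
  qed (use m that in \<open>auto simp: distrib_left mult.left_commute integrable_mult_circle_bounded[OF f]\<close>)
  have pos: "AE z in mT. h z = 0" if [measurable]: "h \<in> borel_measurable borel" and hi: "integrable mT h"
    and h: "\<And>A. A \<in> sets borel \<Longrightarrow> integral\<^sup>L mT (\<lambda>z. h z * indicator A z) = 0" for h :: "complex \<Rightarrow> real"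
  proof -
    let ?P = "{z. h z \<ge> 0}" and ?N = "{z. h z \<le> 0}"
    have PN: "?P \<in> sets borel" "?N \<in> sets borel" by measurable
    have i: "integrable mT (\<lambda>z. h z * indicator A z)" if "A \<in> sets borel" for A
      using integrable_real_mult_indicator[of A mT h] that hi by simp
    have "AE z in mT. h z * indicator ?P z = 0"
      using integral_nonneg_eq_0_iff_AE[OF i[OF PN(1)]] h[OF PN(1)] by (auto simp: indicator_def)
    moreover have "AE z in mT. - (h z * indicator ?N z) = 0"
      using integral_nonneg_eq_0_iff_AE[OF Bochner_Integration.integrable_minus[OF i[OF PN(2)]]] h[OF PN(2)]
      by (auto simp: indicator_def)
    ultimately show ?thesis by eventually_elim (auto simp: indicator_def split: if_splits)
  qed
  have fi: "integrable mT (\<lambda>z. f z * indicator A z)" if "A \<in> sets borel" for A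
    using that by (intro integrable_mult_circle_bounded f) (auto simp: circle_bounded_def indicator_def
        intro!: exI[of _ 1])
  have "AE z in mT. Re (f z) = 0"
  proof (rule pos)
    fix A :: "complex set" assume A: "A \<in> sets borel"
    have "integral\<^sup>L mT (\<lambda>z. Re (f z * indicator A z)) = 0" using ind[OF A] integral_Re[OF fi[OF A]] by simp
    moreover have "Re (f z * indicator A z) = Re (f z) * indicator A z" for z by (auto simp: indicator_def)
    ultimately show "integral\<^sup>L mT (\<lambda>z. Re (f z) * indicator A z) = 0" by simp
  qed (use f in auto)
  moreover have "AE z in mT. Im (f z) = 0"
  proof (rule pos)
    fix A :: "complex set" assume A: "A \<in> sets borel"
    have "integral\<^sup>L mT (\<lambda>z. Im (f z * indicator A z)) = 0" using ind[OF A] integral_Im[OF fi[OF A]] by simp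
    moreover have "Im (f z * indicator A z) = Im (f z) * indicator A z" for z by (auto simp: indicator_def)
    ultimately show "integral\<^sup>L mT (\<lambda>z. Im (f z) * indicator A z) = 0" by simp
  qed (use f in auto)
  ultimately show ?thesis by eventually_elim (simp add: complex_eq_iff)
qed

lemma unimodular_power_cases:
  assumes "cmod w = 1"
  shows "w ^ j * cnj w ^ k = (if k \<le> j then w ^ (j - k) else cnj w ^ (k - j))"
proof -
  have 1: "w * cnj w = 1" using assms by (simp add: complex_norm_square[symmetric])
  have 2: "w ^ i * cnj w ^ i = 1" for i by (simp add: power_mult_distrib[symmetric] 1)
  show ?thesis
  proof (cases "k \<le> j")
    case True
    then have "w ^ j * cnj w ^ k = w ^ (j - k) * (w ^ k * cnj w ^ k)"
        by (simp add: power_add[symmetric] flip: mult.assoc)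
    then show ?thesis using True 2 by simp
  next
    case False
    then have "w ^ j * cnj w ^ k = cnj w ^ (k - j) * (w ^ j * cnj w ^ j)" 
      by (metis (no_types, lifting) le_add_diff_inverse2 mult.commute mult.left_commute nat_le_linear
          power_add)
    then show ?thesis using False 2 by simp
  qed
qed

text \<open>Conjugation supplies the negative powers, so the image measure and \<open>mT\<close>
  have the same moments. Unimodularity at every point, not only almost everywhere, lets values on
  the circle control compositions with \<open>u\<close>.\<close>

lemma measure_preserving_if_moments_zero:
  assumes [measurable]: "u \<in> borel_measurable borel" and u: "\<And>z. cmod (u z) = 1"
    and m: "\<And>k. k \<ge> 1 \<Longrightarrow> integral\<^sup>L mT (\<lambda>z. u z ^ k) = 0"
  shows "distr mT borel u = mT"
proof (rule measure_eqI)
  let ?L = "\<lambda>\<phi>. integral\<^sup>L mT (\<lambda>z. \<phi> (u z)) - integral\<^sup>L mT (\<lambda>z. \<phi> z) :: complex"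
  have i1: "integrable mT (\<lambda>z. g (u z))" if g: "circle_bounded g" for g
  proof -
    obtain C where C: "\<And>z. cmod z = 1 \<Longrightarrow> cmod (g z) \<le> C" using g by (auto simp: circle_bounded_def)
    have [measurable]: "g \<in> borel_measurable borel" using g by (auto simp: circle_bounded_def)
    show ?thesis by (rule mT.integrable_const_bound[where B=C]) (use C u in auto)
  qed
  have i2: "integrable mT g" if g: "circle_bounded g" for g
    using integrable_mult_circle_bounded[OF _ g, of "\<lambda>z. 1"] by simp
  \<comment> \<open>Applied to \<open>u\<close> and to the identity, so that both sides of the
    comparison get the same mixed moments.\<close>
  have um: "integral\<^sup>L mT (\<lambda>z. v z ^ j * cnj (v z) ^ k) = (if j = k then 1 else 0)"
    if [measurable]: "v \<in> borel_measurable borel" and v: "AE z in mT. cmod (v z) = 1" and m: "\<And>k. k \<ge> 1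
        \<Longrightarrow> integral\<^sup>L mT (\<lambda>z. v z ^ k) = 0" for v j k
  proof -
    have "integral\<^sup>L mT (\<lambda>z. v z ^ j * cnj (v z) ^ k) = integral\<^sup>L mT (\<lambda>z. if k \<le> j then v z ^ (j
        - k) else cnj (v z ^ (k - j)))"
      by (rule integral_cong_AE) (use v unimodular_power_cases in \<open>auto elim!: eventually_mono\<close>)
    then show ?thesis
      using m[of "j - k"] m[of "k - j"] by (cases j k rule: linorder_cases) (auto simp del: complex_cnj_power)
  qed
  have ind: "?L (indicator A) = 0" if "A \<in> sets borel" for A
  proof (rule functional_zero_on_indicators[where \<Lambda>="?L"])
    fix F :: "nat \<Rightarrow> complex \<Rightarrow> complex" and g C
    assume [measurable]: "\<And>k. F k \<in> borel_measurable borel" "g \<in> borel_measurable borel"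
      and b: "\<And>k z. cmod z = 1 \<Longrightarrow> cmod (F k z) \<le> C"
      and l: "\<And>z. cmod z = 1 \<Longrightarrow> (\<lambda>k. F k z) \<longlonglongrightarrow> g z"
    have "(\<lambda>k. integral\<^sup>L mT (\<lambda>z. F k (u z))) \<longlonglongrightarrow> integral\<^sup>L mT (\<lambda>z. g (u z))"
      by (rule integral_dominated_convergence[where w="\<lambda>z. C"]) (use b l u in auto)
    moreover have "(\<lambda>k. integral\<^sup>L mT (\<lambda>z. F k z)) \<longlonglongrightarrow> integral\<^sup>L mT (\<lambda>z. g z)"
      by (rule integral_dominated_convergence[where w="\<lambda>z. C"]) (use b l in \<open>auto intro: AE_mT\<close>)
    ultimately show "(\<lambda>k. ?L (F k)) \<longlonglongrightarrow> ?L g" by (rule tendsto_diff)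
  next
    fix j k
    show "?L (\<lambda>z. z ^ j * cnj z ^ k) = 0"
      using um[of u j k] um[of "\<lambda>z. z" j k] u m AE_mT_cmod integral_mT_power by simp
  qed (use that in \<open>auto simp: i1 i2 algebra_simps\<close>)
  fix A assume "A \<in> sets (distr mT borel u)"
  then have A[measurable]: "A \<in> sets borel" by simp
  have "measure mT (u -` A) = integral\<^sup>L mT (\<lambda>z. indicator A (u z) :: real)"
    by (subst indicator_vimage[symmetric]) (use measurable_sets_borel[OF assms(1) A] in simp)
  moreover have "complex_of_real (integral\<^sup>L mT (\<lambda>z. indicator A (u z) :: real))
      = integral\<^sup>L mT (\<lambda>z. indicator A (u z))"
    by (subst integral_complex_of_real[symmetric]) (simp add: of_real_indicator)
  moreover have "complex_of_real (measure mT A) = integral\<^sup>L mT (\<lambda>z. indicator A z)"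
    using integral_complex_of_real[of mT "indicator A"] by (simp add: of_real_indicator)
  ultimately have "measure mT (u -` A) = measure mT A" using ind[OF A]
      by (metis eq_iff_diff_eq_0 of_real_eq_iff)
  then show "emeasure (distr mT borel u) A = emeasure mT A"
    by (simp add: emeasure_distr mT.emeasure_eq_measure)
qed simp

section \<open>The Hardy space of square integrable functions\<close>

text \<open>The Hardy space through its boundary values: the Fourier coefficients of negative index
  vanish.\<close>

definition H2 :: "(complex \<Rightarrow> complex) set" where
  "H2 = {f \<in> L2. \<forall>k\<ge>1. integral\<^sup>L mT (\<lambda>z. f z * z ^ k) = 0}"

lemma H2_L2: "f \<in> H2 \<Longrightarrow> f \<in> L2"
  by (simp add: H2_def)

lemma H2_measurable [measurable_dest]: "f \<in> H2 \<Longrightarrow> f \<in> borel_measurable borel"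
  by (simp add: H2_def L2_def)

lemma H2_moment: "f \<in> H2 \<Longrightarrow> k \<ge> 1 \<Longrightarrow> integral\<^sup>L mT (\<lambda>z. f z * z ^ k) = 0"
  by (simp add: H2_def)

lemma Hinf_iff: "f \<in> Hinf \<longleftrightarrow> f \<in> Linf \<and> f \<in> H2"
  by (auto simp: Hinf_def H2_def Linf_L2)

lemma integral_mT_cong:
  assumes "f \<in> borel_measurable borel" "g \<in> borel_measurable borel" "\<And>z. cmod z = 1 \<Longrightarrow> f z = g z"
  shows "integral\<^sup>L mT f = (integral\<^sup>L mT g :: complex)"
  by (rule integral_cong_AE) (use assms in \<open>auto intro: AE_mT\<close>)

lemma L2_trig: "(\<lambda>z. z ^ j * cnj z ^ k) \<in> L2"
  by (rule L2_bounded[where C=1]) (auto intro!: AE_mT simp: norm_mult norm_power)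

lemma L2_mult_circle:
  assumes f: "f \<in> L2" and b: "b \<in> borel_measurable borel" "\<And>z. cmod z = 1 \<Longrightarrow> cmod (b z) \<le> C"
  shows "(\<lambda>z. b z * f z) \<in> L2" "integrable mT (\<lambda>z. b z * f z)"
proof -
  show "(\<lambda>z. b z * f z) \<in> L2"
    by (rule L2_mult_bounded[OF f b(1), where C=C]) (use b(2) in \<open>auto intro: AE_mT\<close>)
  then show "integrable mT (\<lambda>z. b z * f z)" by (rule L2_integrable)
qed

lemma H2_subspace: "linear_subspace H2"
proof -
  have "integral\<^sup>L mT (\<lambda>z. (f z + g z) * z ^ k) = integral\<^sup>L mT (\<lambda>z. f z * z ^ k) + integral\<^sup>L mT (\<lambda>z. g z
      * z ^ k)"
    if "f \<in> L2" "g \<in> L2" for f g k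
    using L2_mult_integrable(1)[OF that(1) L2_trig[of k 0]] L2_mult_integrable(1)[OF that(2) L2_trig[of k 0]]
    by (simp add: distrib_right)
  then show ?thesis
    unfolding linear_subspace_def H2_def by (auto simp: L2_const L2_add L2_cmult mult.assoc)
qed

lemma H2_cong:
  assumes f: "f \<in> H2" and g: "g \<in> borel_measurable borel" and eq: "AE z in mT. f z = g z"
  shows "g \<in> H2"
proof -
  note [measurable] = f g
  have "integral\<^sup>L mT (\<lambda>z. g z * z ^ k) = integral\<^sup>L mT (\<lambda>z. f z * z ^ k)" for k
    by (rule integral_cong_AE) (use eq in \<open>auto elim!: eventually_mono\<close>)
  then show ?thesis using f L2_cong_AE[OF H2_L2[OF f] g eq] by (simp add: H2_def)
qed

text \<open>Each moment is a pairing with a bounded function, hence continuous in L2.\<close>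

lemma cl2_H2: "cl2 H2 = H2"
proof
  show "H2 \<subseteq> cl2 H2" by (rule subset_cl2) (auto simp: H2_L2)
  show "cl2 H2 \<subseteq> H2"
  proof
    fix f assume f: "f \<in> cl2 H2"
    have "integral\<^sup>L mT (\<lambda>z. f z * z ^ k) = 0" if "k \<ge> 1" for k
    proof -
      have "ip f (\<lambda>z. z ^ 0 * cnj z ^ k) = 0"
        by (rule cl2_ip_zero[OF f]) (use that H2_moment in \<open>auto simp: H2_L2 ip_def intro: L2_trig[of 0,
            simplified]\<close>)
      then show ?thesis by (simp add: ip_def)
    qed
    then show "f \<in> H2" using cl2_L2[OF f] by (simp add: H2_def)
  qed
qed

lemma H2_z:
  assumes f: "f \<in> H2"
  shows "(\<lambda>z. z * f z) \<in> H2" "integral\<^sup>L mT (\<lambda>z. z * f z) = 0"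
proof -
  have "integral\<^sup>L mT (\<lambda>z. (z * f z) * z ^ k) = 0" for k
    using H2_moment[OF f, of "Suc k"] by (simp add: mult_ac)
  then show "(\<lambda>z. z * f z) \<in> H2"
    using L2_mult_circle(1)[OF H2_L2[OF f], of "\<lambda>z. z" 1] by (simp add: H2_def)
  show "integral\<^sup>L mT (\<lambda>z. z * f z) = 0"
    using H2_moment[OF f, of 1] by (simp add: mult_ac)
qed

lemma H2_const: "(\<lambda>z. c) \<in> H2"
  by (auto simp: H2_def L2_const integral_mT_power)

lemma H2_AE_zero:
  assumes f: "f \<in> H2" and m: "\<And>k. integral\<^sup>L mT (\<lambda>z. f z * cnj z ^ k) = 0"
  shows "AE z in mT. f z = 0"
proof (rule AE_zero_if_moments_zero)
  note [measurable] = f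
  show "integrable mT f" using L2_integrable H2_L2 f by blast
  fix j k :: nat
  show "integral\<^sup>L mT (\<lambda>z. f z * (z ^ j * cnj z ^ k)) = 0"
  proof (cases "k < j")
    case True
    have "integral\<^sup>L mT (\<lambda>z. f z * (z ^ j * cnj z ^ k)) = integral\<^sup>L mT (\<lambda>z. f z * z ^ (j - k))"
      by (rule integral_mT_cong) (use True in \<open>auto simp: unimodular_power_cases\<close>)
    then show ?thesis using H2_moment[OF f] True by simp
  next
    case False
    have "integral\<^sup>L mT (\<lambda>z. f z * (z ^ j * cnj z ^ k)) = integral\<^sup>L mT (\<lambda>z. f z * cnj z ^ (k - j))"
      by (rule integral_mT_cong) (use False in \<open>auto simp: unimodular_power_cases\<close>)
    then show ?thesis using m by simp
  qed
qed

section \<open>Blaschke factors\<close>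

definition bf :: "complex \<Rightarrow> complex \<Rightarrow> complex" where
  "bf c z = (z - c) / (1 - cnj c * z)"

text \<open>The Szego kernel: for \<open>c\<close> in the disc, pairing a function in
  \<open>H2\<close> with \<open>kf c\<close> gives the value at \<open>c\<close> of its holomorphic
  extension.\<close>

definition kf :: "complex \<Rightarrow> complex \<Rightarrow> complex" where
  "kf c z = 1 / (1 - cnj c * z)"

lemma bf_measurable [measurable]: "bf c \<in> borel_measurable borel"
  unfolding bf_def by measurable

lemma kf_measurable [measurable]: "kf c \<in> borel_measurable borel"
  unfolding kf_def by measurable

lemma unimodular_mult_cnj: "cmod z = 1 \<Longrightarrow> z * cnj z = 1"
  by (simp add: complex_norm_square[symmetric])

context
  fixes c :: complex
  assumes c: "cmod c < 1"
begin

lemma kf_denominator: assumes "cmod z = 1" shows "1 - cnj c * z \<noteq> 0" "cmod (1 - cnj c * z) \<ge> 1 - cmod c"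
proof -
  have "1 - cmod c \<le> cmod 1 - cmod (cnj c * z)" using assms by (simp add: norm_mult)
  also have "\<dots> \<le> cmod (1 - cnj c * z)" by (rule norm_triangle_ineq2)
  finally show "cmod (1 - cnj c * z) \<ge> 1 - cmod c" .
  then show "1 - cnj c * z \<noteq> 0" using c by auto
qed

lemma kf_bounded: "cmod z = 1 \<Longrightarrow> cmod (kf c z) \<le> 1 / (1 - cmod c)"
  using kf_denominator(2)[of z] c by (auto simp: kf_def norm_divide intro!: divide_left_mono mult_pos_pos)

lemma kf_rec: "cmod z = 1 \<Longrightarrow> kf c z = 1 + cnj c * z * kf c z"
  using kf_denominator(1)[of z] by (simp add: kf_def field_simps)

text \<open>Rests on z - c = z (1 - c cnj z) on the circle. It yields both the unimodularity of
  \<open>bf c\<close> and the vanishing at \<open>c\<close> of its multiples.\<close>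

lemma bf_cnj_kf: assumes "cmod z = 1" shows "bf c z * cnj (kf c z) = z * kf c z"
proof -
  have z: "z * cnj z = 1" using unimodular_mult_cnj assms by blast
  have n: "1 - cnj c * z \<noteq> 0" "1 - c * cnj z \<noteq> 0"
    using kf_denominator(1)[OF assms] by (auto simp: complex_eq_iff algebra_simps)
  have "z - c = z * (1 - c * cnj z)" using z by (simp add: algebra_simps)
  then show ?thesis using n by (simp add: bf_def kf_def)
qed

lemma bf_unimodular: assumes "cmod z = 1" shows "cmod (bf c z) = 1"
proof -
  have "cmod (kf c z) \<noteq> 0" using kf_denominator(1)[OF assms] by (simp add: kf_def)
  moreover have "cmod (bf c z) * cmod (kf c z) = cmod (kf c z)"
    using arg_cong[OF bf_cnj_kf[OF assms], of cmod] assms by (simp add: norm_mult)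
  ultimately show ?thesis by simp
qed

text \<open>By the kernel equation \<open>kf_rec\<close> each moment of the product is
  \<open>cnj c\<close> times the next one. The moments are bounded and |c| < 1, so iteration leaves
  only zero.\<close>

lemma H2_kf:
  assumes f: "f \<in> H2" shows "(\<lambda>z. kf c z * f z) \<in> H2"
proof -
  note [measurable] = f
  define I where "I k = integral\<^sup>L mT (\<lambda>z. kf c z * f z * z ^ k)" for k
  have L: "(\<lambda>z. kf c z * f z) \<in> L2"
    by (rule L2_mult_circle(1)[OF H2_L2[OF f]]) (use kf_bounded in auto)
  have i: "integrable mT (\<lambda>z. kf c z * f z * z ^ k)" for k
    using L2_mult_integrable(1)[OF L L2_trig[of k 0]] by simp
  have fi: "integrable mT (\<lambda>z. f z * z ^ k)" for k
    using L2_mult_integrable(1)[OF H2_L2[OF f] L2_trig[of k 0]] by simp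
  have rec: "I k = cnj c * I (Suc k)" if "k \<ge> 1" for k
  proof -
    have "I k = integral\<^sup>L mT (\<lambda>z. f z * z ^ k + cnj c * (kf c z * f z * z ^ Suc k))"
      unfolding I_def
    proof (rule integral_mT_cong)
      fix z :: complex assume z: "cmod z = 1"
      have "kf c z * f z * z ^ k = (1 + cnj c * z * kf c z) * f z * z ^ k" using kf_rec[OF z] by simp
      then show "kf c z * f z * z ^ k = f z * z ^ k + cnj c * (kf c z * f z * z ^ Suc k)"
        by (simp add: algebra_simps)
    qed auto
    also have "\<dots> = integral\<^sup>L mT (\<lambda>z. f z * z ^ k) + cnj c * I (Suc k)"
      unfolding I_def by (subst Bochner_Integration.integral_add) (use i fi in \<open>auto simp del: power_Suc\<close>)
    finally show ?thesis using H2_moment[OF f that] by simp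
  qed
  have itr: "I k = cnj c ^ j * I (k + j)" if "k \<ge> 1" for k j
  proof (induction j)
    case (Suc j)
    then show ?case using rec[of "k + j"] that by simp
  qed simp
  define D where "D = integral\<^sup>L mT (\<lambda>z. cmod (kf c z * f z))"
  have Ib: "cmod (I k) \<le> D" for k
  proof -
    have "cmod (I k) \<le> integral\<^sup>L mT (\<lambda>z. cmod (kf c z * f z * z ^ k))" unfolding I_def
        by (rule integral_norm_bound)
    also have "\<dots> = D" unfolding D_def
      by (rule integral_cong_AE) (auto intro!: AE_mT simp: norm_mult norm_power)
    finally show ?thesis .
  qed
  have "I k = 0" if "k \<ge> 1" for k
  proof -
    have "(\<lambda>j. cmod c ^ j * D) \<longlonglongrightarrow> 0 * D" by (intro tendsto_intros LIMSEQ_power_zero) (use c in simp)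
    moreover have "cmod (I k) \<le> cmod c ^ j * D" for j
    proof -
      have "cmod (I k) = cmod c ^ j * cmod (I (k + j))"
          by (subst itr[OF that, of j]) (simp add: norm_mult norm_power)
      also have "\<dots> \<le> cmod c ^ j * D" by (intro mult_left_mono Ib) auto
      finally show ?thesis .
    qed
    ultimately have "cmod (I k) \<le> 0 * D" by (intro LIMSEQ_le_const) auto
    then show ?thesis by simp
  qed
  then show ?thesis using L by (simp add: H2_def I_def)
qed

lemma H2_bf:
  assumes f: "f \<in> H2" shows "(\<lambda>z. bf c z * f z) \<in> H2"
proof -
  have k: "(\<lambda>z. kf c z * f z) \<in> H2" by (rule H2_kf[OF f])
  have "(\<lambda>z. z * (kf c z * f z) - c * (kf c z * f z)) \<in> H2"
    by (intro linear_subspaceD(4)[OF H2_subspace] linear_subspaceD(3)[OF H2_subspace] H2_z k)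
  then show ?thesis by (simp add: bf_def kf_def diff_divide_distrib algebra_simps)
qed

text \<open>The hypothesis says that \<open>f\<close> vanishes at \<open>c\<close>. By
  \<open>kf_rec\<close> the same then holds for every z^m f, and the moments of the quotient are
  combinations of these vanishing pairings.\<close>

lemma H2_div_bf:
  assumes f: "f \<in> H2" and 0: "integral\<^sup>L mT (\<lambda>z. f z * cnj (kf c z)) = 0"
  shows "(\<lambda>z. cnj (bf c z) * f z) \<in> H2"
proof -
  note [measurable] = f
  define D where "D m = integral\<^sup>L mT (\<lambda>z. f z * z ^ m * cnj (kf c z))" for m
  have kL: "kf c \<in> L2" by (rule L2_bounded) (use kf_bounded in \<open>auto intro: AE_mT\<close>)
  have zL: "(\<lambda>z. z ^ m * f z) \<in> L2" for m
    by (rule L2_mult_circle(1)[OF H2_L2[OF f], where C=1]) (auto simp: norm_power)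
  have i: "integrable mT (\<lambda>z. f z * z ^ m * cnj (kf c z))" for m
    using L2_mult_integrable(2)[OF zL kL] by (simp add: mult_ac)
  have fi: "integrable mT (\<lambda>z. f z * z ^ k)" for k
    using L2_mult_integrable(1)[OF H2_L2[OF f] L2_trig[of k 0]] by simp
  have rec: "D (Suc m) = c * D m" for m
  proof -
    have "D (Suc m) = integral\<^sup>L mT (\<lambda>z. f z * z ^ Suc m + c * (f z * z ^ m * cnj (kf c z)))"
      unfolding D_def
    proof (rule integral_mT_cong)
      fix z :: complex assume z: "cmod z = 1"
      have "cnj (kf c z) = 1 + c * cnj z * cnj (kf c z)" using arg_cong[OF kf_rec[OF z], of cnj] by simp
      then have "f z * z ^ Suc m * cnj (kf c z) = f z * z ^ Suc m * (1 + c * cnj z * cnj (kf c z))" by simp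
      also have "\<dots> = f z * z ^ Suc m + c * (f z * z ^ m * (z * cnj z) * cnj (kf c z))"
          by (simp add: algebra_simps)
      finally show "f z * z ^ Suc m * cnj (kf c z) = f z * z ^ Suc m + c * (f z * z ^ m * cnj (kf c z))"
        using unimodular_mult_cnj[OF z] by simp
    qed auto
    also have "\<dots> = integral\<^sup>L mT (\<lambda>z. f z * z ^ Suc m) + c * D m"
      unfolding D_def by (subst Bochner_Integration.integral_add) (use i fi in \<open>auto simp del: power_Suc\<close>)
    finally show ?thesis using H2_moment[OF f, of "Suc m"] by simp
  qed
  have D0: "D m = 0" for m
  proof (induction m)
    case 0
    then show ?case using \<open>integral\<^sup>L mT (\<lambda>z. f z * cnj (kf c z)) = 0\<close> by (simp add: D_def)
  qed (simp add: rec)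
  have "integral\<^sup>L mT (\<lambda>z. cnj (bf c z) * f z * z ^ m) = 0" if m: "m \<ge> 1" for m
  proof -
    obtain j where j: "m = Suc j" using m by (cases m) auto
    have "integral\<^sup>L mT (\<lambda>z. cnj (bf c z) * f z * z ^ m)
        = integral\<^sup>L mT (\<lambda>z. f z * z ^ j * cnj (kf c z) - cnj c * (f z * z ^ m * cnj (kf c z)))"
    proof (rule integral_mT_cong)
      fix z :: complex assume z: "cmod z = 1"
      have "cnj (bf c z) * z = (cnj z - cnj c) * z * cnj (kf c z)"
        by (simp add: bf_def kf_def)
      also have "\<dots> = (1 - cnj c * z) * cnj (kf c z)"
        using unimodular_mult_cnj[OF z] by (simp add: algebra_simps)
      finally have "cnj (bf c z) * z * (f z * z ^ j) = (1 - cnj c * z) * cnj (kf c z) * (f z * z ^ j)" by simp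
      then show "cnj (bf c z) * f z * z ^ m = f z * z ^ j * cnj (kf c z) - cnj c * (f z * z ^ m * cnj (kf c
          z))"
        by (simp add: j algebra_simps)
    qed auto
    also have "\<dots> = D j - cnj c * D m"
      unfolding D_def by (subst Bochner_Integration.integral_diff) (use i in auto)
    finally show ?thesis by (simp add: D0)
  qed
  moreover have "(\<lambda>z. cnj (bf c z) * f z) \<in> L2"
    by (rule L2_mult_circle(1)[OF H2_L2[OF f], where C=1]) (use bf_unimodular in auto)
  ultimately show ?thesis by (simp add: H2_def)
qed

text \<open>The counterpart of \<open>H2_div_bf\<close>: on the circle the integrand becomes z times
  a function in \<open>H2\<close>, which has mean zero.\<close>

lemma integral_bf_cnj_kf:
  assumes g: "g \<in> H2" shows "integral\<^sup>L mT (\<lambda>z. bf c z * g z * cnj (kf c z)) = 0"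
proof -
  note [measurable] = g
  have "integral\<^sup>L mT (\<lambda>z. bf c z * g z * cnj (kf c z)) = integral\<^sup>L mT (\<lambda>z. z * (kf c z * g z))"
  proof (rule integral_mT_cong)
    fix z :: complex assume z: "cmod z = 1"
    have "bf c z * g z * cnj (kf c z) = (bf c z * cnj (kf c z)) * g z" by simp
    then show "bf c z * g z * cnj (kf c z) = z * (kf c z * g z)" by (simp only: bf_cnj_kf[OF z] mult.assoc)
  qed auto
  then show ?thesis using H2_z(2)[OF H2_kf[OF g]] by simp
qed

text \<open>Substituting \<open>kf_rec\<close> for one factor, and then for the conjugate one, leads
  to the fixed-point equation X = 1 + |c|^2 X.\<close>

lemma integral_kf_sq: "integral\<^sup>L mT (\<lambda>z. kf c z * cnj (kf c z)) = 1 / (1 - (cmod c)\<^sup>2)"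
proof -
  define X where "X = integral\<^sup>L mT (\<lambda>z. kf c z * cnj (kf c z))"
  have kH: "kf c \<in> H2" using H2_kf[OF H2_const[of 1]] by simp
  have kL: "kf c \<in> L2" using kH H2_L2 by blast
  have zkL: "(\<lambda>z. z * kf c z) \<in> L2" using H2_z(1)[OF kH] H2_L2 by blast
  have I1: "integral\<^sup>L mT (kf c) = 1"
  proof -
    have "integral\<^sup>L mT (kf c) = integral\<^sup>L mT (\<lambda>z. 1 + cnj c * (z * kf c z))"
    proof (rule integral_mT_cong)
      fix z :: complex assume "cmod z = 1"
      then show "kf c z = 1 + cnj c * (z * kf c z)" using kf_rec[of z] by (simp only: mult.assoc)
    qed auto
    also have "\<dots> = 1 + cnj c * integral\<^sup>L mT (\<lambda>z. z * kf c z)"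
      by (subst Bochner_Integration.integral_add) (use L2_integrable[OF zkL] in auto)
    finally show ?thesis using H2_z(2)[OF kH] by simp
  qed
  have Xr: "cnj X = X" unfolding X_def by (subst Bochner_Integration.integral_cnj[symmetric]) (simp add:
      mult.commute del: Bochner_Integration.integral_cnj)
  have zk: "integral\<^sup>L mT (\<lambda>z. kf c z * (z * cnj (kf c z))) = c * X"
  proof -
    have "integral\<^sup>L mT (\<lambda>z. kf c z * (z * cnj (kf c z))) = integral\<^sup>L mT (\<lambda>z. z * kf c z + c * (kf c z
        * cnj (kf c z)))"
    proof (rule integral_mT_cong)
      fix z :: complex assume z: "cmod z = 1"
      have "cnj (kf c z) = 1 + c * cnj z * cnj (kf c z)" using arg_cong[OF kf_rec[OF z], of cnj] by simp
      then have "kf c z * (z * cnj (kf c z)) = kf c z * (z * (1 + c * cnj z * cnj (kf c z)))" by simp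
      also have "\<dots> = z * kf c z + c * (kf c z * (z * cnj z) * cnj (kf c z))" by (simp add: algebra_simps)
      finally show "kf c z * (z * cnj (kf c z)) = z * kf c z + c * (kf c z * cnj (kf c z))"
        using unimodular_mult_cnj[OF z] by simp
    qed auto
    also have "\<dots> = integral\<^sup>L mT (\<lambda>z. z * kf c z) + c * X"
      unfolding X_def by (subst Bochner_Integration.integral_add)
        (use L2_integrable[OF zkL] L2_mult_integrable(2)[OF kL kL] in auto)
    finally show ?thesis using H2_z(2)[OF kH] by simp
  qed
  have "X = integral\<^sup>L mT (\<lambda>z. cnj (kf c z) + cnj c * (kf c z * (z * cnj (kf c z))))"
    unfolding X_def
  proof (rule integral_mT_cong)
    fix z :: complex assume z: "cmod z = 1"
    have "kf c z * cnj (kf c z) = (1 + cnj c * z * kf c z) * cnj (kf c z)" using kf_rec[OF z] by simp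
    then show "kf c z * cnj (kf c z) = cnj (kf c z) + cnj c * (kf c z * (z * cnj (kf c z)))"
      by (simp add: algebra_simps)
  qed auto
  also have "\<dots> = cnj (integral\<^sup>L mT (kf c)) + cnj c * (c * X)"
  proof -
    have "integrable mT (\<lambda>z. kf c z * (z * cnj (kf c z)))"
      using L2_mult_integrable(2)[OF zkL kL] by (simp add: mult_ac)
    then show ?thesis
      unfolding zk[symmetric]
      by (subst Bochner_Integration.integral_add) (use L2_integrable[OF kL] in auto)
  qed
  finally have "X * (1 - c * cnj c) = 1" by (simp add: I1 algebra_simps)
  then have "X * (1 - complex_of_real ((cmod c)\<^sup>2)) = 1" by (simp only: complex_norm_square)
  then show ?thesis unfolding X_def[symmetric] by (auto simp: eq_divide_eq)
qed

end

section \<open>Finite Blaschke products and the Takenaka system\<close>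

text \<open>Orthonormality of all \<open>J i\<close> times integer powers of \<open>u\<close>: for
  unimodular \<open>u\<close> the product of \<open>u ^ p\<close> and \<open>cnj u ^ q\<close> is
  the power of exponent p - q. Boundedness is included because the \<open>J i\<close> act as
  multipliers.\<close>

definition unitary_system :: "(complex \<Rightarrow> complex) \<Rightarrow> nat \<Rightarrow> (nat \<Rightarrow> complex \<Rightarrow> complex) \<Rightarrow> bool" where
  "unitary_system u r J \<longleftrightarrow> (\<forall>i<r. J i \<in> Linf) \<and>
     (\<forall>i<r. \<forall>j<r. \<forall>p q. integral\<^sup>L mT (\<lambda>z. J i z * cnj (J j z) * (u z ^ p * cnj (u z) ^ q))
        = (if i = j \<and> p = q then 1 else 0))"

locale finite_blaschke =
  fixes a :: "complex list" and n :: nat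
  assumes len: "length a = n" and n1: "n \<ge> 1" and zeros: "\<And>i. i < n \<Longrightarrow> cmod (a ! i) < 1" and a0: "a ! 0 = 0"
begin

definition bp :: "nat set \<Rightarrow> complex \<Rightarrow> complex" where
  "bp A z = (\<Prod>i\<in>A. bf (a ! i) z)"

text \<open>The Blaschke product, modified off the circle so that it is unimodular everywhere.\<close>

definition u :: "complex \<Rightarrow> complex" where
  "u z = (if cmod (blaschke a z) = 1 then blaschke a z else 1)"

lemma blaschke_eq_bp: "blaschke a z = bp {..<n} z"
  by (simp add: blaschke_def bp_def bf_def len)

lemma bp_measurable [measurable]: "bp A \<in> borel_measurable borel"
  unfolding bp_def by measurable

lemma blaschke_measurable [measurable]: "blaschke a \<in> borel_measurable borel"
  unfolding blaschke_eq_bp by measurable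

lemma u_measurable [measurable]: "u \<in> borel_measurable borel"
  unfolding u_def by measurable

lemma u_unimodular [simp]: "cmod (u z) = 1"
  by (simp add: u_def)

lemma u_mult_cnj: "u z * cnj (u z) = 1" "cnj (u z) * u z = 1"
  using unimodular_mult_cnj[of "u z"] by (simp_all add: mult.commute)

lemma bp_unimodular: "A \<subseteq> {..<n} \<Longrightarrow> cmod z = 1 \<Longrightarrow> cmod (bp A z) = 1"
  unfolding bp_def prod_norm[symmetric] by (rule prod.neutral) (auto intro!: bf_unimodular zeros)

lemma u_circle: "cmod z = 1 \<Longrightarrow> u z = bp {..<n} z"
  by (simp add: u_def blaschke_eq_bp bp_unimodular)

lemma u_AE_blaschke: "AE z in mT. blaschke a z = u z"
  by (rule AE_mT) (simp add: u_circle blaschke_eq_bp)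

lemma bp_union: "finite A \<Longrightarrow> finite A' \<Longrightarrow> A \<inter> A' = {} \<Longrightarrow> bp (A \<union> A') z = bp A z * bp A' z"
  by (simp add: bp_def prod.union_disjoint)

lemma bp_split: "l \<le> m \<Longrightarrow> bp {..<m} z = bp {..<l} z * bp {l..<m} z"
  by (subst bp_union[symmetric]) (auto intro!: arg_cong2[where f=bp])

lemma bp_first: "m \<ge> 1 \<Longrightarrow> bp {..<m} z = z * bp {1..<m} z"
  by (subst bp_split[of 1]) (auto simp: bp_def bf_def a0)

lemma H2_bp: "f \<in> H2 \<Longrightarrow> A \<subseteq> {..<n} \<Longrightarrow> (\<lambda>z. bp A z * f z) \<in> H2"
proof -
  assume f: "f \<in> H2" and A: "A \<subseteq> {..<n}"
  have "finite A" using A finite_subset by blast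
  then show "(\<lambda>z. bp A z * f z) \<in> H2" using A
  proof (induction A rule: finite_induct)
    case empty
    then show ?case using f by (simp add: bp_def)
  next
    case (insert i A)
    then have "(\<lambda>z. bf (a ! i) z * (bp A z * f z)) \<in> H2" by (intro H2_bf zeros) auto
    then show ?case using insert by (simp add: bp_def mult.assoc)
  qed
qed

lemma H2_bp_pow: "f \<in> H2 \<Longrightarrow> A \<subseteq> {..<n} \<Longrightarrow> (\<lambda>z. bp A z ^ k * f z) \<in> H2"
proof (induction k)
  case (Suc k)
  then show ?case using H2_bp[of "\<lambda>z. bp A z ^ k * f z" A] by (simp add: mult.assoc)
qed simp

lemma H2_u_pow: assumes f: "f \<in> H2" shows "(\<lambda>z. u z ^ k * f z) \<in> H2"
proof (rule H2_cong[OF H2_bp_pow[OF f order.refl, of k]])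
  note [measurable] = f
  show "(\<lambda>z. u z ^ k * f z) \<in> borel_measurable borel" by measurable
  show "AE z in mT. bp {..<n} z ^ k * f z = u z ^ k * f z" by (rule AE_mT) (simp add: u_circle)
qed

text \<open>Here the zero at the origin enters: \<open>u ^ k\<close> is z times a function in
  \<open>H2\<close>.\<close>

lemma integral_u_pow: assumes k: "k \<ge> 1" shows "integral\<^sup>L mT (\<lambda>z. u z ^ k) = 0"
proof -
  obtain j where j: "k = Suc j" using k by (cases k) auto
  have "(\<lambda>z. u z ^ j * 1) \<in> H2" by (rule H2_u_pow[OF H2_const])
  then have "(\<lambda>z. bp {1..<n} z * (u z ^ j * 1)) \<in> H2" by (rule H2_bp) auto
  from H2_z(2)[OF this] have "integral\<^sup>L mT (\<lambda>z. z * (bp {1..<n} z * (u z ^ j * 1))) = 0" .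
  moreover have "integral\<^sup>L mT (\<lambda>z. u z ^ k) = integral\<^sup>L mT (\<lambda>z. z * (bp {1..<n} z * (u z ^ j * 1)))"
    by (rule integral_mT_cong) (use n1 in \<open>auto simp: j u_circle bp_first[of n]\<close>)
  ultimately show ?thesis by simp
qed

text \<open>z divides \<open>u\<close>, so divisibility by u^(j+1) makes z^(j+1) a divisor and
  annihilates the Fourier coefficient of index j.\<close>

lemma H2_divisible_zero:
  assumes f: "f \<in> H2" and d: "\<And>k. (\<lambda>z. cnj (u z) ^ k * f z) \<in> H2"
  shows "AE z in mT. f z = 0"
proof (rule H2_AE_zero[OF f])
  note [measurable] = f
  fix j
  let ?g = "\<lambda>z. cnj (u z) ^ Suc j * f z"
  have "(\<lambda>z. bp {1..<n} z ^ Suc j * ?g z) \<in> H2" by (rule H2_bp_pow[OF d]) auto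
  from H2_z(2)[OF this] have "integral\<^sup>L mT (\<lambda>z. z * (bp {1..<n} z ^ Suc j * ?g z)) = 0" .
  moreover have "integral\<^sup>L mT (\<lambda>z. f z * cnj z ^ j) = integral\<^sup>L mT (\<lambda>z. z * (bp {1..<n} z ^ Suc j * ?g z))"
  proof (rule integral_mT_cong)
    fix z :: complex assume z: "cmod z = 1"
    define \<beta> where "\<beta> = bp {1..<n} z"
    have "cmod \<beta> = 1" unfolding \<beta>_def by (rule bp_unimodular) (use z in auto)
    then have \<beta>: "\<beta> * cnj \<beta> = 1" by (rule unimodular_mult_cnj)
    have "z * (\<beta> ^ Suc j * ?g z) = (z * cnj z) * (\<beta> * cnj \<beta>) ^ Suc j * (f z * cnj z ^ j)"
      using u_circle[OF z] n1 by (simp add: bp_first[of n] \<beta>_def power_mult_distrib mult_ac)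
    then have "z * (\<beta> ^ Suc j * ?g z) = f z * cnj z ^ j"
      by (simp only: unimodular_mult_cnj[OF z] \<beta> power_one mult_1_left)
    then show "f z * cnj z ^ j = z * (bp {1..<n} z ^ Suc j * ?g z)"
      by (simp only: \<beta>_def)
  qed auto
  ultimately show "integral\<^sup>L mT (\<lambda>z. f z * cnj z ^ j) = 0" by simp
qed

text \<open>Reciprocal of the norm of the Szego kernel at the zero \<open>a ! l\<close>.\<close>

definition ce :: "nat \<Rightarrow> complex" where
  "ce l = complex_of_real (sqrt (1 - (cmod (a ! l))\<^sup>2))"

text \<open>The product runs over the strictly earlier zeros. Pairing a function divisible by the
  same product with \<open>e l\<close> evaluates the quotient at \<open>a ! l\<close>, up to a
  constant factor.\<close>

definition e :: "nat \<Rightarrow> complex \<Rightarrow> complex" where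
  "e l z = ce l * (bp {..<l} z * kf (a ! l) z)"

lemma e_measurable [measurable]: "e l \<in> borel_measurable borel"
  unfolding e_def by measurable

lemma ce_props: assumes "l < n" shows "ce l \<noteq> 0" "ce l * cnj (ce l) = complex_of_real (1 - (cmod (a ! l))\<^sup>2)"
proof -
  have "(cmod (a ! l))\<^sup>2 < 1" using zeros[OF assms] by (simp add: power_less_one_iff)
  then have p: "1 - (cmod (a ! l))\<^sup>2 > 0" by simp
  then show "ce l \<noteq> 0" by (simp add: ce_def)
  have "ce l * cnj (ce l) = complex_of_real (sqrt (1 - (cmod (a ! l))\<^sup>2) * sqrt (1 - (cmod (a ! l))\<^sup>2))"
    unfolding ce_def of_real_mult complex_cnj_complex_of_real ..
  also have "sqrt (1 - (cmod (a ! l))\<^sup>2) * sqrt (1 - (cmod (a ! l))\<^sup>2) = 1 - (cmod (a ! l))\<^sup>2" using p by simp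
  finally show "ce l * cnj (ce l) = complex_of_real (1 - (cmod (a ! l))\<^sup>2)" .
qed

lemma e_H2: "l < n \<Longrightarrow> e l \<in> H2"
  unfolding e_def
  by (intro linear_subspaceD(3)[OF H2_subspace] H2_bp)
     (use H2_kf[OF zeros H2_const[of 1]] in auto)

lemma e_Linf: assumes "l < n" shows "e l \<in> Linf"
proof -
  have "cmod (e l z) \<le> cmod (ce l) * (1 / (1 - cmod (a ! l)))" if "cmod z = 1" for z
  proof -
    have "cmod (e l z) = cmod (ce l) * cmod (kf (a ! l) z)"
      using bp_unimodular[of "{..<l}" z] that assms by (simp add: e_def norm_mult)
    also have "\<dots> \<le> cmod (ce l) * (1 / (1 - cmod (a ! l)))"
      by (intro mult_left_mono kf_bounded zeros assms that) simp
    finally show ?thesis .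
  qed
  then show ?thesis unfolding Linf_def by (auto intro: AE_mT)
qed

text \<open>The partial product cancels on the circle and leaves the value at \<open>a ! m\<close>
  of a multiple of \<open>bf (a ! m)\<close>.\<close>

lemma e_orthogonal:
  assumes h: "h \<in> H2" and m: "m < n"
  shows "integral\<^sup>L mT (\<lambda>z. bp {..<Suc m} z * h z * cnj (e m z)) = 0"
proof -
  note [measurable] = h
  have "integral\<^sup>L mT (\<lambda>z. bp {..<Suc m} z * h z * cnj (e m z))
      = integral\<^sup>L mT (\<lambda>z. cnj (ce m) * (bf (a ! m) z * h z * cnj (kf (a ! m) z)))"
  proof (rule integral_mT_cong)
    fix z :: complex assume z: "cmod z = 1"
    have "cmod (bp {..<m} z) = 1" using bp_unimodular[of "{..<m}" z] m z by auto
    then have "bp {..<m} z * cnj (bp {..<m} z) = 1" by (rule unimodular_mult_cnj)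
    moreover have "bp {..<Suc m} z * h z * cnj (e m z)
        = (bp {..<m} z * cnj (bp {..<m} z)) * (cnj (ce m) * (bf (a ! m) z * h z * cnj (kf (a ! m) z)))"
      by (simp add: e_def bp_def mult_ac)
    ultimately show "bp {..<Suc m} z * h z * cnj (e m z) = cnj (ce m) * (bf (a ! m) z * h z * cnj (kf (a !
        m) z))"
      by simp
  qed auto
  then show ?thesis using integral_bf_cnj_kf[OF zeros[OF m] h] by simp
qed

lemma e_norm: assumes l: "l < n" shows "integral\<^sup>L mT (\<lambda>z. e l z * cnj (e l z)) = 1"
proof -
  have "integral\<^sup>L mT (\<lambda>z. e l z * cnj (e l z))
      = integral\<^sup>L mT (\<lambda>z. (ce l * cnj (ce l)) * (kf (a ! l) z * cnj (kf (a ! l) z)))"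
  proof (rule integral_mT_cong)
    fix z :: complex assume z: "cmod z = 1"
    have "cmod (bp {..<l} z) = 1" using bp_unimodular[of "{..<l}" z] l z by auto
    then have "bp {..<l} z * cnj (bp {..<l} z) = 1" by (rule unimodular_mult_cnj)
    moreover have "e l z * cnj (e l z) = (bp {..<l} z * cnj (bp {..<l} z)) * ((ce l * cnj (ce l))
        * (kf (a ! l) z * cnj (kf (a ! l) z)))"
      by (simp add: e_def mult_ac)
    ultimately show "e l z * cnj (e l z) = (ce l * cnj (ce l)) * (kf (a ! l) z * cnj (kf (a ! l) z))" by simp
  qed auto
  also have "\<dots> = (ce l * cnj (ce l)) * (1 / (1 - (cmod (a ! l))\<^sup>2))"
    using integral_kf_sq[OF zeros[OF l]] by simp
  also have "\<dots> = 1" using ce_props[OF l] by auto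
  finally show ?thesis .
qed

text \<open>Off the diagonal, one side is divisible by the product of all zeros up to and including
  the index of the other: a spare factor \<open>u\<close> if d \<ge> 1, otherwise the Takenaka
  function of larger index. \<open>e_orthogonal\<close> then applies, after conjugation if l <
  m.\<close>

lemma e_pairing:
  assumes l: "l < n" and m: "m < n"
  shows "integral\<^sup>L mT (\<lambda>z. u z ^ d * e l z * cnj (e m z)) = (if l = m \<and> d = 0 then 1 else 0)"
proof -
  consider "d \<ge> 1" | "d = 0" "m < l" | "d = 0" "l < m" | "d = 0" "l = m" by linarith
  then show ?thesis
  proof cases
    case 1
    then obtain d' where d': "d = Suc d'" by (cases d) auto
    have h: "(\<lambda>z. bp {Suc m..<n} z * (u z ^ d' * e l z)) \<in> H2"
      by (intro H2_bp H2_u_pow e_H2 l) auto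
    have "integral\<^sup>L mT (\<lambda>z. u z ^ d * e l z * cnj (e m z))
       = integral\<^sup>L mT (\<lambda>z. bp {..<Suc m} z * (bp {Suc m..<n} z * (u z ^ d' * e l z)) * cnj (e m z))"
    proof (rule integral_mT_cong)
      fix z :: complex assume z: "cmod z = 1"
      have "u z = bp {..<Suc m} z * bp {Suc m..<n} z" using u_circle[OF z] bp_split[of "Suc m" n z] m by simp
      then show "u z ^ d * e l z * cnj (e m z) = bp {..<Suc m} z * (bp {Suc m..<n} z * (u z ^ d' * e l z))
          * cnj (e m z)"
        unfolding d' power_Suc by (simp only: mult_ac)
    qed auto
    then show ?thesis using e_orthogonal[OF h m] 1 by simp
  next
    case 2
    have h: "(\<lambda>z. ce l * (bp {Suc m..<l} z * (kf (a ! l) z * 1))) \<in> H2"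
      by (intro linear_subspaceD(3)[OF H2_subspace] H2_bp H2_kf zeros H2_const) (use l in auto)
    have "bp {..<l} z = bp {..<Suc m} z * bp {Suc m..<l} z" for z using bp_split[of "Suc m" l z] 2 by simp
    then have "(\<lambda>z. u z ^ d * e l z * cnj (e m z)) = (\<lambda>z. bp {..<Suc m} z * (ce l * (bp {Suc m..<l} z
        * (kf (a ! l) z * 1))) * cnj (e m z))"
      unfolding e_def[of l] using 2 by (simp add: mult_ac)
    then show ?thesis using e_orthogonal[OF h m] 2 by simp
  next
    case 3
    have h: "(\<lambda>z. ce m * (bp {Suc l..<m} z * (kf (a ! m) z * 1))) \<in> H2"
      by (intro linear_subspaceD(3)[OF H2_subspace] H2_bp H2_kf zeros H2_const) (use m in auto)
    have "bp {..<m} z = bp {..<Suc l} z * bp {Suc l..<m} z" for z using bp_split[of "Suc l" m z] 3 by simp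
    then have "(\<lambda>z. e m z * cnj (e l z)) = (\<lambda>z. bp {..<Suc l} z * (ce m * (bp {Suc l..<m} z * (kf (a ! m) z
        * 1))) * cnj (e l z))"
      unfolding e_def[of m] by (simp add: mult_ac)
    then have "ip (e m) (e l) = 0" using e_orthogonal[OF h l] by (simp add: ip_def)
    then have "ip (e l) (e m) = 0" using ip_cnj[of "e l" "e m"] by simp
    then show ?thesis using 3 by (simp add: ip_def)
  next
    case 4
    then show ?thesis using e_norm[OF l] by simp
  qed
qed

lemma u_power_cases: "u z ^ p * cnj (u z) ^ q = (if q \<le> p then u z ^ (p - q) else cnj (u z) ^ (q - p))"
  by (rule unimodular_power_cases) simp

lemma e_system: "unitary_system u n e"
  unfolding unitary_system_def
proof (intro conjI allI impI e_Linf)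
  fix l m p q assume l: "l < n" and m: "m < n"
  show "integral\<^sup>L mT (\<lambda>z. e l z * cnj (e m z) * (u z ^ p * cnj (u z) ^ q)) = (if l = m \<and> p
      = q then 1 else 0)"
  proof (cases "q \<le> p")
    case True
    then have "(\<lambda>z. e l z * cnj (e m z) * (u z ^ p * cnj (u z) ^ q)) = (\<lambda>z. u z ^ (p - q) * e l z
        * cnj (e m z))"
      by (simp add: u_power_cases mult_ac)
    then show ?thesis using e_pairing[OF l m, of "p - q"] True by simp
  next
    case False
    then have "(\<lambda>z. e l z * cnj (e m z) * (u z ^ p * cnj (u z) ^ q)) = (\<lambda>z. cnj (u z ^ (q - p) * e m z
        * cnj (e l z)))"
      by (simp add: u_power_cases mult_ac)
    then have "integral\<^sup>L mT (\<lambda>z. e l z * cnj (e m z) * (u z ^ p * cnj (u z) ^ q)) = cnj (integral\<^sup>L mT (\<lambda>z.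
        u z ^ (q - p) * e m z * cnj (e l z)))"
      by (simp only: Bochner_Integration.integral_cnj)
    then show ?thesis using e_pairing[OF m l, of "q - p"] False by simp
  qed
qed

text \<open>Zeros are divided out one by one: once the first m factors are removed, orthogonality to
  \<open>e m\<close> is the vanishing of the quotient at \<open>a ! m\<close>.\<close>

lemma H2_div_u:
  assumes f: "f \<in> H2" and o: "\<And>l. l < n \<Longrightarrow> integral\<^sup>L mT (\<lambda>z. f z * cnj (e l z)) = 0"
  shows "(\<lambda>z. cnj (u z) * f z) \<in> H2"
proof -
  note [measurable] = f
  have "m \<le> n \<Longrightarrow> (\<lambda>z. cnj (bp {..<m} z) * f z) \<in> H2" for m
  proof (induction m)
    case 0
    then show ?case using f by (simp add: bp_def)
  next
    case (Suc m)
    then have g: "(\<lambda>z. cnj (bp {..<m} z) * f z) \<in> H2" and m: "m < n" by auto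
    have "(\<lambda>z. f z * cnj (e m z)) = (\<lambda>z. cnj (ce m) * (cnj (bp {..<m} z) * f z * cnj (kf (a ! m) z)))"
      by (simp add: e_def mult_ac)
    then have "integral\<^sup>L mT (\<lambda>z. cnj (ce m) * (cnj (bp {..<m} z) * f z * cnj (kf (a ! m) z))) = 0"
      using o[OF m] by simp
    then have "integral\<^sup>L mT (\<lambda>z. cnj (bp {..<m} z) * f z * cnj (kf (a ! m) z)) = 0"
      using ce_props(1)[OF m] by simp
    from H2_div_bf[OF zeros[OF m] g this] show ?case by (simp add: bp_def mult_ac)
  qed
  then have "(\<lambda>z. cnj (bp {..<n} z) * f z) \<in> H2" by simp
  then show ?thesis
    by (rule H2_cong) (auto intro!: AE_mT simp: u_circle)
qed

lemma e_complete_H2: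
  assumes f: "f \<in> H2" and o: "\<And>l k. l < n \<Longrightarrow> integral\<^sup>L mT (\<lambda>z. f z * cnj (e l z) * cnj (u z) ^ k) = 0"
  shows "AE z in mT. f z = 0"
proof (rule H2_divisible_zero[OF f])
  fix k show "(\<lambda>z. cnj (u z) ^ k * f z) \<in> H2"
  proof (induction k)
    case (Suc k)
    have "(\<lambda>z. cnj (u z) * (cnj (u z) ^ k * f z)) \<in> H2"
      by (rule H2_div_u[OF Suc]) (use o in \<open>simp add: mult_ac\<close>)
    then show ?case by (simp add: mult.assoc)
  qed (simp add: f)
qed

text \<open>For each i the projection of u^i f to \<open>H2\<close> is orthogonal to all u^k e_l,
  hence zero. Writing u = z b on the circle, the mixed moment of \<open>f\<close> is the pairing of
  u^i f with the \<open>H2\<close> function b^i z^j.\<close>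

lemma e_complete_L2:
  assumes f: "f \<in> L2"
    and o: "\<And>l p q. l < n \<Longrightarrow> integral\<^sup>L mT (\<lambda>z. f z * cnj (e l z) * (u z ^ p * cnj (u z) ^ q)) = 0"
  shows "AE z in mT. f z = 0"
proof (rule AE_zero_if_moments_zero)
  note [measurable] = L2_measurable[OF f]
  show "integrable mT f" using L2_integrable f by blast
  fix i j :: nat
  let ?F = "\<lambda>z. u z ^ i * f z"
  have F: "?F \<in> L2" by (rule L2_mult_bounded[OF f, where C=1]) (auto simp: norm_power)
  have H: "H2 \<subseteq> L2" using H2_L2 by auto
  obtain p where p: "p \<in> H2" "\<And>h. h \<in> H2 \<Longrightarrow> ip (\<lambda>z. ?F z - p z) h = 0"
    using L2_projection[OF H2_subspace H F] by (auto simp: cl2_H2)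
  have pL: "p \<in> L2" using p H by auto
  note [measurable] = p(1)
  have p0: "AE z in mT. p z = 0"
  proof (rule e_complete_H2[OF p(1)])
    fix l k assume l: "l < n"
    have h: "(\<lambda>z. u z ^ k * e l z) \<in> H2" by (intro H2_u_pow e_H2 l)
    have "ip ?F (\<lambda>z. u z ^ k * e l z) - ip p (\<lambda>z. u z ^ k * e l z) = 0"
      using p(2)[OF h] by (simp add: ip_diff_left F pL H2_L2[OF h])
    moreover have "ip ?F (\<lambda>z. u z ^ k * e l z) = 0"
      unfolding ip_def using o[OF l, of i k] by (simp add: mult_ac)
    ultimately show "integral\<^sup>L mT (\<lambda>z. p z * cnj (e l z) * cnj (u z) ^ k) = 0"
      by (simp add: ip_def mult_ac)
  qed
  have z: "(\<lambda>z. z ^ j) \<in> H2"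
  proof (induction j)
    case (Suc j)
    then show ?case using H2_z(1) by simp
  qed (simp add: H2_const)
  have h: "(\<lambda>z. bp {1..<n} z ^ i * z ^ j) \<in> H2" by (rule H2_bp_pow[OF z]) auto
  have "integral\<^sup>L mT (\<lambda>z. f z * (z ^ i * cnj z ^ j)) = ip (\<lambda>z. ?F z - p z) (\<lambda>z. bp {1..<n} z ^ i * z ^ j)"
    unfolding ip_def
  proof (rule integral_cong_AE)
    show "AE z in mT. f z * (z ^ i * cnj z ^ j) = (?F z - p z) * cnj (bp {1..<n} z ^ i * z ^ j)"
      using p0 AE_mT_cmod
    proof eventually_elim
      case (elim z)
      define \<beta> where "\<beta> = bp {1..<n} z"
      have "cmod \<beta> = 1" unfolding \<beta>_def by (rule bp_unimodular) (use elim in auto)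
      then have \<beta>: "\<beta> * cnj \<beta> = 1" by (rule unimodular_mult_cnj)
      have "u z = z * \<beta>" using u_circle[of z] elim n1 bp_first[of n z] by (simp add: \<beta>_def)
      then have "?F z * cnj (\<beta> ^ i * z ^ j) = (\<beta> * cnj \<beta>) ^ i * (f z * (z ^ i * cnj z ^ j))"
        by (simp add: power_mult_distrib mult_ac)
      then have "?F z * cnj (\<beta> ^ i * z ^ j) = f z * (z ^ i * cnj z ^ j)"
        by (simp only: \<beta> power_one mult_1_left)
      then show ?case by (simp only: elim(1) \<beta>_def diff_zero)
    qed
  qed auto
  then show "integral\<^sup>L mT (\<lambda>z. f z * (z ^ i * cnj z ^ j)) = 0" using p(2)[OF h] by simp
qed

end

section \<open>Fejer means along the Blaschke product\<close>

text \<open>The excess of |f| over \<open>D\<close> is at most |f - g|, so its integral is dominated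
  by distances that can be made arbitrarily small.\<close>

lemma AE_bound_of_L2_limit:
  assumes f: "f \<in> L2"
    and a: "\<And>\<epsilon>. \<epsilon> > 0 \<Longrightarrow> \<exists>g\<in>L2. (AE z in mT. cmod (g z) \<le> D) \<and> n2 (\<lambda>z. f z - g z) < \<epsilon>"
  shows "AE z in mT. cmod (f z) \<le> D"
proof -
  note [measurable] = L2_measurable[OF f]
  let ?h = "\<lambda>z. max 0 (cmod (f z) - D)"
  have hi: "integrable mT ?h"
    by (rule Bochner_Integration.integrable_bound[where f="\<lambda>z. cmod (f z) + \<bar>D\<bar>"])
       (use L2_integrable[OF f] in auto)
  have "integral\<^sup>L mT ?h \<le> 0 + \<epsilon>" if e: "\<epsilon> > 0" for \<epsilon>
  proof -
    obtain g where g: "g \<in> L2" "AE z in mT. cmod (g z) \<le> D" "n2 (\<lambda>z. f z - g z) < \<epsilon>" using a[OF e] by blast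
    have "integral\<^sup>L mT ?h \<le> integral\<^sup>L mT (\<lambda>z. cmod (f z - g z))"
    proof (rule integral_mono_AE[OF hi])
      show "integrable mT (\<lambda>z. cmod (f z - g z))" using L2_integrable[OF L2_diff[OF f g(1)]] by simp
      show "AE z in mT. ?h z \<le> cmod (f z - g z)" using g(2)
      proof eventually_elim
        case (elim z)
        then show ?case using norm_triangle_ineq2[of "f z" "g z"] by (auto simp: max_def)
      qed
    qed
    also have "\<dots> \<le> n2 (\<lambda>z. f z - g z)" by (rule L1_le_n2[OF L2_diff[OF f g(1)]])
    finally show ?thesis using g(3) by simp
  qed
  then have "integral\<^sup>L mT ?h \<le> 0" by (rule field_le_epsilon)
  then have "integral\<^sup>L mT ?h = 0" by (intro antisym integral_nonneg) auto
  then have "AE z in mT. ?h z = 0" using integral_nonneg_eq_0_iff_AE[OF hi] by simp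
  then show ?thesis by eventually_elim (auto simp: max_def split: if_splits)
qed

section \<open>Bounded functions as multipliers\<close>

lemma LinfD: "f \<in> Linf \<Longrightarrow> f \<in> borel_measurable borel"
  by (simp add: Linf_def)

lemma Linf_bound: "f \<in> Linf \<Longrightarrow> \<exists>C\<ge>0. AE z in mT. cmod (f z) \<le> C"
proof -
  assume "f \<in> Linf"
  then obtain C where "AE z in mT. cmod (f z) \<le> C" by (auto simp: Linf_def)
  then have "AE z in mT. cmod (f z) \<le> max 0 C" by eventually_elim simp
  then show ?thesis by (intro exI[of _ "max 0 C"]) simp
qed

lemma LinfI: "f \<in> borel_measurable borel \<Longrightarrow> AE z in mT. cmod (f z) \<le> C \<Longrightarrow> f \<in> Linf"
  by (auto simp: Linf_def)

lemma Linf_mult: assumes "f \<in> Linf" "g \<in> Linf" shows "(\<lambda>z. f z * g z) \<in> Linf"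
proof -
  note [measurable] = LinfD[OF assms(1)] LinfD[OF assms(2)]
  obtain C D where C: "C \<ge> 0" "AE z in mT. cmod (f z) \<le> C" and D: "D \<ge> 0" "AE z in mT. cmod (g z) \<le> D"
    using Linf_bound assms by metis
  have "AE z in mT. cmod (f z * g z) \<le> C * D" using C(2) D(2)
    by eventually_elim (auto simp: norm_mult C(1) intro!: mult_mono)
  then show ?thesis by (intro LinfI) auto
qed

lemma Linf_cnj: "f \<in> Linf \<Longrightarrow> (\<lambda>z. cnj (f z)) \<in> Linf"
  by (auto simp: Linf_def)

lemma Linf_add: assumes "f \<in> Linf" "g \<in> Linf" shows "(\<lambda>z. f z + g z) \<in> Linf"
proof -
  note [measurable] = LinfD[OF assms(1)] LinfD[OF assms(2)]
  obtain C D where C: "AE z in mT. cmod (f z) \<le> C" and D: "AE z in mT. cmod (g z) \<le> D"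
    using Linf_bound assms by metis
  have "AE z in mT. cmod (f z + g z) \<le> C + D" using C D
    by eventually_elim (rule norm_triangle_mono)
  then show ?thesis by (intro LinfI) auto
qed

lemma Linf_const: "(\<lambda>z. c) \<in> Linf"
  by (auto simp: Linf_def)

lemma Linf_subspace: "linear_subspace Linf"
  unfolding linear_subspace_def using Linf_const Linf_add Linf_mult by auto

lemma L2_mult_Linf: "f \<in> L2 \<Longrightarrow> b \<in> Linf \<Longrightarrow> (\<lambda>z. b z * f z) \<in> L2" "f \<in> L2 \<Longrightarrow> b \<in> Linf \<Longrightarrow> (\<lambda>z. f z * b z) \<in> L2"
  using L2_mult_bounded[of f b] Linf_bound[of b] LinfD[of b] by (auto simp: mult.commute)

lemma integrable_mult_bounded:
  assumes f: "integrable mT f" and b: "b \<in> borel_measurable borel" "AE z in mT. cmod (b z) \<le> C"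
  shows "integrable mT (\<lambda>z. f z * b z :: complex)"
proof -
  have [measurable]: "f \<in> borel_measurable borel" using borel_measurable_integrable[OF f] by simp
  note [measurable] = b(1)
  have "integrable mT (\<lambda>z. C * cmod (f z))" using f by auto
  then show ?thesis
  proof (rule Bochner_Integration.integrable_bound)
    show "AE z in mT. norm (f z * b z) \<le> norm (C * cmod (f z))" using b(2)
    proof eventually_elim
      case (elim z)
      have "cmod (f z) * cmod (b z) \<le> cmod (f z) * C" using elim by (intro mult_left_mono) auto
      then show ?case by (simp add: norm_mult abs_mult mult.commute) (meson abs_ge_self mult_right_mono
          norm_ge_zero order_trans)
    qed
  qed auto
qed

context finite_blaschke
begin

text \<open>The Fourier coefficient of index i - j along \<open>u\<close>; two natural exponents
  stand for one integer.\<close>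

definition cf :: "(complex \<Rightarrow> complex) \<Rightarrow> nat \<Rightarrow> nat \<Rightarrow> complex" where
  "cf f i j = integral\<^sup>L mT (\<lambda>z. f z * (cnj (u z) ^ i * u z ^ j))"

text \<open>The double sum is the Fejer mean before collecting the frequencies \<open>i - j\<close>; in this shape
  positivity of the kernel is visible as \<open>\<bar>\<Sum>i<N. u(z)^i cnj(u(w))^i\<bar>^2 / N\<close>.\<close>

definition sig :: "nat \<Rightarrow> (complex \<Rightarrow> complex) \<Rightarrow> complex \<Rightarrow> complex" where
  "sig N f z = (\<Sum>i<N. \<Sum>j<N. cf f i j * (u z ^ i * cnj (u z) ^ j)) / of_nat N"

definition kern :: "nat \<Rightarrow> complex \<Rightarrow> complex \<Rightarrow> real" where
  "kern N z w = (cmod (\<Sum>i<N. u z ^ i * cnj (u w) ^ i))\<^sup>2 / real N"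

lemma sig_measurable [measurable]: "sig N f \<in> borel_measurable borel"
  unfolding sig_def by measurable

lemma kern_measurable [measurable]: "kern N z \<in> borel_measurable borel"
  unfolding kern_def by measurable

lemma kern_nonneg: "0 \<le> kern N z w"
  by (simp add: kern_def)

lemma kern_bounded: "kern N z w \<le> real N"
proof -
  have "cmod (\<Sum>i<N. u z ^ i * cnj (u w) ^ i) \<le> (\<Sum>i<N. 1)"
    by (rule order_trans[OF norm_sum]) (auto simp: norm_mult norm_power intro!: sum_mono)
  then have "(cmod (\<Sum>i<N. u z ^ i * cnj (u w) ^ i))\<^sup>2 \<le> (real N)\<^sup>2" by (intro power_mono) auto
  then show ?thesis by (simp add: kern_def divide_le_eq power2_eq_square split: if_splits)
qed

lemma kern_expand: "complex_of_real (kern N z w) = (\<Sum>i<N. \<Sum>j<N. (cnj (u w) ^ i * u w ^ j) * (u z ^ i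
    * cnj (u z) ^ j)) / of_nat N"
proof -
  have "complex_of_real ((cmod (\<Sum>i<N. u z ^ i * cnj (u w) ^ i))\<^sup>2)
      = (\<Sum>i<N. u z ^ i * cnj (u w) ^ i) * (\<Sum>j<N. cnj (u z) ^ j * u w ^ j)"
    by (simp only: complex_norm_square cnj_sum complex_cnj_mult complex_cnj_power complex_cnj_cnj)
  also have "\<dots> = (\<Sum>i<N. \<Sum>j<N. (cnj (u w) ^ i * u w ^ j) * (u z ^ i * cnj (u z) ^ j))"
    unfolding sum_product by (simp add: mult_ac)
  finally show ?thesis by (simp add: kern_def)
qed

lemma integrable_u_mult: assumes f: "integrable mT f" shows "integrable mT (\<lambda>z. f z * (cnj (u z) ^ i
    * u z ^ j))"
  by (rule integrable_mult_bounded[OF f, where C=1]) (auto simp: norm_mult norm_power)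

lemma integrable_kern_mult:
  assumes f: "integrable mT f"
  shows "integrable mT (\<lambda>w. f w * complex_of_real (kern N z w))"
  by (rule integrable_mult_bounded[OF f, where C="real N"]) (auto simp: kern_bounded kern_nonneg)

lemma sig_eq_integral:
  assumes f: "integrable mT f"
  shows "sig N f z = integral\<^sup>L mT (\<lambda>w. f w * complex_of_real (kern N z w))"
proof -
  have "(\<lambda>w. f w * complex_of_real (kern N z w))
    = (\<lambda>w. \<Sum>i<N. \<Sum>j<N. (f w * (cnj (u w) ^ i * u w ^ j)) * (u z ^ i * cnj (u z) ^ j) / of_nat N)"
    unfolding kern_expand by (simp add: sum_distrib_left sum_divide_distrib mult.assoc)
  then have "integral\<^sup>L mT (\<lambda>w. f w * complex_of_real (kern N z w))
    = (\<Sum>i<N. \<Sum>j<N. integral\<^sup>L mT (\<lambda>w. (f w * (cnj (u w) ^ i * u w ^ j)) * (u z ^ i * cnj (u z) ^ j) / of_nat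
        N))"
    using integrable_u_mult[OF f] by (simp add: Bochner_Integration.integral_sum)
  also have "\<dots> = sig N f z"
    by (simp add: sig_def cf_def sum_divide_distrib)
  finally show ?thesis by simp
qed

text \<open>For real \<open>g\<close> the coefficients of opposite index are conjugate, so one sign
  of the index controls the other.\<close>

lemma cf_real:
  assumes g: "integrable mT (g :: complex \<Rightarrow> real)" and 0: "\<And>k. k \<ge> 1 \<Longrightarrow> integral\<^sup>L mT (\<lambda>z. complex_of_real (g
      z) * u z ^ k) = 0"
  shows "cf (\<lambda>z. complex_of_real (g z)) i j = (if i = j then complex_of_real (integral\<^sup>L mT g) else 0)"
proof -
  have *: "cnj (u z) ^ i * u z ^ j = (if i \<le> j then u z ^ (j - i) else cnj (u z ^ (i - j)))" for z
    using u_power_cases[of z j i] by (simp add: mult.commute)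
  consider "i < j" | "i = j" | "j < i" by linarith
  then show ?thesis
  proof cases
    case 1
    then show ?thesis unfolding cf_def * using 0[of "j - i"] by simp
  next
    case 2
    then show ?thesis unfolding cf_def * by simp
  next
    case 3
    have "cf (\<lambda>z. complex_of_real (g z)) i j = integral\<^sup>L mT (\<lambda>z. cnj (complex_of_real (g z) * u z ^ (i
        - j)))"
      unfolding cf_def * using 3 by simp
    also have "\<dots> = cnj (integral\<^sup>L mT (\<lambda>z. complex_of_real (g z) * u z ^ (i - j)))"
      by (rule Bochner_Integration.integral_cnj)
    finally show ?thesis using 3 0[of "i - j"] by simp
  qed
qed

lemma u_pow_mult_cnj: "u z ^ i * cnj (u z) ^ i = 1"
  by (simp add: power_mult_distrib[symmetric] u_mult_cnj)

lemma sig_const: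
  assumes c: "\<And>i j. cf f i j = (if i = j then c else 0)" and N: "N \<ge> 1"
  shows "sig N f z = c"
proof -
  have "(\<Sum>i<N. \<Sum>j<N. cf f i j * (u z ^ i * cnj (u z) ^ j)) = (\<Sum>i<N. c)"
  proof (rule sum.cong[OF refl])
    fix i assume i: "i \<in> {..<N}"
    have "(\<Sum>j<N. cf f i j * (u z ^ i * cnj (u z) ^ j)) = (\<Sum>j<N. if i = j then c * (u z ^ i * cnj (u z) ^ i)
        else 0)"
      by (rule sum.cong) (auto simp: c)
    also have "\<dots> = c" using i by (simp add: u_pow_mult_cnj)
    finally show "(\<Sum>j<N. cf f i j * (u z ^ i * cnj (u z) ^ j)) = c" .
  qed
  then show ?thesis using N by (simp add: sig_def)
qed

text \<open>The left-hand side is the Fejer mean of \<open>g\<close> at \<open>z\<close>, of which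
  only the constant term survives.\<close>

lemma integral_kern_flat:
  assumes g: "integrable mT (g :: complex \<Rightarrow> real)" and 0: "\<And>k. k \<ge> 1 \<Longrightarrow> integral\<^sup>L mT (\<lambda>z. complex_of_real (g
      z) * u z ^ k) = 0"
    and N: "N \<ge> 1"
  shows "integral\<^sup>L mT (\<lambda>w. g w * kern N z w) = integral\<^sup>L mT g"
proof -
  have "complex_of_real (integral\<^sup>L mT (\<lambda>w. g w * kern N z w)) = sig N (\<lambda>z. complex_of_real (g z)) z"
    using g by (subst sig_eq_integral) (auto simp flip: of_real_mult)
  also have "\<dots> = complex_of_real (integral\<^sup>L mT g)"
    by (rule sig_const[OF cf_real[OF g 0] N])
  finally show ?thesis by simp
qed

lemma integral_kern: "N \<ge> 1 \<Longrightarrow> integral\<^sup>L mT (kern N z) = 1"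
  using integral_kern_flat[of "\<lambda>z. 1" N z] integral_u_pow by simp

lemma integrable_kern_real:
  assumes g: "integrable mT (g :: complex \<Rightarrow> real)" shows "integrable mT (\<lambda>w. g w * kern N z w)"
proof -
  have "integrable mT (\<lambda>w. complex_of_real (g w) * complex_of_real (kern N z w))"
    using g by (intro integrable_kern_mult) auto
  then have "integrable mT (\<lambda>w. Re (complex_of_real (g w) * complex_of_real (kern N z w)))"
    by (rule integrable_Re)
  then show ?thesis by simp
qed

lemma sig_bound:
  assumes f: "integrable mT f" and b: "AE z in mT. cmod (f z) \<le> C" and N: "N \<ge> 1"
  shows "cmod (sig N f z) \<le> C"
proof -
  have "cmod (sig N f z) \<le> integral\<^sup>L mT (\<lambda>w. cmod (f w * complex_of_real (kern N z w)))"
    unfolding sig_eq_integral[OF f] by (rule integral_norm_bound)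
  also have "\<dots> \<le> integral\<^sup>L mT (\<lambda>w. C * kern N z w)"
  proof (rule integral_mono_AE)
    show "integrable mT (\<lambda>w. cmod (f w * complex_of_real (kern N z w)))"
      using integrable_kern_mult[OF f] by (rule integrable_norm)
    show "integrable mT (\<lambda>w. C * kern N z w)" using integrable_kern_real[of "\<lambda>w. C"] by simp
    show "AE w in mT. cmod (f w * complex_of_real (kern N z w)) \<le> C * kern N z w"
      using b by eventually_elim (auto simp: norm_mult kern_nonneg intro: mult_right_mono)
  qed
  also have "\<dots> = C" using integral_kern[OF N] by simp
  finally show ?thesis .
qed

text \<open>A positive kernel splits into two square roots, one for each factor; ordinary
  Cauchy-Schwarz does the rest.\<close>

lemma sig_Cauchy_Schwarz:
  assumes f: "f \<in> L2" and g: "g \<in> L2"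
  shows "(cmod (sig N (\<lambda>z. f z * cnj (g z)) z))\<^sup>2 \<le>
    integral\<^sup>L mT (\<lambda>w. (cmod (f w))\<^sup>2 * kern N z w) * integral\<^sup>L mT (\<lambda>w. (cmod (g w))\<^sup>2 * kern N z w)"
proof -
  let ?s = "\<lambda>w. complex_of_real (sqrt (kern N z w))"
  have s: "?s \<in> Linf"
    by (rule LinfI[where C="sqrt (real N)"]) (auto simp: kern_nonneg kern_bounded)
  have fs: "(\<lambda>w. f w * ?s w) \<in> L2" and gs: "(\<lambda>w. g w * ?s w) \<in> L2"
    using L2_mult_Linf(2) f g s by auto
  have ss: "?s w * ?s w = complex_of_real (kern N z w)" for w
    by (simp add: kern_nonneg flip: of_real_mult)
  have nf: "(n2 (\<lambda>w. h w * ?s w))\<^sup>2 = integral\<^sup>L mT (\<lambda>w. (cmod (h w))\<^sup>2 * kern N z w)" for h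
    by (simp add: n2_sq norm_mult power_mult_distrib kern_nonneg)
  have "sig N (\<lambda>z. f z * cnj (g z)) z = ip (\<lambda>w. f w * ?s w) (\<lambda>w. g w * ?s w)"
    unfolding sig_eq_integral[OF L2_mult_integrable(2)[OF f g]] ip_def ss[symmetric]
    by (simp add: mult_ac)
  then have "(cmod (sig N (\<lambda>z. f z * cnj (g z)) z))\<^sup>2 \<le> (n2 (\<lambda>w. f w * ?s w) * n2 (\<lambda>w. g w * ?s w))\<^sup>2"
    using L2_Cauchy_Schwarz[OF fs gs] by (simp add: power_mono)
  then show ?thesis by (simp only: power_mult_distrib nf)
qed

lemma integral_u_pows: "integral\<^sup>L mT (\<lambda>z. u z ^ i * cnj (u z) ^ j) = (if i = j then 1 else 0)"
  using cf_real[of "\<lambda>z. 1" j i] integral_u_pow by (auto simp: cf_def mult.commute)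

lemma sig_Linf: "sig N f \<in> Linf"
proof -
  have "cmod (sig N f z) \<le> (\<Sum>i<N. \<Sum>j<N. cmod (cf f i j)) / real N" for z
  proof -
    have "cmod (\<Sum>i<N. \<Sum>j<N. cf f i j * (u z ^ i * cnj (u z) ^ j)) \<le> (\<Sum>i<N. \<Sum>j<N. cmod (cf f i j))"
      by (rule sum_norm_le, rule sum_norm_le) (simp add: norm_mult norm_power)
    then show ?thesis unfolding sig_def norm_divide norm_of_nat by (rule divide_right_mono) simp
  qed
  then show ?thesis by (intro LinfI) auto
qed

lemma integral_sig: assumes N: "N \<ge> 1" shows "integral\<^sup>L mT (sig N f) = integral\<^sup>L mT f"
proof -
  have i: "integrable mT (\<lambda>z. u z ^ i * cnj (u z) ^ j)" for i j
    using integrable_u_mult[of "\<lambda>z. 1" j i] by (simp add: mult.commute)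
  have "integral\<^sup>L mT (sig N f) = (\<Sum>i<N. \<Sum>j<N. cf f i j * (if i = j then 1 else 0)) / of_nat N"
    unfolding sig_def using i by (simp add: Bochner_Integration.integral_sum integral_u_pows)
  also have "\<dots> = (\<Sum>i<N. \<Sum>j<N. if j = i then integral\<^sup>L mT f else 0) / of_nat N"
    by (intro arg_cong2[where f="(/)"] sum.cong refl)
       (auto simp: cf_def mult.commute[of "cnj (u _) ^ _"] u_pow_mult_cnj)
  also have "\<dots> = integral\<^sup>L mT f" using N by simp
  finally show ?thesis .
qed

text \<open>Replaces an interchange of integrations: as a function of \<open>z\<close> the inner
  integral is a finite combination of powers of \<open>u\<close> and its conjugate, whose mean is
  read off.\<close>

lemma integral_integral_kern:
  assumes g: "integrable mT (g :: complex \<Rightarrow> real)" and N: "N \<ge> 1"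
  shows "integrable mT (\<lambda>z. integral\<^sup>L mT (\<lambda>w. g w * kern N z w))"
    "integral\<^sup>L mT (\<lambda>z. integral\<^sup>L mT (\<lambda>w. g w * kern N z w)) = integral\<^sup>L mT g"
proof -
  have eq: "complex_of_real (integral\<^sup>L mT (\<lambda>w. g w * kern N z w)) = sig N (\<lambda>z. complex_of_real (g z)) z"
      for z
    using g by (subst sig_eq_integral) (auto simp flip: of_real_mult)
  have si: "integrable mT (sig N (\<lambda>z. complex_of_real (g z)))" using L2_integrable Linf_L2 sig_Linf by blast
  have eq': "integral\<^sup>L mT (\<lambda>w. g w * kern N z w) = Re (sig N (\<lambda>z. complex_of_real (g z)) z)" for z
    by (simp add: eq[symmetric])
  show "integrable mT (\<lambda>z. integral\<^sup>L mT (\<lambda>w. g w * kern N z w))" unfolding eq' using si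
      by (rule integrable_Re)
  show "integral\<^sup>L mT (\<lambda>z. integral\<^sup>L mT (\<lambda>w. g w * kern N z w)) = integral\<^sup>L mT g"
    unfolding eq' integral_Re[OF si] integral_sig[OF N] by simp
qed

lemma sig_L1:
  assumes f: "integrable mT f" and N: "N \<ge> 1"
  shows "integral\<^sup>L mT (\<lambda>z. cmod (sig N f z)) \<le> integral\<^sup>L mT (\<lambda>z. cmod (f z))"
proof -
  have nf: "integrable mT (\<lambda>z. cmod (f z))" using f by simp
  have "integral\<^sup>L mT (\<lambda>z. cmod (sig N f z)) \<le> integral\<^sup>L mT (\<lambda>z. integral\<^sup>L mT (\<lambda>w. cmod (f w)
      * kern N z w))"
  proof (rule integral_mono)
    show "integrable mT (\<lambda>z. cmod (sig N f z))" using L2_integrable[OF Linf_L2[OF sig_Linf]] by simp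
    show "integrable mT (\<lambda>z. integral\<^sup>L mT (\<lambda>w. cmod (f w) * kern N z w))"
      using integral_integral_kern(1)[OF nf N] .
    show "cmod (sig N f z) \<le> integral\<^sup>L mT (\<lambda>w. cmod (f w) * kern N z w)" for z
      unfolding sig_eq_integral[OF f]
      by (rule order_trans[OF integral_norm_bound]) (simp add: norm_mult kern_nonneg)
  qed
  then show ?thesis using integral_integral_kern(2)[OF nf N] by simp
qed

text \<open>Jensen's inequality for the probability density \<open>kern N z\<close>, obtained as
  Cauchy-Schwarz against the constant 1.\<close>

lemma sig_n2:
  assumes f: "f \<in> L2" and N: "N \<ge> 1"
  shows "n2 (sig N f) \<le> n2 f"
proof -
  have g: "integrable mT (\<lambda>z. (cmod (f z))\<^sup>2)" using L2_sq_integrable[OF f] .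
  have "integral\<^sup>L mT (\<lambda>z. (cmod (sig N f z))\<^sup>2) \<le> integral\<^sup>L mT (\<lambda>z. integral\<^sup>L mT (\<lambda>w. (cmod (f w))\<^sup>2
      * kern N z w))"
  proof (rule integral_mono)
    show "integrable mT (\<lambda>z. (cmod (sig N f z))\<^sup>2)" by (rule L2_sq_integrable[OF Linf_L2[OF sig_Linf]])
    show "integrable mT (\<lambda>z. integral\<^sup>L mT (\<lambda>w. (cmod (f w))\<^sup>2 * kern N z w))"
      using integral_integral_kern(1)[OF g N] .
    show "(cmod (sig N f z))\<^sup>2 \<le> integral\<^sup>L mT (\<lambda>w. (cmod (f w))\<^sup>2 * kern N z w)" for z
      using sig_Cauchy_Schwarz[OF f L2_const[of 1], of N z] integral_kern[OF N, of z] by simp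
  qed
  then show ?thesis using integral_integral_kern(2)[OF g N] by (simp add: n2_def)
qed

lemma cf_add: "integrable mT f \<Longrightarrow> integrable mT g \<Longrightarrow> cf (\<lambda>z. f z + g z) i j = cf f i j + cf g i j"
  unfolding cf_def by (simp add: distrib_right integrable_u_mult)

lemma cf_cmult: "cf (\<lambda>z. c * f z) i j = c * cf f i j"
  unfolding cf_def by (simp add: mult.assoc)

lemma sig_add: "integrable mT f \<Longrightarrow> integrable mT g \<Longrightarrow> sig N (\<lambda>z. f z + g z) z = sig N f z + sig N g z"
  unfolding sig_def by (simp add: cf_add distrib_right sum.distrib add_divide_distrib)

lemma sig_cmult: "sig N (\<lambda>z. c * f z) z = c * sig N f z"
  unfolding sig_def by (simp add: cf_cmult sum_distrib_left mult.assoc)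

lemma sig_diff: "integrable mT f \<Longrightarrow> integrable mT g \<Longrightarrow> sig N (\<lambda>z. f z - g z) z = sig N f z - sig N g z"
  using sig_add[of f "\<lambda>z. (-1) * g z" N z] sig_cmult[of N "-1" g z] by simp

text \<open>Fejer summation of the expansion of \<open>f\<close> in the functions \<open>J i\<close>
  times integer powers of \<open>u\<close>, carried out for every \<open>i\<close>
  separately.\<close>

definition Phi :: "nat \<Rightarrow> (nat \<Rightarrow> complex \<Rightarrow> complex) \<Rightarrow> nat \<Rightarrow> (complex \<Rightarrow> complex) \<Rightarrow> complex \<Rightarrow> complex" where
  "Phi r J N f z = (\<Sum>i<r. J i z * sig N (\<lambda>z. f z * cnj (J i z)) z)"

definition system_span :: "nat \<Rightarrow> (nat \<Rightarrow> complex \<Rightarrow> complex) \<Rightarrow> (complex \<Rightarrow> complex) set" where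
  "system_span r J = cspan {\<lambda>z. J i z * (u z ^ p * cnj (u z) ^ q) | i p q. i < r}"

lemma u_pows_Linf: "(\<lambda>z. u z ^ p * cnj (u z) ^ q) \<in> Linf"
  by (rule LinfI[where C=1]) (auto simp: norm_mult norm_power)

text \<open>Counts the pairs on one diagonal of an N by N square, which gives the Fejer weight. The
  crude lower bound N - (p + q) comes from the points (t + p, t + q).\<close>

lemma card_band: "\<bar>real (card {(i, j). i < N \<and> j < N \<and> p + j = q + i}) / real N - 1\<bar>
    \<le> real (p + q) / real N" if N: "N \<ge> 1"
proof -
  let ?A = "{(i, j). i < N \<and> j < N \<and> p + j = q + (i::nat)}"
  have fin: "finite ?A" by (rule finite_subset[of _ "{..<N} \<times> {..<N}"]) auto
  have "card ?A = card (fst ` ?A)"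
    by (rule card_image[symmetric]) (auto simp: inj_on_def)
  also have "\<dots> \<le> card {..<N}" by (rule card_mono) auto
  finally have 1: "card ?A \<le> N" by simp
  have "card ((\<lambda>t. (t + p, t + q)) ` {..<N - (p + q)}) \<le> card ?A"
    by (rule card_mono[OF fin]) auto
  moreover have "card ((\<lambda>t. (t + p, t + q)) ` {..<N - (p + q)}) = N - (p + q)"
    by (subst card_image) (auto simp: inj_on_def)
  ultimately have 2: "N \<le> card ?A + (p + q)" by linarith
  have "\<bar>real (card ?A) / real N - 1\<bar> = (real N - real (card ?A)) / real N"
    using 1 N by (simp add: abs_if field_simps)
  also have "\<dots> \<le> real (p + q) / real N" using 2 by (intro divide_right_mono) auto
  finally show ?thesis .
qed

context
  fixes r J
  assumes sys: "unitary_system u r J"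
begin

lemma sys_Linf: "i < r \<Longrightarrow> J i \<in> Linf"
  using sys by (simp add: unitary_system_def)

lemma sys_L2: "i < r \<Longrightarrow> J i \<in> L2"
  using sys_Linf Linf_L2 by blast

lemma sys_int: "i < r \<Longrightarrow> j < r \<Longrightarrow>
  integral\<^sup>L mT (\<lambda>z. J i z * cnj (J j z) * (u z ^ p * cnj (u z) ^ q)) = (if i = j \<and> p = q then 1 else 0)"
  using sys by (simp add: unitary_system_def)

lemma sys_prod_L2: "f \<in> L2 \<Longrightarrow> i < r \<Longrightarrow> (\<lambda>z. f z * cnj (J i z)) \<in> L2"
  using L2_mult_Linf(2)[OF _ Linf_cnj[OF sys_Linf]] by blast

lemma Phi_L2: "Phi r J N f \<in> L2"
  unfolding Phi_def by (rule L2_sum) (auto intro!: Linf_L2 Linf_mult sys_Linf sig_Linf)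

lemma Phi_add: "f \<in> L2 \<Longrightarrow> g \<in> L2 \<Longrightarrow> Phi r J N (\<lambda>z. f z + g z) z = Phi r J N f z + Phi r J N g z"
proof -
  assume f: "f \<in> L2" and g: "g \<in> L2"
  have "sig N (\<lambda>z. (f z + g z) * cnj (J i z)) z = sig N (\<lambda>z. f z * cnj (J i z)) z + sig N (\<lambda>z. g z
      * cnj (J i z)) z"
    if "i < r" for i
    unfolding distrib_right
    by (rule sig_add) (use sys_prod_L2 f g that L2_integrable in blast)+
  then show ?thesis unfolding Phi_def by (simp add: distrib_left sum.distrib)
qed

lemma Phi_cmult: "Phi r J N (\<lambda>z. c * f z) z = c * Phi r J N f z"
  unfolding Phi_def by (simp add: sig_cmult mult.assoc sum_distrib_left mult.left_commute)

text \<open>Uniformity in \<open>N\<close> is what carries convergence from the span to its closure.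
  The bounds of the \<open>J i\<close> enter twice, once for the multiplication and once for the
  coefficients.\<close>

lemma Phi_bounded: "\<exists>D\<ge>0. \<forall>f\<in>L2. \<forall>N\<ge>1. n2 (Phi r J N f) \<le> D * n2 f"
proof -
  have "\<forall>i. \<exists>C. i < r \<longrightarrow> C \<ge> 0 \<and> (AE z in mT. cmod (J i z) \<le> C)"
    using Linf_bound[OF sys_Linf] by blast
  then obtain C where C: "\<And>i. i < r \<Longrightarrow> C i \<ge> 0" "\<And>i. i < r \<Longrightarrow> AE z in mT. cmod (J i z) \<le> C i"
    by metis
  have "n2 (Phi r J N f) \<le> (\<Sum>i<r. C i * C i) * n2 f" if f: "f \<in> L2" and N: "N \<ge> 1" for f N
  proof -
    have "n2 (Phi r J N f) \<le> (\<Sum>i<r. n2 (\<lambda>z. J i z * sig N (\<lambda>z. f z * cnj (J i z)) z))"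
      unfolding Phi_def by (rule n2_sum) (auto intro!: Linf_L2 Linf_mult sys_Linf sig_Linf)
    also have "\<dots> \<le> (\<Sum>i<r. C i * (C i * n2 f))"
    proof (rule sum_mono)
      fix i assume "i \<in> {..<r}"
      then have i: "i < r" by simp
      have "n2 (\<lambda>z. J i z * sig N (\<lambda>z. f z * cnj (J i z)) z) \<le> C i * n2 (sig N (\<lambda>z. f z * cnj (J i z)))"
        by (rule n2_mult_bounded) (use C i Linf_L2 sig_Linf LinfD[OF sys_Linf] in auto)
      also have "\<dots> \<le> C i * n2 (\<lambda>z. f z * cnj (J i z))"
        by (intro mult_left_mono sig_n2 sys_prod_L2 f i N C)
      also have "n2 (\<lambda>z. f z * cnj (J i z)) = n2 (\<lambda>z. cnj (J i z) * f z)" by (simp add: mult.commute)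
      also have "C i * \<dots> \<le> C i * (C i * n2 f)"
        by (intro mult_left_mono n2_mult_bounded) (use C i f LinfD[OF Linf_cnj[OF sys_Linf]] in auto)
      finally show "n2 (\<lambda>z. J i z * sig N (\<lambda>z. f z * cnj (J i z)) z) \<le> C i * (C i * n2 f)" by simp
    qed
    also have "\<dots> = (\<Sum>i<r. C i * C i) * n2 f" by (simp add: sum_distrib_right mult.assoc)
    finally show ?thesis .
  qed
  moreover have "(\<Sum>i<r. C i * C i) \<ge> 0" by (rule sum_nonneg) simp
  ultimately show ?thesis by blast
qed

text \<open>Orthonormality leaves a single diagonal of coefficients, and all its pairs produce the
  same power of \<open>u\<close>. Each generator is thus an eigenvector, with the Fejer weight as
  eigenvalue.\<close>

lemma Phi_generator:
  assumes m: "m < r"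
  shows "Phi r J N (\<lambda>z. J m z * (u z ^ p * cnj (u z) ^ q)) z
    = of_real (real (card {(i, j). i < N \<and> j < N \<and> p + j = q + i}) / real N) * (J m z * (u z ^ p * cnj (u z)
        ^ q))"
proof -
  let ?A = "{(i, j). i < N \<and> j < N \<and> p + j = q + (i::nat)}"
  let ?f = "\<lambda>z. J m z * (u z ^ p * cnj (u z) ^ q)"
  have cfv: "cf (\<lambda>z. ?f z * cnj (J l z)) i j = (if m = l \<and> p + j = q + i then 1 else 0)" if l: "l < r"
      for l i j
  proof -
    have "cf (\<lambda>z. ?f z * cnj (J l z)) i j = integral\<^sup>L mT (\<lambda>z. J m z * cnj (J l z) * (u z ^ (p + j)
        * cnj (u z) ^ (q + i)))"
      unfolding cf_def by (simp add: power_add mult_ac)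
    then show ?thesis using sys_int[OF m l] by simp
  qed
  have s0: "sig N (\<lambda>z. ?f z * cnj (J l z)) z = 0" if "l < r" "l \<noteq> m" for l
    using cfv[OF that(1)] that(2) by (simp add: sig_def)
  have band: "u z ^ i * cnj (u z) ^ j = u z ^ p * cnj (u z) ^ q" if "p + j = q + i" for i j
  proof -
    have "u z ^ i * cnj (u z) ^ j = (u z ^ i * cnj (u z) ^ j) * ((u z ^ q * cnj (u z) ^ q))"
        by (simp add: u_pow_mult_cnj)
    also have "\<dots> = u z ^ (q + i) * cnj (u z) ^ j * cnj (u z) ^ q" by (simp add: power_add mult_ac)
    also have "\<dots> = (u z ^ p * cnj (u z) ^ q) * (u z ^ j * cnj (u z) ^ j)" unfolding that[symmetric]
        by (simp add: power_add mult_ac)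
    finally show ?thesis by (simp add: u_pow_mult_cnj)
  qed
  have "(\<Sum>i<N. \<Sum>j<N. cf (\<lambda>z. ?f z * cnj (J m z)) i j * (u z ^ i * cnj (u z) ^ j))
      = (\<Sum>x\<in>{..<N} \<times> {..<N}. if x \<in> ?A then u z ^ p * cnj (u z) ^ q else 0)"
    unfolding sum.cartesian_product by (rule sum.cong) (auto simp: cfv[OF m] intro: band split: if_splits)
  also have "\<dots> = (\<Sum>x\<in>?A. u z ^ p * cnj (u z) ^ q)"
    by (rule sum.mono_neutral_cong_right) auto
  also have "\<dots> = of_nat (card ?A) * (u z ^ p * cnj (u z) ^ q)" by simp
  finally have s1: "sig N (\<lambda>z. ?f z * cnj (J m z)) z = of_nat (card ?A) * (u z ^ p * cnj (u z) ^ q) / of_nat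
      N"
    by (simp add: sig_def)
  have "Phi r J N ?f z = (\<Sum>l<r. if l = m then J m z * sig N (\<lambda>z. ?f z * cnj (J m z)) z else 0)"
    unfolding Phi_def by (rule sum.cong) (use s0 in auto)
  also have "\<dots> = J m z * sig N (\<lambda>z. ?f z * cnj (J m z)) z" using m by simp
  finally show ?thesis unfolding s1 by simp
qed

lemma system_span_L2: "system_span r J \<subseteq> L2"
  unfolding system_span_def
  by (rule cspan_L2) (auto intro!: Linf_L2 Linf_mult[OF sys_Linf u_pows_Linf])

lemma Phi_tendsto_span:
  "f \<in> system_span r J \<Longrightarrow> (\<lambda>N. n2 (\<lambda>z. Phi r J N f z - f z)) \<longlonglongrightarrow> 0"
  unfolding system_span_def
proof (induction rule: cspan.induct)
  case zero
  have "Phi r J N (\<lambda>z. 0) z = 0" for N z using Phi_cmult[of N 0 "\<lambda>z. 0" z] by simp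
  then show ?case by simp
next
  case (add f g c)
  from add obtain m p q where m: "m < r" and g: "g = (\<lambda>z. J m z * (u z ^ p * cnj (u z) ^ q))" by auto
  have fL: "f \<in> L2" using add(1) system_span_L2 by (auto simp: system_span_def)
  have gL: "g \<in> L2" unfolding g by (intro Linf_L2 Linf_mult[OF sys_Linf[OF m] u_pows_Linf])
  have cg: "(\<lambda>z. c * g z) \<in> L2" using gL L2_cmult by blast
  define d where "d N = real (card {(i, j). i < N \<and> j < N \<and> p + j = q + i}) / real N - 1" for N
  have lim0: "(\<lambda>N. d N) \<longlonglongrightarrow> 0"
  proof (rule Lim_null_comparison)
    show "eventually (\<lambda>N. norm (d N) \<le> real (p + q) / real N) sequentially"
      using eventually_ge_at_top[of 1] by eventually_elim (use card_band in \<open>simp add: d_def\<close>)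
    show "(\<lambda>N. real (p + q) / real N) \<longlonglongrightarrow> 0" by (rule lim_const_over_n)
  qed
  have pg: "Phi r J N g z - g z = complex_of_real (d N) * g z" for N z
    using Phi_generator[OF m, of N p q z] by (simp add: g d_def algebra_simps)
  have le: "n2 (\<lambda>z. Phi r J N (\<lambda>z. f z + c * g z) z - (f z + c * g z)) \<le> n2 (\<lambda>z. Phi r J N f z - f z)
      + cmod c * (\<bar>d N\<bar> * n2 g)" for N
  proof -
    have "(\<lambda>z. Phi r J N (\<lambda>z. f z + c * g z) z - (f z + c * g z)) = (\<lambda>z. (Phi r J N f z - f z) + c
        * (complex_of_real (d N) * g z))"
      unfolding pg[symmetric] using Phi_add[OF fL cg] Phi_cmult[of N c g] by (simp add: algebra_simps)
    moreover have "n2 (\<lambda>z. (Phi r J N f z - f z) + c * (complex_of_real (d N) * g z))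
        \<le> n2 (\<lambda>z. Phi r J N f z - f z) + n2 (\<lambda>z. c * (complex_of_real (d N) * g z))"
      by (intro n2_triangle L2_diff Phi_L2 fL L2_cmult gL)
    ultimately show ?thesis by (simp only: n2_cmult norm_of_real)
  qed
  show ?case
  proof (rule Lim_null_comparison)
    show "eventually (\<lambda>N. norm (n2 (\<lambda>z. Phi r J N (\<lambda>z. f z + c * g z) z - (f z + c * g z)))
        \<le> n2 (\<lambda>z. Phi r J N f z - f z) + cmod c * (\<bar>d N\<bar> * n2 g)) sequentially"
      using le by (intro always_eventually allI) simp
    have "(\<lambda>N. n2 (\<lambda>z. Phi r J N f z - f z) + cmod c * (\<bar>d N\<bar> * n2 g)) \<longlonglongrightarrow> 0 + cmod c * (\<bar>0\<bar> * n2 g)"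
      by (rule tendsto_add[OF add.IH tendsto_mult[OF tendsto_const tendsto_mult[OF tendsto_rabs[OF lim0]
          tendsto_const]]])
    then show "(\<lambda>N. n2 (\<lambda>z. Phi r J N f z - f z) + cmod c * (\<bar>d N\<bar> * n2 g)) \<longlonglongrightarrow> 0" by simp
  qed
qed

lemma Phi_tendsto:
  assumes f: "f \<in> cl2 (system_span r J)"
  shows "(\<lambda>N. n2 (\<lambda>z. Phi r J N f z - f z)) \<longlonglongrightarrow> 0"
proof (rule LIMSEQ_I)
  fix \<epsilon> :: real assume e: "\<epsilon> > 0"
  obtain D where D: "D \<ge> 0" "\<And>f N. f \<in> L2 \<Longrightarrow> N \<ge> 1 \<Longrightarrow> n2 (Phi r J N f) \<le> D * n2 f" using Phi_bounded by blast
  have fL: "f \<in> L2" using f cl2_L2 by blast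
  \<comment> \<open>\<open>Phi\<close> minus the identity has norm at most \<open>D + 1\<close>; the
    factor 2 leaves half of the error for the convergence on \<open>s\<close>.\<close>
  obtain s where s: "s \<in> system_span r J" "n2 (\<lambda>z. f z - s z) < \<epsilon> / (2 * (D + 1))"
    using cl2D[OF f, of "\<epsilon> / (2 * (D + 1))"] e D by auto
  have sL: "s \<in> L2" using s system_span_L2 by blast
  have fs: "(\<lambda>z. f z - s z) \<in> L2" using fL sL L2_diff by blast
  have "eventually (\<lambda>N. n2 (\<lambda>z. Phi r J N s z - s z) < \<epsilon> / 2) sequentially"
    using order_tendstoD(2)[OF Phi_tendsto_span[OF s(1)], of "\<epsilon> / 2"] e by simp
  then obtain N0 where N0: "\<And>N. N \<ge> N0 \<Longrightarrow> n2 (\<lambda>z. Phi r J N s z - s z) < \<epsilon> / 2"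
    by (auto simp: eventually_sequentially)
  have "norm (n2 (\<lambda>z. Phi r J N f z - f z) - 0) < \<epsilon>" if N: "N \<ge> max 1 N0" for N
  proof -
    have "Phi r J N f z = Phi r J N (\<lambda>z. f z - s z) z + Phi r J N s z" for z
      using Phi_add[OF fs sL, of N z] by simp
    then have "n2 (\<lambda>z. Phi r J N f z - f z) = n2 (\<lambda>z. (Phi r J N (\<lambda>z. f z - s z) z - (f z - s z))
        + (Phi r J N s z - s z))"
      by (simp add: algebra_simps)
    also have "\<dots> \<le> n2 (\<lambda>z. Phi r J N (\<lambda>z. f z - s z) z - (f z - s z)) + n2 (\<lambda>z. Phi r J N s z - s z)"
      by (intro n2_triangle L2_diff Phi_L2 fL sL)
    also have "n2 (\<lambda>z. Phi r J N (\<lambda>z. f z - s z) z - (f z - s z)) \<le> n2 (Phi r J N (\<lambda>z. f z - s z)) + n2 (\<lambda>z.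
        - (f z - s z))"
      using n2_triangle[OF Phi_L2[of N "\<lambda>z. f z - s z"] L2_cmult[OF fs, of "-1"]] by (simp add: algebra_simps)
    also have "\<dots> \<le> D * n2 (\<lambda>z. f z - s z) + n2 (\<lambda>z. f z - s z)"
      using D(2)[OF fs, of N] N by (simp only: n2_minus) simp
    also have "\<dots> = (D + 1) * n2 (\<lambda>z. f z - s z)" by (simp add: algebra_simps)
    also have "\<dots> < (D + 1) * (\<epsilon> / (2 * (D + 1)))" using s(2) D by (intro mult_strict_left_mono) auto
    also have "\<dots> = \<epsilon> / 2" using D(1) by (simp add: field_simps)
    finally show ?thesis using N0[of N] N by simp
  qed
  then show "\<exists>no. \<forall>N\<ge>no. norm (n2 (\<lambda>z. Phi r J N f z - f z) - 0) < \<epsilon>" by blast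
qed

end

end

lemma n2_tendsto_ip:
  assumes "\<And>N. g N \<in> L2" "f \<in> L2" "h \<in> L2" "(\<lambda>N. n2 (\<lambda>z. g N z - f z)) \<longlonglongrightarrow> 0"
  shows "(\<lambda>N. ip (g N) h) \<longlonglongrightarrow> ip f h"
proof -
  have "(\<lambda>N. ip (g N) h - ip f h) \<longlonglongrightarrow> 0"
  proof (rule Lim_null_comparison)
    show "(\<lambda>N. n2 (\<lambda>z. g N z - f z) * n2 h) \<longlonglongrightarrow> 0"
      using tendsto_mult_left_zero[OF assms(4)] .
    show "eventually (\<lambda>N. norm (ip (g N) h - ip f h) \<le> n2 (\<lambda>z. g N z - f z) * n2 h) sequentially"
      using L2_Cauchy_Schwarz[OF L2_diff[OF assms(1,2)] assms(3)]
      by (intro always_eventually allI) (simp add: ip_diff_left assms)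
  qed
  then show ?thesis by (simp add: LIM_zero_iff)
qed

section \<open>Completeness, boundedness and size of unitary systems\<close>

context finite_blaschke
begin

lemma system_span_orthogonal:
  assumes sys: "unitary_system u r J" and f: "f \<in> L2"
    and o: "\<And>g. g \<in> system_span r J \<Longrightarrow> ip f g = 0" and i: "i < r"
  shows "cf (\<lambda>z. f z * cnj (J i z)) p q = 0"
proof -
  have "(\<lambda>z. J i z * (u z ^ p * cnj (u z) ^ q)) \<in> system_span r J"
    unfolding system_span_def by (rule cspan_base) (use i in auto)
  from o[OF this] show ?thesis by (simp add: ip_def cf_def mult_ac)
qed

lemma system_span_projection:
  assumes sys: "unitary_system u r J" and f: "f \<in> L2"
  obtains p where "p \<in> cl2 (system_span r J)" "\<And>g. g \<in> system_span r J \<Longrightarrow> ip (\<lambda>z. f z - p z) g = 0"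
    "\<And>i a b. i < r \<Longrightarrow> cf (\<lambda>z. (f z - p z) * cnj (J i z)) a b = 0"
proof -
  obtain p where p: "p \<in> cl2 (system_span r J)" "\<And>g. g \<in> system_span r J \<Longrightarrow> ip (\<lambda>z. f z - p z) g = 0"
    using L2_projection[OF _ system_span_L2[OF sys] f] cspan_subspace by (auto simp: system_span_def)
  have "(\<lambda>z. f z - p z) \<in> L2" using p f cl2_L2 L2_diff by blast
  from system_span_orthogonal[OF sys this p(2)] show ?thesis using that p by blast
qed

text \<open>The difference between a function and its projection has zero coefficients, so
  \<open>e_complete_L2\<close> annihilates it.\<close>

lemma e_span_dense: "cl2 (system_span n e) = L2"
proof
  show "cl2 (system_span n e) \<subseteq> L2" using cl2_L2 by blast
  show "L2 \<subseteq> cl2 (system_span n e)"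
  proof
    fix f assume f: "f \<in> L2"
    note [measurable] = L2_measurable[OF f]
    obtain p where p: "p \<in> cl2 (system_span n e)"
      "\<And>i a b. i < n \<Longrightarrow> cf (\<lambda>z. (f z - p z) * cnj (e i z)) a b = 0"
      using system_span_projection[OF e_system f] by metis
    have "AE z in mT. f z - p z = 0"
      by (rule e_complete_L2[OF L2_diff[OF f cl2_L2[OF p(1)]]])
         (use p(2) in \<open>simp add: cf_def mult.commute[of "u _ ^ _"]\<close>)
    then have "AE z in mT. p z = f z" by eventually_elim simp
    then show "f \<in> cl2 (system_span n e)"
      using cl2_AE[OF p(1) _ _ system_span_L2[OF e_system]] by simp
  qed
qed

text \<open>Flatness of the squared modulus makes its integral against every Fejer kernel constant, so
  Cauchy-Schwarz bounds the Fejer means of the coefficients of \<open>\<phi>\<close> uniformly.\<close>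

lemma flat_bounded:
  "\<exists>C\<ge>0. \<forall>\<phi>\<in>L2. (\<forall>k\<ge>1. integral\<^sup>L mT (\<lambda>z. complex_of_real ((cmod (\<phi> z))\<^sup>2) * u z ^ k) = 0) \<longrightarrow>
     (AE z in mT. cmod (\<phi> z) \<le> C * n2 \<phi>)"
proof -
  have "\<forall>i. \<exists>C. i < n \<longrightarrow> C \<ge> 0 \<and> (AE z in mT. cmod (e i z) \<le> C)"
    using Linf_bound[OF e_Linf] by blast
  then obtain C where C: "\<And>i. i < n \<Longrightarrow> C i \<ge> 0" "\<And>i. i < n \<Longrightarrow> AE z in mT. cmod (e i z) \<le> C i"
    by metis
  have flat_e: "integral\<^sup>L mT (\<lambda>z. complex_of_real ((cmod (e i z))\<^sup>2) * u z ^ k) = 0" if "i < n" "k \<ge> 1"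
      for i k
    using sys_int[OF e_system that(1) that(1), of k 0] that
        by (simp add: complex_norm_square del: of_real_power)
  have n_e: "integral\<^sup>L mT (\<lambda>z. (cmod (e i z))\<^sup>2) = 1" if "i < n" for i
  proof -
    have "complex_of_real ((n2 (e i))\<^sup>2) = 1" using sys_int[OF e_system that that, of 0 0]
        by (simp add: n2_sq_ip ip_def del: of_real_power)
    then show ?thesis by (simp add: n2_sq del: of_real_power)
  qed
  have "AE z in mT. cmod (\<phi> z) \<le> (\<Sum>i<n. C i) * n2 \<phi>"
    if f: "\<phi> \<in> L2" and flat: "\<And>k. k \<ge> 1 \<Longrightarrow> integral\<^sup>L mT (\<lambda>z. complex_of_real ((cmod (\<phi> z))\<^sup>2) * u z ^ k)
        = 0" for \<phi>
  proof (rule AE_bound_of_L2_limit[OF f])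
    have "\<phi> \<in> cl2 (system_span n e)" using f e_span_dense by simp
    from Phi_tendsto[OF e_system this] have lim: "(\<lambda>N. n2 (\<lambda>z. Phi n e N \<phi> z - \<phi> z)) \<longlonglongrightarrow> 0" .
    fix \<epsilon> :: real assume "\<epsilon> > 0"
    then have "eventually (\<lambda>N. n2 (\<lambda>z. Phi n e N \<phi> z - \<phi> z) < \<epsilon>) sequentially"
      by (rule order_tendstoD(2)[OF lim])
    then obtain N0 where N0: "\<And>N. N \<ge> N0 \<Longrightarrow> n2 (\<lambda>z. Phi n e N \<phi> z - \<phi> z) < \<epsilon>"
        by (auto simp: eventually_sequentially)
    define N where "N = max 1 N0"
    have N: "N \<ge> 1" "N \<ge> N0" by (auto simp: N_def)
    have "AE z in mT. \<forall>i\<in>{..<n}. cmod (e i z) \<le> C i"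
      by (rule AE_finite_allI) (use C in auto)
    then have "AE z in mT. cmod (Phi n e N \<phi> z) \<le> (\<Sum>i<n. C i) * n2 \<phi>"
    proof eventually_elim
      case (elim z)
      have "cmod (Phi n e N \<phi> z) \<le> (\<Sum>i<n. C i * n2 \<phi>)"
        unfolding Phi_def
      proof (rule sum_norm_le)
        fix i assume "i \<in> {..<n}"
        then have i: "i < n" by simp
        \<comment> \<open>Against the kernel, the squared modulus of \<open>\<phi>\<close>
          integrates to \<open>(n2 \<phi>)\<^sup>2\<close> and that of \<open>e i\<close> to
          1.\<close>
        have "(cmod (sig N (\<lambda>z. \<phi> z * cnj (e i z)) z))\<^sup>2 \<le> (n2 \<phi>)\<^sup>2"
          using sig_Cauchy_Schwarz[OF f sys_L2[OF e_system i], of N z]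
            integral_kern_flat[OF L2_sq_integrable[OF f] flat N(1), of z]
            integral_kern_flat[OF L2_sq_integrable[OF sys_L2[OF e_system i]] flat_e[OF i] N(1), of z] n_e[OF
                i]
          by (simp add: n2_sq)
        then have "cmod (sig N (\<lambda>z. \<phi> z * cnj (e i z)) z) \<le> n2 \<phi>" by (rule power2_le_imp_le) simp
        then show "cmod (e i z * sig N (\<lambda>z. \<phi> z * cnj (e i z)) z) \<le> C i * n2 \<phi>"
          unfolding norm_mult using elim i C(1)[OF i] by (intro mult_mono) auto
      qed
      then show ?case by (simp add: sum_distrib_right)
    qed
    then show "\<exists>g\<in>L2. (AE z in mT. cmod (g z) \<le> (\<Sum>i<n. C i) * n2 \<phi>) \<and> n2 (\<lambda>z. \<phi> z - g z) < \<epsilon>"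
      using N0[OF N(2)] Phi_L2[OF e_system] n2_diff_commute[of \<phi> "Phi n e N \<phi>"]
          by (intro bexI[of _ "Phi n e N \<phi>"]) auto
  qed
  moreover have "(\<Sum>i<n. C i) \<ge> 0" by (rule sum_nonneg) (use C in auto)
  ultimately show ?thesis by blast
qed

text \<open>Exchanging \<open>f\<close> and \<open>g\<close> conjugates and transposes the
  coefficient matrix, hence leaves this sum of squares unchanged. That symmetry drives the count in
  \<open>unitary_system_size\<close>.\<close>

lemma ip_Phi:
  assumes f: "f \<in> L2" and g: "g \<in> Linf"
  shows "ip (\<lambda>z. g z * sig N (\<lambda>z. f z * cnj (g z)) z) f
    = (\<Sum>i<N. \<Sum>j<N. complex_of_real ((cmod (cf (\<lambda>z. f z * cnj (g z)) i j))\<^sup>2)) / of_nat N"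
proof -
  let ?c = "cf (\<lambda>z. f z * cnj (g z))"
  have fg: "integrable mT (\<lambda>z. g z * cnj (f z))" using L2_mult_integrable(2)[OF Linf_L2[OF g] f] .
  have cc: "integral\<^sup>L mT (\<lambda>z. g z * cnj (f z) * (u z ^ i * cnj (u z) ^ j)) = cnj (?c i j)" for i j
    unfolding cf_def Bochner_Integration.integral_cnj[symmetric]
        by (simp add: mult_ac del: Bochner_Integration.integral_cnj)
  have int: "integrable mT (\<lambda>z. g z * cnj (f z) * (u z ^ i * cnj (u z) ^ j))" for i j
    using integrable_u_mult[OF fg, of j i] by (simp add: mult.commute[of "u _ ^ _"])
  have "ip (\<lambda>z. g z * sig N (\<lambda>z. f z * cnj (g z)) z) f
    = integral\<^sup>L mT (\<lambda>z. \<Sum>i<N. \<Sum>j<N. ?c i j * (g z * cnj (f z) * (u z ^ i * cnj (u z) ^ j)) / of_nat N)"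
    unfolding ip_def sig_def by (simp add: sum_distrib_left sum_distrib_right sum_divide_distrib mult_ac)
  also have "\<dots> = (\<Sum>i<N. \<Sum>j<N. ?c i j * cnj (?c i j) / of_nat N)"
    using int by (simp add: Bochner_Integration.integral_sum cc)
  finally show ?thesis by (simp add: complex_norm_square sum_divide_distrib del: of_real_power)
qed

text \<open>Both sides of the count are the same double sum of squared coefficients: the Takenaka system
  expands every \<open>J i\<close> completely, while the \<open>J i\<close> only expand a projection of every \<open>e l\<close>.\<close>

lemma unitary_system_size:
  assumes sys: "unitary_system u r J" shows "r \<le> n"
proof -
  define T where "T f g N = ip (\<lambda>z. g z * sig N (\<lambda>z. f z * cnj (g z)) z) f" for f g :: "complex \<Rightarrow> complex"
      and N
  have Tsym: "T f g N = T g f N" if "f \<in> Linf" "g \<in> Linf" for f g N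
  proof -
    have c: "cf (\<lambda>z. g z * cnj (f z)) i j = cnj (cf (\<lambda>z. f z * cnj (g z)) j i)" for i j
      unfolding cf_def Bochner_Integration.integral_cnj[symmetric]
          by (simp add: mult_ac del: Bochner_Integration.integral_cnj)
    show ?thesis
      unfolding T_def ip_Phi[OF Linf_L2[OF that(1)] that(2)] ip_Phi[OF Linf_L2[OF that(2)] that(1)] c
      by (subst sum.swap) simp
  qed
  have TPhi: "ip (Phi s G N f) f = (\<Sum>i<s. T f (G i) N)" if G: "unitary_system u s G" and f: "f \<in> L2"
      for s G N f
    unfolding Phi_def T_def
    by (rule ip_sum_left) (use f in \<open>auto intro!: Linf_L2 Linf_mult sys_Linf[OF G] sig_Linf\<close>)
  have nJ: "ip (J i) (J i) = 1" if "i < r" for i using sys_int[OF sys that that, of 0 0] by (simp add: ip_def)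
  have ne: "ip (e i) (e i) = 1" if "i < n" for i using sys_int[OF e_system that that, of 0 0]
      by (simp add: ip_def)
  \<comment> \<open>Three facts about one projection are bundled, so that a single choice over
    \<open>l\<close> delivers them together.\<close>
  define Q where "Q l p \<longleftrightarrow> p \<in> cl2 (system_span r J) \<and> (\<forall>g \<in> system_span r J. ip (\<lambda>z. e l z - p z) g = 0) \<and>
    (\<forall>i a b. i < r \<longrightarrow> cf (\<lambda>z. (e l z - p z) * cnj (J i z)) a b = 0)" for l p
  have "\<exists>p. Q l p" if "l < n" for l
    unfolding Q_def by (rule system_span_projection[OF sys sys_L2[OF e_system that]]) blast
  then have "\<forall>l. \<exists>p. l < n \<longrightarrow> Q l p" by blast
  from choice[OF this] obtain p where pQ: "\<forall>l. l < n \<longrightarrow> Q l (p l)" ..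
  then have p: "\<And>l. l < n \<Longrightarrow> p l \<in> cl2 (system_span r J)"
      "\<And>l g. l < n \<Longrightarrow> g \<in> system_span r J \<Longrightarrow> ip (\<lambda>z. e l z - p l z) g = 0"
      "\<And>l i a b. l < n \<Longrightarrow> i < r \<Longrightarrow> cf (\<lambda>z. (e l z - p l z) * cnj (J i z)) a b = 0"
    unfolding Q_def by blast+
  have limJ: "(\<lambda>N. \<Sum>i<r. ip (Phi n e N (J i)) (J i)) \<longlonglongrightarrow> (\<Sum>i<r. ip (J i) (J i))"
  proof (rule tendsto_sum)
    fix i assume "i \<in> {..<r}"
    then have i: "J i \<in> L2" using sys_L2[OF sys] by simp
    then have "J i \<in> cl2 (system_span n e)" using e_span_dense by simp
    then show "(\<lambda>N. ip (Phi n e N (J i)) (J i)) \<longlonglongrightarrow> ip (J i) (J i)"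
      by (intro n2_tendsto_ip Phi_tendsto[OF e_system] Phi_L2[OF e_system] i)
  qed
  have lime: "(\<lambda>N. \<Sum>l<n. ip (Phi r J N (e l)) (e l)) \<longlonglongrightarrow> (\<Sum>l<n. ip (p l) (e l))"
  proof (rule tendsto_sum)
    fix l assume "l \<in> {..<n}"
    then have l: "l < n" by simp
    have eL: "e l \<in> L2" using sys_L2[OF e_system l] .
    have pL: "p l \<in> L2" using p(1)[OF l] cl2_L2 by blast
    have d: "(\<lambda>z. e l z - p l z) \<in> L2" using eL pL L2_diff by blast
    \<comment> \<open>The remainder of the projection has zero coefficients, so \<open>Phi\<close>
      does not see it.\<close>
    have "Phi r J N (e l) z = Phi r J N (p l) z" for N z
    proof -
      have "Phi r J N (\<lambda>z. (e l z - p l z) + p l z) z = Phi r J N (\<lambda>z. e l z - p l z) z + Phi r J N (p l) z"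
        by (rule Phi_add[OF sys d pL])
      moreover have "Phi r J N (\<lambda>z. e l z - p l z) z = 0"
        unfolding Phi_def sig_def using p(3)[OF l] by simp
      ultimately show ?thesis by simp
    qed
    then have "Phi r J N (e l) = Phi r J N (p l)" for N by (rule ext)
    then show "(\<lambda>N. ip (Phi r J N (e l)) (e l)) \<longlonglongrightarrow> ip (p l) (e l)"
      using n2_tendsto_ip[OF Phi_L2[OF sys] pL eL Phi_tendsto[OF sys p(1)[OF l]]] by simp
  qed
  have same: "(\<Sum>i<r. ip (Phi n e N (J i)) (J i)) = (\<Sum>l<n. ip (Phi r J N (e l)) (e l))" for N
  proof -
    have "(\<Sum>i<r. ip (Phi n e N (J i)) (J i)) = (\<Sum>i<r. \<Sum>l<n. T (J i) (e l) N)"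
      by (rule sum.cong) (auto simp: TPhi[OF e_system sys_L2[OF sys]])
    also have "\<dots> = (\<Sum>l<n. \<Sum>i<r. T (e l) (J i) N)"
      by (subst sum.swap) (auto intro!: sum.cong Tsym sys_Linf[OF sys] e_Linf)
    also have "\<dots> = (\<Sum>l<n. ip (Phi r J N (e l)) (e l))"
      by (rule sum.cong) (auto simp: TPhi[OF sys sys_L2[OF e_system]])
    finally show ?thesis .
  qed
  \<comment> \<open>The left side is \<open>r\<close>; each of the \<open>n\<close> terms on the
    right is the squared length of a projected unit vector, hence at most 1.\<close>
  have "(\<Sum>i<r. ip (J i) (J i)) = (\<Sum>l<n. ip (p l) (e l))"
    using LIMSEQ_unique[OF limJ] lime unfolding same by blast
  then have "complex_of_real (real r) = (\<Sum>l<n. ip (p l) (e l))" using nJ by simp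
  then have "cmod (complex_of_real (real r)) = cmod (\<Sum>l<n. ip (p l) (e l))" by simp
  then have "real r = cmod (\<Sum>l<n. ip (p l) (e l))" by simp
  also have "\<dots> \<le> (\<Sum>l<n. 1)"
  proof (rule sum_norm_le)
    fix l assume "l \<in> {..<n}"
    then have l: "l < n" by simp
    have eL: "e l \<in> L2" using sys_L2[OF e_system l] .
    have pL: "p l \<in> L2" using p(1)[OF l] cl2_L2 by blast
    have d: "(\<lambda>z. e l z - p l z) \<in> L2" using eL pL L2_diff by blast
    have "ip (p l) (\<lambda>z. e l z - p l z) = 0"
      by (rule cl2_ip_zero[OF p(1)[OF l] system_span_L2[OF sys] d])
         (subst ip_cnj, use p(2)[OF l] in simp)
    then have pe: "ip (p l) (e l) = ip (p l) (p l)" by (simp add: ip_diff_right eL pL)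
    have n1: "n2 (e l) = 1"
    proof -
      have "complex_of_real ((n2 (e l))\<^sup>2) = 1" using ne[OF l] by (simp only: n2_sq_ip)
      then have "(n2 (e l))\<^sup>2 = 1" using of_real_eq_1_iff by blast
      then show ?thesis by (simp add: power2_eq_1_iff) (use n2_nonneg[of "e l"] in linarith)
    qed
    have "(n2 (p l))\<^sup>2 = cmod (ip (p l) (e l))" unfolding pe n2_sq_ip[symmetric] by (simp add: norm_power)
    also have "\<dots> \<le> n2 (p l)" using L2_Cauchy_Schwarz[OF pL eL] n1 by simp
    finally have le: "(n2 (p l))\<^sup>2 \<le> n2 (p l)" .
    have "n2 (p l) \<le> 1"
    proof (rule ccontr)
      assume "\<not> n2 (p l) \<le> 1"
      then have "n2 (p l) * 1 < n2 (p l) * n2 (p l)" by (intro mult_strict_left_mono) auto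
      then show False using le by (simp add: power2_eq_square)
    qed
    then show "cmod (ip (p l) (e l)) \<le> 1" using L2_Cauchy_Schwarz[OF pL eL] n1 by simp
  qed
  finally show ?thesis by simp
qed

section \<open>Analytic polynomials in u and their bounded limits\<close>

definition PA :: "(complex \<Rightarrow> complex) set" where
  "PA = cspan {\<lambda>z. u z ^ k | k. True}"

text \<open>Stands for the bounded analytic functions of \<open>u\<close>. The description through a
  closure requires no function \<open>h\<close> with q = h(u).\<close>

definition PB :: "(complex \<Rightarrow> complex) set" where
  "PB = Linf \<inter> cl2 PA"

lemma u_pow_Linf: "(\<lambda>z. u z ^ k) \<in> Linf"
  using u_pows_Linf[of k 0] by simp

lemma PA_Linf: "PA \<subseteq> Linf"
  unfolding PA_def by (rule cspan_least[OF Linf_subspace]) (auto intro: u_pow_Linf)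

lemma PA_L2: "PA \<subseteq> L2"
  using PA_Linf Linf_L2 by blast

lemma PA_subspace: "linear_subspace PA"
  unfolding PA_def by (rule cspan_subspace)

lemma u_pow_PA: "(\<lambda>z. u z ^ k) \<in> PA"
  unfolding PA_def by (rule cspan_base) auto

lemma PA_mult_u: assumes "f \<in> PA" shows "(\<lambda>z. u z ^ k * f z) \<in> PA"
  using assms unfolding PA_def
proof (rule cspan_mult_image[OF _ cspan_subspace])
  fix g assume "g \<in> {\<lambda>z. u z ^ k | k. True}"
  then obtain j where "g = (\<lambda>z. u z ^ j)" by auto
  then have "(\<lambda>z. u z ^ k * g z) = (\<lambda>z. u z ^ (k + j))" by (simp add: power_add)
  then show "(\<lambda>z. u z ^ k * g z) \<in> cspan {\<lambda>z. u z ^ k | k. True}"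
      by (simp only: cspan_base) (rule cspan_base, auto)
qed

lemma cl2_PA_moment:
  assumes q: "q \<in> cl2 PA" and k: "k \<ge> 1"
  shows "integral\<^sup>L mT (\<lambda>z. q z * u z ^ k) = 0"
proof -
  have L: "(\<lambda>z. cnj (u z) ^ k) \<in> L2" using Linf_L2[OF Linf_cnj[OF u_pow_Linf[of k]]] by simp
  have "ip g (\<lambda>z. cnj (u z) ^ k) = 0" if "g \<in> PA" for g
    using that unfolding PA_def
  proof induction
    case (add f g c)
    then obtain j where g: "g = (\<lambda>z. u z ^ j)" by auto
    have "f \<in> L2" using add(1) PA_L2 by (auto simp: PA_def)
    moreover have "g \<in> L2" unfolding g using Linf_L2[OF u_pow_Linf] .
    moreover have "ip g (\<lambda>z. cnj (u z) ^ k) = 0"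
      using integral_u_pow[of "j + k"] k by (simp add: g ip_def power_add)
    ultimately show ?case using add.IH L by (simp add: ip_add_left ip_cmult_left L2_cmult)
  qed simp
  from cl2_ip_zero[OF q PA_L2 L this] show ?thesis by (simp add: ip_def)
qed

text \<open>The assumption removes the coefficients of negative index, and the remaining terms are
  powers of \<open>u\<close>.\<close>

lemma sig_PA:
  assumes m: "\<And>k. k \<ge> 1 \<Longrightarrow> integral\<^sup>L mT (\<lambda>z. f z * u z ^ k) = 0"
  shows "sig N f \<in> PA"
proof -
  have t: "(\<lambda>z. cf f i j * (u z ^ i * cnj (u z) ^ j)) \<in> PA" for i j
  proof (cases "j \<le> i")
    case True
    then show ?thesis
      unfolding u_power_cases using linear_subspaceD(3)[OF PA_subspace u_pow_PA] by simp
  next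
    case False
    then have "cf f i j = integral\<^sup>L mT (\<lambda>z. f z * u z ^ (j - i))"
      unfolding cf_def mult.commute[of "cnj (u _) ^ _"] u_power_cases by simp
    then show ?thesis using m[of "j - i"] False linear_subspaceD(1)[OF PA_subspace] by simp
  qed
  have "(\<lambda>z. (1 / of_nat N) * (\<Sum>i<N. \<Sum>j<N. cf f i j * (u z ^ i * cnj (u z) ^ j))) \<in> PA"
    by (intro linear_subspaceD(3)[OF PA_subspace] linear_subspace_sum[OF PA_subspace] t) auto
  then show ?thesis by (simp add: sig_def[abs_def])
qed

text \<open>With the constant 1 as its only member, \<open>sig\<close> becomes an instance of
  \<open>Phi\<close> and inherits the convergence.\<close>

lemma one_system: "unitary_system u 1 (\<lambda>i z. 1)"
  unfolding unitary_system_def using integral_u_pows by (auto simp: Linf_const)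

lemma sig_tendsto:
  assumes "f \<in> cl2 (cspan {\<lambda>z. u z ^ p * cnj (u z) ^ q | p q. True})"
  shows "(\<lambda>N. n2 (\<lambda>z. sig N f z - f z)) \<longlonglongrightarrow> 0"
proof -
  have "system_span 1 (\<lambda>i z. 1) = cspan {\<lambda>z. u z ^ p * cnj (u z) ^ q | p q. True}"
    unfolding system_span_def by (rule arg_cong[of _ _ cspan]) auto
  then show ?thesis using Phi_tendsto[OF one_system, of f] assms by (simp add: Phi_def)
qed

lemma PA_trig: "PA \<subseteq> cspan {\<lambda>z. u z ^ p * cnj (u z) ^ q | p q. True}"
  unfolding PA_def
proof (rule cspan_least[OF cspan_subspace], safe)
  fix k
  have "(\<lambda>z. u z ^ k * cnj (u z) ^ 0) \<in> cspan {\<lambda>z. u z ^ p * cnj (u z) ^ q | p q. True}"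
    by (rule cspan_base) blast
  then show "(\<lambda>z. u z ^ k) \<in> cspan {\<lambda>z. u z ^ p * cnj (u z) ^ q | p q. True}" by simp
qed

text \<open>Fejer means never exceed the bound of \<open>q\<close>. Density in L2 alone would give
  polynomials without a common bound, to which the continuity of \<alpha> could not be
  applied.\<close>

lemma PB_approx:
  assumes q: "q \<in> PB"
  obtains C s where "C \<ge> 0" "AE z in mT. cmod (q z) \<le> C" "\<And>N. s N \<in> PA" "\<And>N z. cmod (s N z) \<le> C"
    "(\<lambda>N. n2 (\<lambda>z. s N z - q z)) \<longlonglongrightarrow> 0"
proof -
  have qi: "q \<in> Linf" and qc: "q \<in> cl2 PA" using q by (auto simp: PB_def)
  obtain C where C: "C \<ge> 0" "AE z in mT. cmod (q z) \<le> C" using Linf_bound[OF qi] by auto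
  have "(\<lambda>N. n2 (\<lambda>z. sig N q z - q z)) \<longlonglongrightarrow> 0" using sig_tendsto cl2_mono[OF PA_trig] qc by blast
  \<comment> \<open>The shift skips \<open>sig 0\<close>, where the mean would divide by zero and
    \<open>sig_bound\<close> does not apply.\<close>
  then have "(\<lambda>N. n2 (\<lambda>z. sig (Suc N) q z - q z)) \<longlonglongrightarrow> 0" by (rule LIMSEQ_Suc)
  moreover have "cmod (sig (Suc N) q z) \<le> C" for N z
    by (rule sig_bound[OF L2_integrable[OF Linf_L2[OF qi]] C(2)]) simp
  ultimately show ?thesis using that[OF C, of "\<lambda>N. sig (Suc N) q"] sig_PA[OF cl2_PA_moment[OF qc]] by blast
qed

text \<open>A Szego extremal problem replaces outer functions: with \<open>w = 1 + \<epsilon> F\<close>, the element of least norm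
  among the \<open>sqrt w * p(B)\<close>, \<open>p(0) = 1\<close>, is orthogonal to its own multiples by powers of \<open>B\<close>.\<close>

lemma truncation:
  assumes F: "integrable mT F" "\<And>z. F z \<ge> (0::real)"
  shows "\<exists>C\<ge>0. \<forall>\<delta>>0. \<exists>q\<in>PB. \<exists>D\<ge>0. n2 (\<lambda>z. q z - 1) < \<delta> \<and> (AE z in mT. cmod (q z) \<le> C) \<and> (AE z
      in mT. (cmod (q z))\<^sup>2 * F z \<le> D)"
proof -
  obtain C where C: "C \<ge> 0" and Cb0: "\<forall>\<phi>\<in>L2. (\<forall>k\<ge>1. integral\<^sup>L mT (\<lambda>z. complex_of_real ((cmod (\<phi> z))\<^sup>2)
      * u z ^ k) = 0) \<longrightarrow>
     (AE z in mT. cmod (\<phi> z) \<le> C * n2 \<phi>)"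
    using flat_bounded by (elim exE conjE)
  have Cb: "AE z in mT. cmod (\<phi> z) \<le> C * n2 \<phi>"
    if "\<phi> \<in> L2" "\<And>k. k \<ge> 1 \<Longrightarrow> integral\<^sup>L mT (\<lambda>z. complex_of_real ((cmod (\<phi> z))\<^sup>2) * u z ^ k) = 0" for \<phi>
    using Cb0[rule_format, OF that] .
  have [measurable]: "F \<in> borel_measurable borel" using borel_measurable_integrable[OF F(1)] by simp
  have "\<exists>q\<in>PB. \<exists>D\<ge>0. n2 (\<lambda>z. q z - 1) < \<delta> \<and> (AE z in mT. cmod (q z) \<le> C * sqrt 2) \<and> (AE z
      in mT. (cmod (q z))\<^sup>2 * F z \<le> D)"
    if \<delta>: "\<delta> > 0" for \<delta>
  proof -
    define IF where "IF = integral\<^sup>L mT F"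
    have IF: "IF \<ge> 0" unfolding IF_def by (rule Bochner_Integration.integral_nonneg) (use F in auto)
    \<comment> \<open>Chosen so that \<epsilon> times the integral of \<open>F\<close> is at most 1
      and at most \<delta>^2 / 2. The first keeps the norm of the extremal function below a fixed
      constant, the second brings \<open>q\<close> close to 1.\<close>
    define \<epsilon> where "\<epsilon> = min 1 (\<delta>\<^sup>2 / 2) / (IF + 1)"
    have e0: "\<epsilon> > 0" using IF \<delta> by (simp add: \<epsilon>_def)
    have "\<epsilon> * (IF + 1) = min 1 (\<delta>\<^sup>2 / 2)" using IF by (simp add: \<epsilon>_def)
    moreover have "\<epsilon> * IF \<le> \<epsilon> * (IF + 1)" using e0 by (intro mult_left_mono) auto
    ultimately have e1: "\<epsilon> * IF \<le> 1" and e2: "\<epsilon> * IF \<le> \<delta>\<^sup>2 / 2" by auto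
    define w where "w z = 1 + \<epsilon> * F z" for z
    have w1: "w z \<ge> 1" for z using F(2)[of z] e0 by (simp add: w_def)
    have [measurable]: "w \<in> borel_measurable borel" unfolding w_def by measurable
    have wi: "integrable mT w" and Iw: "integral\<^sup>L mT w = 1 + \<epsilon> * IF"
      unfolding w_def IF_def using F by auto
    define sw where "sw z = complex_of_real (sqrt (w z))" for z
    have sw0: "sw z \<noteq> 0" "cmod (sw z) = sqrt (w z)" "sqrt (w z) \<ge> 1" for z
      using w1[of z] by (auto simp: sw_def)
    have swi: "cmod (1 / sw z) \<le> 1" for z
    proof -
      have "w z > 0" using w1[of z] by linarith
      then show ?thesis using w1[of z] by (simp add: norm_divide sw0(2) divide_le_eq_1)
    qed
    have [measurable]: "sw \<in> borel_measurable borel" unfolding sw_def by measurable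
    have swsq: "(cmod (sw z))\<^sup>2 = w z" for z using w1[of z] by (simp add: sw_def)
    have swL: "sw \<in> L2" unfolding L2_def using wi by (simp add: swsq)
    have nsw: "(n2 sw)\<^sup>2 = 1 + \<epsilon> * IF" by (simp add: n2_sq swsq Iw)
    \<comment> \<open>Multiples of \<open>u\<close> are the polynomials without constant term: the
      directions in which a competitor with value 1 at the origin may vary.\<close>
    define A where "A = (\<lambda>p z. u z * p z * sw z) ` PA"
    have AL: "A \<subseteq> L2"
    proof
      fix f assume "f \<in> A"
      then obtain p where p: "p \<in> PA" "f = (\<lambda>z. u z * p z * sw z)" by (auto simp: A_def)
      have "(\<lambda>z. u z * p z) \<in> Linf" using Linf_mult[OF u_pow_Linf[of 1]] p PA_Linf by auto
      then show "f \<in> L2" unfolding p using L2_mult_Linf(1)[OF swL] by blast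
    qed
    have Asub: "linear_subspace A"
      unfolding linear_subspace_def
    proof (intro conjI ballI allI)
      show "(\<lambda>z. 0) \<in> A" unfolding A_def using linear_subspaceD(1)[OF PA_subspace]
          by (auto intro!: image_eqI[of _ _ "\<lambda>z. 0"])
      fix f assume "f \<in> A"
      then obtain p where p: "p \<in> PA" "f = (\<lambda>z. u z * p z * sw z)" by (auto simp: A_def)
      show "(\<lambda>z. c * f z) \<in> A" for c
        unfolding A_def using linear_subspaceD(3)[OF PA_subspace p(1), of c]
        by (intro image_eqI[of _ _ "\<lambda>z. c * p z"]) (auto simp: p mult_ac)
      fix g assume "g \<in> A"
      then obtain p' where p': "p' \<in> PA" "g = (\<lambda>z. u z * p' z * sw z)" by (auto simp: A_def)
      show "(\<lambda>z. f z + g z) \<in> A"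
        unfolding A_def using linear_subspaceD(2)[OF PA_subspace p(1) p'(1)]
        by (intro image_eqI[of _ _ "\<lambda>z. p z + p' z"]) (auto simp: p p' algebra_simps)
    qed
    obtain s where s: "s \<in> cl2 A" "\<And>g. g \<in> A \<Longrightarrow> ip (\<lambda>z. sw z - s z) g = 0"
      using L2_projection[OF Asub AL swL] by blast
    have sL: "s \<in> L2" using s cl2_L2 by blast
    define v where "v z = sw z - s z" for z
    have vL: "v \<in> L2" unfolding v_def using swL sL L2_diff by blast
    note [measurable] = L2_measurable[OF vL]
    have v_perp: "ip v g = 0" if "g \<in> cl2 A" for g
    proof -
      have "ip g v = 0"
        by (rule cl2_ip_zero[OF that AL vL]) (subst ip_cnj, use s(2) in \<open>simp add: v_def[abs_def]\<close>)
      then show ?thesis using ip_cnj[of v g] by simp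
    qed
    define V where "V = (\<lambda>p z. p z * sw z) ` PA"
    have VL: "V \<subseteq> L2" using L2_mult_Linf(1)[OF swL] PA_Linf by (auto simp: V_def)
    have uA: "(\<lambda>z. u z ^ k * g z) \<in> A" if k: "k \<ge> 1" and g: "g \<in> V" for k g
    proof -
      obtain p where p: "p \<in> PA" "g = (\<lambda>z. p z * sw z)" using g by (auto simp: V_def)
      obtain j where j: "k = Suc j" using k by (cases k) auto
      show ?thesis unfolding A_def using PA_mult_u[OF p(1), of j]
        by (intro image_eqI[of _ _ "\<lambda>z. u z ^ j * p z"]) (auto simp: p j mult_ac)
    qed
    have vV: "v \<in> cl2 V"
    proof (rule cl2I[OF vL])
      fix \<eta> :: real assume "\<eta> > 0"
      then obtain g where g: "g \<in> A" "n2 (\<lambda>z. s z - g z) < \<eta>" using cl2D[OF s(1)] by blast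
      then obtain p where p: "p \<in> PA" "g = (\<lambda>z. u z * p z * sw z)" by (auto simp: A_def)
      have "(\<lambda>z. 1 - u z * p z) \<in> PA"
        using linear_subspaceD(4)[OF PA_subspace u_pow_PA[of 0] PA_mult_u[OF p(1), of 1]] by simp
      then have "(\<lambda>z. (1 - u z * p z) * sw z) \<in> V" by (auto simp: V_def)
      moreover have "(\<lambda>z. v z - (1 - u z * p z) * sw z) = (\<lambda>z. g z - s z)"
        by (auto simp: v_def p algebra_simps)
      ultimately show "\<exists>g\<in>V. n2 (\<lambda>z. v z - g z) < \<eta>" using g(2) n2_diff_commute[of g s] by metis
    qed
    \<comment> \<open>Minimality makes \<open>v\<close> orthogonal to \<open>cl2 A\<close>, which
      contains u^k v for k \<ge> 1; this is the flatness of its squared modulus.\<close>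
    have flat: "integral\<^sup>L mT (\<lambda>z. complex_of_real ((cmod (v z))\<^sup>2) * u z ^ k) = 0" if k: "k \<ge> 1" for k
    proof -
      have "(\<lambda>z. u z ^ k * v z) \<in> cl2 A"
        by (rule cl2_mult[OF vV VL, where C=1]) (use uA[OF k] in \<open>auto simp: norm_power\<close>)
      then have "ip (\<lambda>z. u z ^ k * v z) v = 0" using v_perp ip_cnj[of "\<lambda>z. u z ^ k * v z" v] by simp
      then show ?thesis unfolding complex_norm_square by (simp add: ip_def mult_ac)
    qed
    have vb: "AE z in mT. cmod (v z) \<le> C * n2 v" by (rule Cb[OF vL flat])
    have nv: "(n2 v)\<^sup>2 \<le> 1 + \<epsilon> * IF"
    proof -
      have "ip v s = 0" using v_perp s(1) by blast
      then have "(n2 (\<lambda>z. v z + s z))\<^sup>2 = (n2 v)\<^sup>2 + (n2 s)\<^sup>2" using n2_sq_add[OF vL sL] by simp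
      moreover have "(\<lambda>z. v z + s z) = sw" by (auto simp: v_def)
      ultimately have "(n2 v)\<^sup>2 + (n2 s)\<^sup>2 = 1 + \<epsilon> * IF" using nsw by metis
      then show ?thesis using zero_le_power2[of "n2 s"] by linarith
    qed
    \<comment> \<open>A bound free of \<delta>, so that \<open>C * sqrt 2\<close> can serve as the
      common bound of all \<open>q\<close>.\<close>
    then have nv2: "n2 v \<le> sqrt 2" using e1 by (intro real_le_rsqrt) linarith
    define q where "q z = v z / sw z" for z
    have [measurable]: "q \<in> borel_measurable borel" unfolding q_def by measurable
    have qv: "cmod (q z) * sqrt (w z) = cmod (v z)" for z
      using sw0[of z] by (simp add: q_def norm_divide)
    have qlev: "cmod (q z) \<le> cmod (v z)" for z
      using qv[of z] sw0(3)[of z] mult_left_mono[OF sw0(3)[of z] norm_ge_zero[of "q z"]] by simp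
    have vC: "AE z in mT. cmod (v z) \<le> C * sqrt 2"
      using vb
    proof eventually_elim
      case (elim z)
      have "C * n2 v \<le> C * sqrt 2" using nv2 C by (intro mult_left_mono) auto
      then show ?case using elim by simp
    qed
    have qC: "AE z in mT. cmod (q z) \<le> C * sqrt 2"
      using vC by eventually_elim (use qlev order_trans in blast)
    have qL: "q \<in> L2" by (rule L2_bounded[OF _ qC]) measurable
    have qcl: "q \<in> cl2 PA"
    proof -
      have "(\<lambda>z. (1 / sw z) * v z) \<in> cl2 PA"
      proof (rule cl2_mult[OF vV VL, where C=1])
        show "AE z in mT. cmod (1 / sw z) \<le> 1" using swi by simp
        fix g assume "g \<in> V"
        then obtain p where p: "p \<in> PA" "g = (\<lambda>z. p z * sw z)" by (auto simp: V_def)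
        then have "(\<lambda>z. 1 / sw z * g z) = p" using sw0(1) by auto
        then show "(\<lambda>z. 1 / sw z * g z) \<in> PA" using p by simp
      qed measurable
      then show ?thesis by (simp add: q_def[abs_def])
    qed
    have qP: "q \<in> PB" unfolding PB_def using qcl qC by (auto intro: LinfI)
    text \<open>The value at the origin is the mean, which is 1 for every competitor.\<close>
    have q1: "ip q (\<lambda>z. 1) = 1"
    proof -
      have "(\<lambda>z. (1 / sw z) * s z) \<in> cl2 ((\<lambda>p z. u z * p z) ` PA)"
      proof (rule cl2_mult[OF s(1) AL, where C=1])
        show "AE z in mT. cmod (1 / sw z) \<le> 1" using swi by simp
        fix g assume "g \<in> A"
        then obtain p where p: "p \<in> PA" "g = (\<lambda>z. u z * p z * sw z)" by (auto simp: A_def)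
        then have "(\<lambda>z. 1 / sw z * g z) = (\<lambda>z. u z * p z)" using sw0(1) by auto
        then show "(\<lambda>z. 1 / sw z * g z) \<in> (\<lambda>p z. u z * p z) ` PA" using p by blast
      qed measurable
      then have "ip (\<lambda>z. (1 / sw z) * s z) (\<lambda>z. 1) = 0"
      proof (rule cl2_ip_zero[OF _ _ L2_const])
        show "(\<lambda>p z. u z * p z) ` PA \<subseteq> L2"
          using PA_mult_u[of _ 1] PA_L2 by auto
        fix g assume "g \<in> (\<lambda>p z. u z * p z) ` PA"
        then obtain p where p: "p \<in> PA" "g = (\<lambda>z. u z * p z)" by auto
        have "p \<in> cl2 PA" using p subset_cl2[OF PA_L2] by blast
        from cl2_PA_moment[OF this, of 1] show "ip g (\<lambda>z. 1) = 0" by (simp add: ip_def p mult.commute)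
      qed
      moreover have "q = (\<lambda>z. 1 - (1 / sw z) * s z)" using sw0(1) by (auto simp: q_def v_def field_simps)
      moreover have "(\<lambda>z. (1 / sw z) * s z) \<in> L2"
        by (rule L2_mult_bounded[OF sL, where C=1]) (use swi in auto)
      ultimately show ?thesis using ip_diff_left[OF L2_const[of 1] _ L2_const[of 1]] by (simp add: ip_def)
    qed
    \<comment> \<open>Because \<open>q\<close> has mean 1, its distance to 1 is governed by its norm
      alone.\<close>
    have "(n2 (\<lambda>z. q z - 1))\<^sup>2 = (n2 q)\<^sup>2 - 1"
      using n2_sq_diff[OF qL L2_const[of 1]] q1 by simp
    also have "\<dots> \<le> (n2 v)\<^sup>2 - 1"
      using n2_mono[OF _ vL, of q] qlev by (auto intro!: power_mono)
    also have "\<dots> \<le> \<delta>\<^sup>2 / 2" using nv e2 by simp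
    also have "\<dots> < \<delta>\<^sup>2" using \<delta> by simp
    finally have q\<delta>: "n2 (\<lambda>z. q z - 1) < \<delta>" using \<delta> by (simp add: power2_less_imp_less)
    \<comment> \<open>In contrast to the bound on \<open>q\<close>, this one depends on \<epsilon>
      and thereby on \<delta>.\<close>
    have "AE z in mT. (cmod (q z))\<^sup>2 * F z \<le> (C * sqrt 2)\<^sup>2 / \<epsilon>"
      using vC
    proof eventually_elim
      case (elim z)
      have "(cmod (q z))\<^sup>2 * (\<epsilon> * F z) \<le> (cmod (q z))\<^sup>2 * w z" by (intro mult_left_mono) (auto simp: w_def)
      also have "\<dots> = (cmod (v z))\<^sup>2" unfolding qv[of z, symmetric] using w1[of z]
          by (simp add: power_mult_distrib)
      also have "\<dots> \<le> (C * sqrt 2)\<^sup>2" using elim by (intro power_mono) auto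
      finally show ?case using e0 by (simp add: field_simps)
    qed
    moreover have "(C * sqrt 2)\<^sup>2 / \<epsilon> \<ge> 0" using e0 by simp
    ultimately show ?thesis using qP q\<delta> qC by blast
  qed
  moreover have "C * sqrt 2 \<ge> 0" using C by simp
  ultimately show ?thesis by blast
qed

end

section \<open>Gauge norms\<close>

locale gauge =
  fixes \<alpha> :: "(complex \<Rightarrow> complex) \<Rightarrow> real"
  assumes dom: "dominating_gauge_norm \<alpha>" and cont: "continuous_gauge \<alpha>"
begin

lemma al_AE: "f \<in> Linf \<Longrightarrow> g \<in> Linf \<Longrightarrow> AE z in mT. f z = g z \<Longrightarrow> \<alpha> f = \<alpha> g"
  using dom unfolding dominating_gauge_norm_def by blast

lemma al_nonneg: "f \<in> Linf \<Longrightarrow> 0 \<le> \<alpha> f"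
  using dom unfolding dominating_gauge_norm_def by blast

lemma al_add: "f \<in> Linf \<Longrightarrow> g \<in> Linf \<Longrightarrow> \<alpha> (\<lambda>z. f z + g z) \<le> \<alpha> f + \<alpha> g"
  using dom unfolding dominating_gauge_norm_def by blast

lemma al_cmult: "f \<in> Linf \<Longrightarrow> \<alpha> (\<lambda>z. c * f z) = cmod c * \<alpha> f"
  using dom unfolding dominating_gauge_norm_def by blast

lemma al_one: "\<alpha> (\<lambda>z. 1) = 1"
  using dom unfolding dominating_gauge_norm_def by blast

lemma al_cmod: "f \<in> Linf \<Longrightarrow> \<alpha> (\<lambda>z. complex_of_real (cmod (f z))) = \<alpha> f"
  using dom unfolding dominating_gauge_norm_def by blast

lemma al_L1: "f \<in> Linf \<Longrightarrow> integral\<^sup>L mT (\<lambda>z. cmod (f z)) \<le> \<alpha> f"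
  using dom unfolding dominating_gauge_norm_def L1norm_def by blast

lemma Linf_cmod: "f \<in> Linf \<Longrightarrow> (\<lambda>z. complex_of_real (cmod (f z))) \<in> Linf"
  by (auto simp: Linf_def)

lemma al_cong_cmod:
  assumes "f \<in> Linf" "g \<in> Linf" "AE z in mT. cmod (f z) = cmod (g z)"
  shows "\<alpha> f = \<alpha> g"
proof -
  have "\<alpha> (\<lambda>z. complex_of_real (cmod (f z))) = \<alpha> (\<lambda>z. complex_of_real (cmod (g z)))"
    by (rule al_AE) (use assms Linf_cmod in \<open>auto elim: eventually_mono\<close>)
  then show ?thesis using al_cmod assms by simp
qed

text \<open>A function of modulus at most one is the average of two unimodular ones.\<close>

lemma al_mono:
  assumes f: "f \<in> Linf" and g: "g \<in> Linf" and le: "AE z in mT. cmod (f z) \<le> cmod (g z)"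
  shows "\<alpha> f \<le> \<alpha> g"
proof -
  note [measurable] = LinfD[OF f] LinfD[OF g]
  \<comment> \<open>Where the assumed inequality fails \<open>h\<close> is set to 0, so that it
    stays in [0, 1] everywhere. Division by zero also gives 0, which is right because
    \<open>f\<close> vanishes there with \<open>g\<close>.\<close>
  define h where "h z = (if cmod (f z) \<le> cmod (g z) then cmod (f z) / cmod (g z) else 0)" for z
  have h: "0 \<le> h z" "h z \<le> 1" for z by (auto simp: h_def divide_le_eq_1)
  have [measurable]: "h \<in> borel_measurable borel" unfolding h_def by measurable
  define v where "v z = Complex (h z) (sqrt (1 - (h z)\<^sup>2))" for z
  have v': "v z = complex_of_real (h z) + \<i> * complex_of_real (sqrt (1 - (h z)\<^sup>2))" for z
    by (simp add: v_def complex_eq_iff)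
  have [measurable]: "v \<in> borel_measurable borel" unfolding v' by measurable
  have vn: "cmod (v z) = 1" for z
  proof -
    have "(h z)\<^sup>2 \<le> 1" using h[of z] by (simp add: power_le_one)
    then show ?thesis by (simp add: v_def cmod_def)
  qed
  have vg: "(\<lambda>z. v z * g z) \<in> Linf" "(\<lambda>z. cnj (v z) * g z) \<in> Linf"
    using Linf_mult[OF LinfI[where C=1] g] vn by auto
  have sum: "(\<lambda>z. (1/2) * (v z * g z) + (1/2) * (cnj (v z) * g z)) \<in> Linf"
    by (intro Linf_add Linf_mult[OF Linf_const] vg)
  have "\<alpha> f = \<alpha> (\<lambda>z. (1/2) * (v z * g z) + (1/2) * (cnj (v z) * g z))"
  proof (rule al_cong_cmod[OF f sum], use le in eventually_elim)
    case (elim z)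
    have "(1/2) * (v z * g z) + (1/2) * (cnj (v z) * g z) = ((v z + cnj (v z)) / 2) * g z"
        by (simp add: algebra_simps)
    also have "(v z + cnj (v z)) / 2 = complex_of_real (h z)" by (simp add: v_def complex_eq_iff)
    finally have "cmod ((1/2) * (v z * g z) + (1/2) * (cnj (v z) * g z)) = h z * cmod (g z)" using h[of z]
        by (simp add: norm_mult)
    then show ?case using elim by (auto simp: h_def)
  qed
  also have "\<dots> \<le> \<alpha> (\<lambda>z. (1/2) * (v z * g z)) + \<alpha> (\<lambda>z. (1/2) * (cnj (v z) * g z))"
    by (intro al_add Linf_mult[OF Linf_const] vg)
  also have "\<dots> = (1/2) * \<alpha> (\<lambda>z. v z * g z) + (1/2) * \<alpha> (\<lambda>z. cnj (v z) * g z)"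
    unfolding al_cmult[OF vg(1)] al_cmult[OF vg(2)] by simp
  also have "\<alpha> (\<lambda>z. v z * g z) = \<alpha> g" by (rule al_cong_cmod[OF vg(1) g]) (simp add: norm_mult vn)
  also have "\<alpha> (\<lambda>z. cnj (v z) * g z) = \<alpha> g" by (rule al_cong_cmod[OF vg(2) g]) (simp add: norm_mult vn)
  finally show ?thesis by simp
qed

lemma al_const: "\<alpha> (\<lambda>z. c) = cmod c"
  using al_cmult[OF Linf_const[of 1], of c] al_one by simp

abbreviation ext :: "(complex \<Rightarrow> complex) \<Rightarrow> ennreal" where
  "ext \<equiv> alpha_ext \<alpha>"

text \<open>The supremum defining \<open>ext\<close> runs over simple functions. Rounding |g| down
  to multiples of \<epsilon> gives a simple function that loses at most \<epsilon> in
  \<alpha>.\<close>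

lemma al_le_ext:
  assumes g: "g \<in> Linf" and le: "AE z in mT. cmod (g z) \<le> cmod (f z)"
  shows "ennreal (\<alpha> g) \<le> ext f"
proof (rule ennreal_le_epsilon)
  note [measurable] = LinfD[OF g]
  obtain C where C: "C \<ge> 0" "AE z in mT. cmod (g z) \<le> C" using Linf_bound[OF g] by auto
  fix \<epsilon> :: real assume e: "\<epsilon> > 0"
  \<comment> \<open>The second branch affects only a null set and keeps the range of
    \<open>s\<close> finite.\<close>
  define s where "s z = (if cmod (g z) \<le> C then \<epsilon> * real_of_int \<lfloor>cmod (g z) / \<epsilon>\<rfloor> else 0)" for z
  have [measurable]: "s \<in> borel_measurable borel" unfolding s_def by measurable
  have s0: "0 \<le> s z" for z using e by (simp add: s_def)
  have sg: "s z \<le> cmod (g z)" for z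
  proof -
    have "\<epsilon> * real_of_int \<lfloor>cmod (g z) / \<epsilon>\<rfloor> \<le> \<epsilon> * (cmod (g z) / \<epsilon>)" using e by (intro mult_left_mono) auto
    then show ?thesis using e by (simp add: s_def)
  qed
  have gs: "cmod (g z) \<le> s z + \<epsilon>" if "cmod (g z) \<le> C" for z
  proof -
    have "cmod (g z) / \<epsilon> \<le> real_of_int \<lfloor>cmod (g z) / \<epsilon>\<rfloor> + 1" by linarith
    then have "\<epsilon> * (cmod (g z) / \<epsilon>) \<le> \<epsilon> * (real_of_int \<lfloor>cmod (g z) / \<epsilon>\<rfloor> + 1)" using e
        by (intro mult_left_mono) auto
    then show ?thesis using e that by (simp add: s_def algebra_simps)
  qed
  have "range s \<subseteq> (\<lambda>k::int. \<epsilon> * real_of_int k) ` {0..\<lfloor>C / \<epsilon>\<rfloor>}"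
  proof safe
    fix z
    show "s z \<in> (\<lambda>k::int. \<epsilon> * real_of_int k) ` {0..\<lfloor>C / \<epsilon>\<rfloor>}"
    proof (cases "cmod (g z) \<le> C")
      case True
      then have "\<lfloor>cmod (g z) / \<epsilon>\<rfloor> \<le> \<lfloor>C / \<epsilon>\<rfloor>" using e by (intro floor_mono divide_right_mono) auto
      then show ?thesis using True e by (auto simp: s_def)
    next
      case False
      have "0 \<le> \<lfloor>C / \<epsilon>\<rfloor>" using C e by simp
      then show ?thesis using False by (auto simp: s_def intro!: image_eqI[of _ _ 0])
    qed
  qed
  then have "finite (range s)" by (rule finite_subset) simp
  then have ss: "simple_function mT s" by (intro simple_function_borel_measurable) auto
  have sL: "(\<lambda>z. complex_of_real (s z)) \<in> Linf"
    by (rule LinfI[where C=C]) (use s0 sg C in \<open>auto elim!: eventually_mono intro: order_trans[OF sg]\<close>)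
  have "\<alpha> g \<le> \<alpha> (\<lambda>z. complex_of_real (s z) + complex_of_real \<epsilon>)"
  proof (rule al_mono[OF g Linf_add[OF sL Linf_const]], use C(2) in eventually_elim)
    case (elim z)
    have "cmod (complex_of_real (s z) + complex_of_real \<epsilon>) = s z + \<epsilon>"
      using s0[of z] e by (simp flip: of_real_add)
    then show ?case using gs[OF elim] by simp
  qed
  also have "\<dots> \<le> \<alpha> (\<lambda>z. complex_of_real (s z)) + \<epsilon>"
    using al_add[OF sL Linf_const[of "complex_of_real \<epsilon>"]] al_const[of "complex_of_real \<epsilon>"] e by simp
  finally have "ennreal (\<alpha> g) \<le> ennreal (\<alpha> (\<lambda>z. complex_of_real (s z)) + \<epsilon>)" by (rule ennreal_leI)
  also have "\<dots> = ennreal (\<alpha> (\<lambda>z. complex_of_real (s z))) + ennreal \<epsilon>"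
    using e al_nonneg[OF sL] by (intro ennreal_plus) auto
  also have "ennreal (\<alpha> (\<lambda>z. complex_of_real (s z))) \<le> ext f"
    unfolding alpha_ext_def
    by (rule SUP_upper) (use ss s0 sg le in \<open>auto elim!: eventually_mono intro: order_trans[OF sg]\<close>)
  finally show "ennreal (\<alpha> g) \<le> ext f + ennreal \<epsilon>" by (simp add: add_right_mono)
qed

text \<open>Together with \<open>al_le_ext\<close> this describes \<open>ext\<close> as a supremum
  over bounded minorants, so later estimates never mention simple functions.\<close>

lemma ext_leI:
  assumes "\<And>g. g \<in> Linf \<Longrightarrow> AE z in mT. cmod (g z) \<le> cmod (f z) \<Longrightarrow> ennreal (\<alpha> g) \<le> x"
  shows "ext f \<le> x"
  unfolding alpha_ext_def
proof (rule SUP_least)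
  fix s assume "s \<in> {s :: complex \<Rightarrow> real. simple_function mT s \<and> (\<forall>z. 0 \<le> s z) \<and> (AE z in mT. s z
      \<le> cmod (f z))}"
  then have s: "simple_function mT s" "\<And>z. 0 \<le> s z" "AE z in mT. s z \<le> cmod (f z)" by auto
  have [measurable]: "s \<in> borel_measurable borel" using borel_measurable_simple_function[OF s(1)] by simp
  have fin: "finite (range s)" using simple_functionD(1)[OF s(1)] by simp
  have "s z \<le> Max (range s)" for z using fin by (intro Max_ge) auto
  then have "(\<lambda>z. complex_of_real (s z)) \<in> Linf" by (intro LinfI[where C="Max (range s)"]) (use s(2) in auto)
  then show "ennreal (\<alpha> (\<lambda>z. complex_of_real (s z))) \<le> x" by (rule assms) (use s in simp)
qed

lemma ext_mono: "AE z in mT. cmod (f z) \<le> cmod (g z) \<Longrightarrow> ext f \<le> ext g"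
  by (rule ext_leI, rule al_le_ext) (auto elim: eventually_elim2)

lemma ext_Linf: "f \<in> Linf \<Longrightarrow> ext f \<le> ennreal (\<alpha> f)"
  by (rule ext_leI) (auto intro!: ennreal_leI al_mono)

lemma ext_cong_cmod: "AE z in mT. cmod (f z) = cmod (g z) \<Longrightarrow> ext f = ext g"
  by (intro antisym ext_mono) (auto elim: eventually_mono)

lemma ext_AE_zero: assumes "AE z in mT. f z = 0" shows "ext f = 0"
proof -
  have "ext f \<le> ext (\<lambda>z. 0)" by (rule ext_mono) (use assms in \<open>auto elim: eventually_mono\<close>)
  also have "\<dots> \<le> ennreal (\<alpha> (\<lambda>z. 0))" by (rule ext_Linf[OF Linf_const])
  finally show ?thesis using al_const[of 0] by simp
qed

text \<open>A bounded minorant of |f + g| is split in the proportion of |f| to |g|; the two pieces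
  are minorants of |f| and |g|.\<close>

lemma ext_add:
  assumes f: "f \<in> borel_measurable borel" and g: "g \<in> borel_measurable borel"
  shows "ext (\<lambda>z. f z + g z) \<le> ext f + ext g"
proof (rule ext_leI)
  fix h assume h: "h \<in> Linf" and le: "AE z in mT. cmod (h z) \<le> cmod (f z + g z)"
  note [measurable] = f g LinfD[OF h]
  obtain C where C: "C \<ge> 0" "AE z in mT. cmod (h z) \<le> C" using Linf_bound[OF h] by auto
  define D where "D z = cmod (f z) + cmod (g z)" for z
  have D: "D z \<ge> 0" "cmod (f z) \<le> D z" "cmod (g z) \<le> D z" "cmod (f z + g z) \<le> D z" for z
    by (auto simp: D_def norm_triangle_ineq)
  have [measurable]: "D \<in> borel_measurable borel" unfolding D_def by measurable
  define h1 where "h1 z = complex_of_real (cmod (h z) * (cmod (f z) / D z))" for z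
  define h2 where "h2 z = complex_of_real (cmod (h z) * (cmod (g z) / D z))" for z
  have r: "0 \<le> cmod (f z) / D z" "cmod (f z) / D z \<le> 1" "0 \<le> cmod (g z) / D z" "cmod (g z) / D z \<le> 1" for z
    using D[of z] by (auto simp: divide_le_eq_1)
  have n1: "cmod (h1 z) = cmod (h z) * (cmod (f z) / D z)" for z using r[of z]
      by (simp only: h1_def norm_of_real) (simp add: D(1))
  have n2: "cmod (h2 z) = cmod (h z) * (cmod (g z) / D z)" for z using r[of z]
      by (simp only: h2_def norm_of_real) (simp add: D(1))
  have b1: "cmod (h1 z) \<le> cmod (h z)" for z unfolding n1 using r[of z] by (intro mult_left_le) auto
  have b2: "cmod (h2 z) \<le> cmod (h z)" for z unfolding n2 using r[of z] by (intro mult_left_le) auto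
  have [measurable]: "h1 \<in> borel_measurable borel" "h2 \<in> borel_measurable borel"
    unfolding h1_def h2_def by measurable
  have L: "h1 \<in> Linf" "h2 \<in> Linf"
    using C(2) by (auto intro!: LinfI[where C=C] elim!: eventually_mono intro: order_trans[OF b1]
        order_trans[OF b2])
  have "\<alpha> h \<le> \<alpha> (\<lambda>z. h1 z + h2 z)"
  proof (rule al_mono[OF h Linf_add[OF L]], use le in eventually_elim)
    case (elim z)
    show ?case
    proof (cases "D z = 0")
      case True
      then have "cmod (f z + g z) \<le> 0" using D(4)[of z] by simp
      then show ?thesis using elim by simp
    next
      case False
      have "h1 z + h2 z = complex_of_real (cmod (h z) * ((cmod (f z) + cmod (g z)) / D z))"
        by (simp add: h1_def h2_def add_divide_distrib algebra_simps)
      also have "(cmod (f z) + cmod (g z)) / D z = 1" using False by (simp add: D_def)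
      finally show ?thesis by simp
    qed
  qed
  also have "\<dots> \<le> \<alpha> h1 + \<alpha> h2" by (rule al_add[OF L])
  finally have "ennreal (\<alpha> h) \<le> ennreal (\<alpha> h1) + ennreal (\<alpha> h2)"
    using al_nonneg[OF L(1)] al_nonneg[OF L(2)] by (metis ennreal_leI ennreal_plus)
  also have "\<dots> \<le> ext f + ext g"
  proof (intro add_mono al_le_ext L)
    show "AE z in mT. cmod (h1 z) \<le> cmod (f z)" using le
    proof eventually_elim
      case (elim z)
      have "cmod (h1 z) \<le> D z * (cmod (f z) / D z)" unfolding n1 using r[of z] elim D(4)[of z]
          by (intro mult_right_mono) auto
      also have "\<dots> \<le> cmod (f z)" using D(1)[of z] by simp
      finally show ?case .
    qed
    show "AE z in mT. cmod (h2 z) \<le> cmod (g z)" using le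
    proof eventually_elim
      case (elim z)
      have "cmod (h2 z) \<le> D z * (cmod (g z) / D z)" unfolding n2 using r[of z] elim D(4)[of z]
          by (intro mult_right_mono) auto
      also have "\<dots> \<le> cmod (g z)" using D(1)[of z] by simp
      finally show ?case .
    qed
  qed
  finally show "ennreal (\<alpha> h) \<le> ext f + ext g" .
qed

lemma ext_mult:
  assumes b: "AE z in mT. cmod (b z) \<le> C" and C: "C > 0"
  shows "ext (\<lambda>z. b z * f z) \<le> ennreal C * ext f"
proof (rule ext_leI)
  fix h assume h: "h \<in> Linf" and le: "AE z in mT. cmod (h z) \<le> cmod (b z * f z)"
  let ?h = "\<lambda>z. complex_of_real (1 / C) * h z"
  have hL: "?h \<in> Linf" by (rule Linf_mult[OF Linf_const h])
  have "AE z in mT. cmod (?h z) \<le> cmod (f z)" using le b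
  proof eventually_elim
    case (elim z)
    have "cmod (h z) \<le> C * cmod (f z)"
      using elim mult_right_mono[OF elim(2), of "cmod (f z)"] by (simp add: norm_mult)
    then show ?case using C by (simp add: norm_mult norm_divide divide_le_eq mult.commute)
  qed
  then have le': "ennreal (\<alpha> ?h) \<le> ext f" by (rule al_le_ext[OF hL])
  have "\<alpha> h = C * \<alpha> ?h" using C al_cmult[OF h, of "complex_of_real (1 / C)"] by (simp add: norm_divide)
  then have "ennreal (\<alpha> h) = ennreal C * ennreal (\<alpha> ?h)" using C al_nonneg[OF hL] by (simp only: ennreal_mult)
  also have "\<dots> \<le> ennreal C * ext f" using le' by (rule mult_left_mono) simp
  finally show "ennreal (\<alpha> h) \<le> ennreal C * ext f" .
qed

text \<open>Chebyshev's inequality: \<open>g\<close> is at most \<open>t\<close> off a set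
  \<open>E\<close> of small measure and at most \<open>C\<close> on it, so its norm is at most
  \<open>t\<close> plus \<open>C\<close> times the norm of the indicator of \<open>E\<close>, which
  the continuity of the gauge makes small.\<close>

lemma al_small:
  assumes C: "C \<ge> 0" and e: "\<epsilon> > 0"
  shows "\<exists>\<eta>>0. \<forall>g\<in>Linf. (AE z in mT. cmod (g z) \<le> C) \<longrightarrow> integral\<^sup>L mT (\<lambda>z. cmod (g z)) < \<eta> \<longrightarrow> \<alpha> g < \<epsilon>"
proof -
  have "\<epsilon> / (2 * (C + 1)) > 0" using C e by simp
  with cont obtain d where d: "d > 0" "\<And>E. E \<in> sets mT \<Longrightarrow> measure mT E < d \<Longrightarrow> \<alpha> (\<lambda>z. complex_of_real
      (indicator E z)) < \<epsilon> / (2 * (C + 1))"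
    unfolding continuous_gauge_def by blast
  \<comment> \<open>The complement of \<open>E\<close> contributes at most \<epsilon> / 4 and
    \<open>E\<close> at most \<epsilon> / 2.\<close>
  define t where "t = \<epsilon> / 4"
  have t: "t > 0" using e by (simp add: t_def)
  have "\<alpha> g < \<epsilon>" if g: "g \<in> Linf" and gC: "AE z in mT. cmod (g z) \<le> C" and gi: "integral\<^sup>L mT (\<lambda>z. cmod (g
      z)) < t * d" for g
  proof -
    note [measurable] = LinfD[OF g]
    define E where "E = {z. cmod (g z) \<ge> t}"
    have E [measurable]: "E \<in> sets borel" unfolding E_def by measurable
    let ?i = "\<lambda>z. complex_of_real (indicator E z)"
    have iL: "?i \<in> Linf" by (rule LinfI[where C=1]) (auto simp: indicator_def)
    have mE: "measure mT E < d"
    proof -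
      have "t * measure mT E = integral\<^sup>L mT (\<lambda>z. t * indicator E z)" by simp
      also have "\<dots> \<le> integral\<^sup>L mT (\<lambda>z. cmod (g z))"
      proof (rule integral_mono)
        show "integrable mT (\<lambda>z. t * indicator E z)"
            by (intro integrable_mult_right integrable_real_indicator) (auto simp: mT.emeasure_eq_measure)
        show "integrable mT (\<lambda>z. cmod (g z))" using L2_integrable[OF Linf_L2[OF g]] by simp
      qed (auto simp: E_def indicator_def)
      finally have "t * measure mT E < t * d" using gi by linarith
      then show ?thesis using t by simp
    qed
    have "\<alpha> g \<le> \<alpha> (\<lambda>z. complex_of_real t + complex_of_real C * ?i z)"
    proof (rule al_mono[OF g], intro Linf_add Linf_const Linf_mult iL, use gC in eventually_elim)
      case (elim z)
      have "cmod (complex_of_real t + complex_of_real C * ?i z) = t + C * indicator E z"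
        using t C by (simp flip: of_real_mult of_real_add)
      then show ?case using elim t by (auto simp: E_def indicator_def)
    qed
    also have "\<dots> \<le> t + C * \<alpha> ?i"
      using al_add[OF Linf_const[of "complex_of_real t"] Linf_mult[OF Linf_const[of "complex_of_real C"] iL]]
        al_const[of "complex_of_real t"] al_cmult[OF iL, of "complex_of_real C"] t C by simp
    also have "\<dots> \<le> t + C * (\<epsilon> / (2 * (C + 1)))" using d(2)[of E] mE C
        by (intro add_left_mono mult_left_mono) auto
    also have "C * (\<epsilon> / (2 * (C + 1))) \<le> (C + 1) * (\<epsilon> / (2 * (C + 1)))" using C e
        by (intro mult_right_mono) auto
    also have "(C + 1) * (\<epsilon> / (2 * (C + 1))) = \<epsilon> / 2" using C by (simp add: field_simps)
    also have "t + \<epsilon> / 2 < \<epsilon>" using e by (simp add: t_def)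
    finally show ?thesis by simp
  qed
  moreover have "t * d > 0" using t d by simp
  ultimately show ?thesis by blast
qed

section \<open>Closures in the gauge norm\<close>

lemma aclosure_measurable: "f \<in> aclosure \<alpha> S \<Longrightarrow> f \<in> borel_measurable borel"
  by (simp add: aclosure_def)

lemma aclosureD: "f \<in> aclosure \<alpha> S \<Longrightarrow> e > 0 \<Longrightarrow> \<exists>g\<in>S. ext (\<lambda>z. f z - g z) < ennreal e"
  by (simp add: aclosure_def)

lemma aclosureI: "f \<in> borel_measurable borel \<Longrightarrow> (\<And>e. e > 0 \<Longrightarrow> \<exists>g\<in>S. ext (\<lambda>z. f z - g z) < ennreal e)
    \<Longrightarrow> f \<in> aclosure \<alpha> S"
  by (simp add: aclosure_def)

lemma aclosure_mono: "S \<subseteq> S' \<Longrightarrow> aclosure \<alpha> S \<subseteq> aclosure \<alpha> S'"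
  unfolding aclosure_def by blast

lemma aclosure_cong_AE:
  assumes "f \<in> aclosure \<alpha> S" "g \<in> borel_measurable borel" "AE z in mT. f z = g z"
  shows "g \<in> aclosure \<alpha> S"
proof (rule aclosureI[OF assms(2)])
  fix e :: real assume "e > 0"
  then obtain h where h: "h \<in> S" "ext (\<lambda>z. f z - h z) < ennreal e" using aclosureD[OF assms(1)] by blast
  have "ext (\<lambda>z. g z - h z) = ext (\<lambda>z. f z - h z)"
    by (rule ext_cong_cmod) (use assms(3) in \<open>auto elim: eventually_mono\<close>)
  then show "\<exists>h\<in>S. ext (\<lambda>z. g z - h z) < ennreal e" using h by (intro bexI[of _ h]) simp_all
qed

lemma aclosure_aclosure:
  assumes S: "S \<subseteq> borel_measurable borel"
  shows "aclosure \<alpha> (aclosure \<alpha> S) \<subseteq> aclosure \<alpha> S"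
proof
  fix f assume f: "f \<in> aclosure \<alpha> (aclosure \<alpha> S)"
  note [measurable] = aclosure_measurable[OF f]
  show "f \<in> aclosure \<alpha> S"
  proof (rule aclosureI)
    fix e :: real assume e: "e > 0"
    then obtain g where g: "g \<in> aclosure \<alpha> S" "ext (\<lambda>z. f z - g z) < ennreal (e/2)"
        using aclosureD[OF f, of "e/2"] by auto
    then obtain h where h: "h \<in> S" "ext (\<lambda>z. g z - h z) < ennreal (e/2)"
        using aclosureD[OF g(1), of "e/2"] e by auto
    have [measurable]: "h \<in> borel_measurable borel" "g \<in> borel_measurable borel"
        using h S aclosure_measurable[OF g(1)] by auto
    have "ext (\<lambda>z. (f z - g z) + (g z - h z)) \<le> ext (\<lambda>z. f z - g z) + ext (\<lambda>z. g z - h z)"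
      by (rule ext_add) measurable
    also have "\<dots> < ennreal (e/2) + ennreal (e/2)" by (rule add_strict_mono[OF g(2) h(2)])
    also have "\<dots> = ennreal e" using e by (subst ennreal_plus[symmetric]) auto
    finally show "\<exists>h\<in>S. ext (\<lambda>z. f z - h z) < ennreal e" using h by (intro bexI[of _ h]) simp_all
  qed measurable
qed

text \<open>Domination of the L1 norm is assumed for bounded functions only; Fatou's lemma along the
  truncations of \<open>f\<close> extends it.\<close>

lemma nn_L1_le_ext:
  assumes f: "f \<in> borel_measurable borel"
  shows "(\<integral>\<^sup>+z. ennreal (cmod (f z)) \<partial>mT) \<le> ext f"
proof -
  note [measurable] = f
  define g where "g k z = (if cmod (f z) \<le> real k then f z else 0)" for k z
  have gm [measurable]: "g k \<in> borel_measurable borel" for k unfolding g_def by measurable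
  have gL: "g k \<in> Linf" for k by (rule LinfI[where C="real k"]) (auto simp: g_def)
  have "(\<integral>\<^sup>+z. ennreal (cmod (f z)) \<partial>mT) = (\<integral>\<^sup>+z. liminf (\<lambda>k. ennreal (cmod (g k z))) \<partial>mT)"
  proof (rule nn_integral_cong)
    fix z
    obtain k0 where k0: "cmod (f z) \<le> real k0" using real_arch_simple by blast
    have "eventually (\<lambda>k. ennreal (cmod (g k z)) = ennreal (cmod (f z))) sequentially"
      using eventually_ge_at_top[of k0] by eventually_elim (use k0 in \<open>auto simp: g_def\<close>)
    then have "(\<lambda>k. ennreal (cmod (g k z))) \<longlonglongrightarrow> ennreal (cmod (f z))" by (rule tendsto_eventually)
    then show "ennreal (cmod (f z)) = liminf (\<lambda>k. ennreal (cmod (g k z)))"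
      by (rule lim_imp_Liminf[OF sequentially_bot, symmetric])
  qed
  also have "\<dots> \<le> liminf (\<lambda>k. \<integral>\<^sup>+z. ennreal (cmod (g k z)) \<partial>mT)" by (rule nn_integral_liminf) auto
  also have "\<dots> \<le> liminf (\<lambda>k::nat. ext f)"
  proof (intro Liminf_mono always_eventually allI)
    fix k
    have "(\<integral>\<^sup>+z. ennreal (cmod (g k z)) \<partial>mT) = ennreal (integral\<^sup>L mT (\<lambda>z. cmod (g k z)))"
      by (rule nn_integral_eq_integral) (use L2_integrable[OF Linf_L2[OF gL]] in auto)
    also have "\<dots> \<le> ennreal (\<alpha> (g k))" by (rule ennreal_leI[OF al_L1[OF gL]])
    also have "\<dots> \<le> ext f" by (rule al_le_ext[OF gL]) (auto simp: g_def)
    finally show "(\<integral>\<^sup>+z. ennreal (cmod (g k z)) \<partial>mT) \<le> ext f" .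
  qed
  finally show ?thesis by (simp add: Liminf_const)
qed

lemma L1_le_ext:
  assumes f: "f \<in> borel_measurable borel" and e: "ext f < ennreal e" "e > 0"
  shows "integrable mT f" "integral\<^sup>L mT (\<lambda>z. cmod (f z)) < e"
proof -
  note [measurable] = f
  have lt: "(\<integral>\<^sup>+z. ennreal (cmod (f z)) \<partial>mT) < ennreal e" using nn_L1_le_ext[OF f] e(1)
      by (rule le_less_trans)
  then have "(\<integral>\<^sup>+z. ennreal (cmod (f z)) \<partial>mT) < \<infinity>" using ennreal_less_top less_trans by fastforce
  then show i: "integrable mT f" by (intro integrableI_bounded) auto
  have "ennreal (integral\<^sup>L mT (\<lambda>z. cmod (f z))) < ennreal e"
    using lt by (subst (asm) nn_integral_eq_integral) (use i in auto)
  then show "integral\<^sup>L mT (\<lambda>z. cmod (f z)) < e" using e(2) by (simp add: ennreal_less_iff)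
qed

lemma aclosure_integrable:
  assumes f: "f \<in> aclosure \<alpha> S" and S: "\<And>g. g \<in> S \<Longrightarrow> integrable mT g"
  shows "integrable mT f"
proof -
  obtain g where g: "g \<in> S" "ext (\<lambda>z. f z - g z) < ennreal 1" using aclosureD[OF f, of 1] by auto
  note [measurable] = aclosure_measurable[OF f]
  have [measurable]: "g \<in> borel_measurable borel" using borel_measurable_integrable[OF S[OF g(1)]] by simp
  have "integrable mT (\<lambda>z. f z - g z)" by (rule L1_le_ext(1)[OF _ g(2)]) auto
  then have "integrable mT (\<lambda>z. (f z - g z) + g z)" using S[OF g(1)]
      by (rule Bochner_Integration.integrable_add)
  then show ?thesis by simp
qed

text \<open>The version of \<open>al_small\<close> with an unbounded factor \<open>f\<close>: a
  bounded \<open>g\<close> close to \<open>f\<close> reduces b g to \<open>al_small\<close>, while b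
  (f - g) is small by the bound on \<open>b\<close>. This is the reason for working in
  \<open>Lalpha\<close>.\<close>

lemma ext_small:
  assumes f: "f \<in> Lalpha \<alpha>" and C: "C \<ge> 0" and e: "\<epsilon> > 0"
  shows "\<exists>\<eta>>0. \<forall>b\<in>borel_measurable borel. (AE z in mT. cmod (b z) \<le> C) \<longrightarrow> integral\<^sup>L mT (\<lambda>z. cmod (b z)) < \<eta> \<longrightarrow>
    ext (\<lambda>z. b z * f z) < ennreal \<epsilon>"
proof -
  have f': "f \<in> aclosure \<alpha> Linf" using f by (simp add: Lalpha_def)
  note [measurable] = aclosure_measurable[OF f']
  have "\<epsilon> / (2 * (C + 1)) > 0" using C e by simp
  then obtain g where g: "g \<in> Linf" "ext (\<lambda>z. f z - g z) < ennreal (\<epsilon> / (2 * (C + 1)))"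
      using aclosureD[OF f'] by blast
  note [measurable] = LinfD[OF g(1)]
  obtain G where G: "G \<ge> 0" "AE z in mT. cmod (g z) \<le> G" using Linf_bound[OF g(1)] by auto
  have CG: "C * G \<ge> 0" and e2: "\<epsilon> / 2 > 0" using C G e by auto
  obtain \<eta> where eta: "\<eta> > 0" "\<And>h. h \<in> Linf \<Longrightarrow> AE z in mT. cmod (h z) \<le> C * G \<Longrightarrow> integral\<^sup>L mT (\<lambda>z. cmod (h
      z)) < \<eta> \<Longrightarrow> \<alpha> h < \<epsilon> / 2"
    using al_small[OF CG e2] by blast
  have "ext (\<lambda>z. b z * f z) < ennreal \<epsilon>"
    if [measurable]: "b \<in> borel_measurable borel" and b: "AE z in mT. cmod (b z) \<le> C"
        and bi: "integral\<^sup>L mT (\<lambda>z. cmod (b z)) < \<eta> / (G + 1)" for b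
  proof -
    have bL: "b \<in> Linf" using b by (intro LinfI) auto
    have bgL: "(\<lambda>z. b z * g z) \<in> Linf" using Linf_mult[OF bL g(1)] .
    have "\<alpha> (\<lambda>z. b z * g z) < \<epsilon> / 2"
    proof (rule eta(2)[OF bgL])
      show "AE z in mT. cmod (b z * g z) \<le> C * G" using b G(2)
        by eventually_elim (auto simp: norm_mult C intro!: mult_mono)
      have "integral\<^sup>L mT (\<lambda>z. cmod (b z * g z)) \<le> integral\<^sup>L mT (\<lambda>z. cmod (b z) * G)"
      proof (rule integral_mono_AE)
        show "integrable mT (\<lambda>z. cmod (b z * g z))" using L2_integrable[OF Linf_L2[OF bgL]] by simp
        show "integrable mT (\<lambda>z. cmod (b z) * G)" using L2_integrable[OF Linf_L2[OF bL]] by simp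
        show "AE z in mT. cmod (b z * g z) \<le> cmod (b z) * G" using G(2)
          by eventually_elim (auto simp: norm_mult intro!: mult_left_mono)
      qed
      also have "\<dots> = integral\<^sup>L mT (\<lambda>z. cmod (b z)) * G" by simp
      also have "\<dots> \<le> integral\<^sup>L mT (\<lambda>z. cmod (b z)) * (G + 1)"
          by (intro mult_left_mono Bochner_Integration.integral_nonneg) auto
      also have "\<dots> < \<eta>" using bi G by (simp add: less_divide_eq)
      finally show "integral\<^sup>L mT (\<lambda>z. cmod (b z * g z)) < \<eta>" .
    qed
    then have 1: "\<alpha> (\<lambda>z. b z * g z) + \<epsilon> / 2 < \<epsilon>" by simp
    have "AE z in mT. cmod (b z) \<le> C + 1" using b by eventually_elim simp
    then have "ext (\<lambda>z. b z * (f z - g z)) \<le> ennreal (C + 1) * ext (\<lambda>z. f z - g z)"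
        by (rule ext_mult) (use C in simp)
    also have "\<dots> \<le> ennreal (C + 1) * ennreal (\<epsilon> / (2 * (C + 1)))" using g(2) by (intro mult_left_mono) auto
    also have "\<dots> = ennreal ((C + 1) * (\<epsilon> / (2 * (C + 1))))" using C e by (intro ennreal_mult[symmetric]) auto
    also have "(C + 1) * (\<epsilon> / (2 * (C + 1))) = \<epsilon> / 2" using C by (simp add: field_simps)
    finally have 2: "ext (\<lambda>z. b z * (f z - g z)) \<le> ennreal (\<epsilon> / 2)" .
    have "(\<lambda>z. b z * f z) = (\<lambda>z. b z * g z + b z * (f z - g z))" by (simp add: algebra_simps)
    then have "ext (\<lambda>z. b z * f z) \<le> ext (\<lambda>z. b z * g z) + ext (\<lambda>z. b z * (f z - g z))"
      using ext_add[of "\<lambda>z. b z * g z" "\<lambda>z. b z * (f z - g z)"] by simp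
    also have "\<dots> \<le> ennreal (\<alpha> (\<lambda>z. b z * g z)) + ennreal (\<epsilon> / 2)" by (rule add_mono[OF ext_Linf[OF bgL] 2])
    also have "\<dots> = ennreal (\<alpha> (\<lambda>z. b z * g z) + \<epsilon> / 2)" using e al_nonneg[OF bgL]
        by (subst ennreal_plus[symmetric]) auto
    also have "\<dots> < ennreal \<epsilon>" using 1 e by (intro ennreal_lessI) auto
    finally show ?thesis .
  qed
  moreover have "\<eta> / (G + 1) > 0" using eta(1) G by simp
  ultimately show ?thesis by blast
qed

lemma Halpha_Lalpha: "Halpha \<alpha> \<subseteq> Lalpha \<alpha>"
  unfolding Halpha_def Lalpha_def by (rule aclosure_mono) (auto simp: Hinf_def)

lemma Lalpha_integrable: "f \<in> Lalpha \<alpha> \<Longrightarrow> integrable mT f"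
  unfolding Lalpha_def by (rule aclosure_integrable) (auto intro: L2_integrable Linf_L2)

text \<open>Since \<alpha> dominates the L1 norm, each moment is continuous for \<alpha> and
  vanishes on the closure of \<open>Hinf\<close>.\<close>

lemma Halpha_moment:
  assumes f: "f \<in> Halpha \<alpha>" and k: "k \<ge> 1"
  shows "integral\<^sup>L mT (\<lambda>z. f z * z ^ k) = 0"
proof -
  have fi: "integrable mT f" using f Halpha_Lalpha Lalpha_integrable by blast
  have zk: "circle_bounded (\<lambda>z. z ^ k)" by (auto simp: circle_bounded_def norm_power intro!: exI[of _ 1])
  have "cmod (integral\<^sup>L mT (\<lambda>z. f z * z ^ k)) \<le> 0 + e" if e: "e > 0" for e
  proof -
    obtain g where g: "g \<in> Hinf" "ext (\<lambda>z. f z - g z) < ennreal e"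
        using aclosureD[OF f[unfolded Halpha_def] e] by blast
    have gi: "integrable mT g" using g(1) by (auto simp: Hinf_def intro: L2_integrable Linf_L2)
    have [measurable]: "f \<in> borel_measurable borel" "g \<in> borel_measurable borel"
      using borel_measurable_integrable[OF fi] borel_measurable_integrable[OF gi] by auto
    have d: "integrable mT (\<lambda>z. f z - g z)" "integral\<^sup>L mT (\<lambda>z. cmod (f z - g z)) < e"
      using L1_le_ext[OF _ g(2) e] by auto
    have "integral\<^sup>L mT (\<lambda>z. g z * z ^ k) = 0" using g(1) k by (simp add: Hinf_def)
    then have "integral\<^sup>L mT (\<lambda>z. f z * z ^ k) = integral\<^sup>L mT (\<lambda>z. (f z - g z) * z ^ k)"
      using integrable_mult_circle_bounded[OF fi zk] integrable_mult_circle_bounded[OF gi zk]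
          by (simp add: left_diff_distrib)
    then have "cmod (integral\<^sup>L mT (\<lambda>z. f z * z ^ k)) \<le> integral\<^sup>L mT (\<lambda>z. cmod ((f z - g z) * z ^ k))"
      by (simp only: integral_norm_bound)
    also have "\<dots> = integral\<^sup>L mT (\<lambda>z. cmod (f z - g z))"
      by (rule integral_cong_AE) (auto intro!: AE_mT simp: norm_mult norm_power)
    finally show ?thesis using d(2) by simp
  qed
  then have "cmod (integral\<^sup>L mT (\<lambda>z. f z * z ^ k)) \<le> 0" by (rule field_le_epsilon)
  then show ?thesis by simp
qed

end

section \<open>Functions of the Blaschke product\<close>

text \<open>The difference between \<open>h\<close> and its projection to the closed span of the
  powers lies in \<open>H2\<close> and has no Fourier coefficients left.\<close>

lemma Hinf_cl2_powers:
  assumes h: "h \<in> Hinf" shows "h \<in> cl2 (cspan {\<lambda>z. z ^ k | k. True})"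
proof -
  let ?S = "cspan {\<lambda>z. z ^ k | k. True} :: (complex \<Rightarrow> complex) set"
  have zH: "(\<lambda>z. z ^ k) \<in> H2" for k
  proof (induction k)
    case (Suc k)
    then show ?case using H2_z(1) by simp
  qed (simp add: H2_const)
  have SH: "?S \<subseteq> H2" by (rule cspan_least[OF H2_subspace]) (auto intro: zH)
  then have SL: "?S \<subseteq> L2" using H2_L2 by blast
  have hH: "h \<in> H2" using h by (simp add: Hinf_iff)
  obtain p where p: "p \<in> cl2 ?S" "\<And>g. g \<in> ?S \<Longrightarrow> ip (\<lambda>z. h z - p z) g = 0"
    using L2_projection[OF cspan_subspace SL H2_L2[OF hH]] by blast
  have pH: "p \<in> H2" using p(1) cl2_mono[OF SH] cl2_H2 by blast
  have d: "(\<lambda>z. h z - p z) \<in> H2" by (rule linear_subspaceD(4)[OF H2_subspace hH pH])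
  have "AE z in mT. h z - p z = 0"
  proof (rule H2_AE_zero[OF d])
    fix k
    have "(\<lambda>z. z ^ k) \<in> ?S" by (rule cspan_base) auto
    from p(2)[OF this] show "integral\<^sup>L mT (\<lambda>z. (h z - p z) * cnj z ^ k) = 0" by (simp add: ip_def)
  qed
  then have "AE z in mT. p z = h z" by eventually_elim simp
  then show ?thesis using cl2_AE[OF p(1) H2_measurable[OF hH] _ SL] by simp
qed

context finite_blaschke
begin

text \<open>Invariance of the measure is what makes composition with \<open>u\<close> respect null
  sets and L2 norms.\<close>

lemma distr_u: "distr mT borel u = mT"
  by (rule measure_preserving_if_moments_zero) (auto simp: integral_u_pow)

lemma AE_compose_u:
  assumes "AE z in mT. P z" shows "AE z in mT. P (u z)"
proof -
  have "AE z in distr mT borel u. P z" unfolding distr_u by (rule assms)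
  then show ?thesis by (rule AE_distrD[rotated]) simp
qed

lemma n2_compose_u: "f \<in> borel_measurable borel \<Longrightarrow> n2 (\<lambda>z. f (u z)) = n2 f"
proof -
  assume [measurable]: "f \<in> borel_measurable borel"
  have "integral\<^sup>L (distr mT borel u) (\<lambda>z. (cmod (f z))\<^sup>2) = integral\<^sup>L mT (\<lambda>z. (cmod (f (u z)))\<^sup>2)"
    by (rule integral_distr) auto
  then show ?thesis by (simp add: n2_def distr_u)
qed

text \<open>Composition with \<open>u\<close> is isometric in L2 and sends polynomials to
  \<open>PA\<close>, so it carries polynomial approximations of \<open>h\<close> over to
  h(u).\<close>

lemma compose_u_PB:
  assumes h: "h \<in> Hinf" shows "(\<lambda>z. h (u z)) \<in> PB"
proof -
  have hL: "h \<in> Linf" using h by (simp add: Hinf_def)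
  note [measurable] = LinfD[OF hL]
  obtain C where "AE z in mT. cmod (h z) \<le> C" using Linf_bound[OF hL] by auto
  from AE_compose_u[OF this] have hu: "(\<lambda>z. h (u z)) \<in> Linf" by (intro LinfI) auto
  have PAc: "(\<lambda>z. g (u z)) \<in> PA \<and> g \<in> borel_measurable borel" if "g \<in> cspan {\<lambda>z. z ^ k | k. True}" for g
    using that
  proof induction
    case zero
    then show ?case using linear_subspaceD(1)[OF PA_subspace] by simp
  next
    case (add f g c)
    then obtain k where g: "g = (\<lambda>z. z ^ k)" by auto
    show ?case using add.IH linear_subspaceD(2)[OF PA_subspace _ linear_subspaceD(3)[OF PA_subspace
        u_pow_PA[of k], of c]]
      by (auto simp: g)
  qed
  have "(\<lambda>z. h (u z)) \<in> cl2 PA"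
  proof (rule cl2I[OF Linf_L2[OF hu]])
    fix e :: real assume "e > 0"
    then obtain g where g: "g \<in> cspan {\<lambda>z. z ^ k | k. True}" "n2 (\<lambda>z. h z - g z) < e"
      using cl2D[OF Hinf_cl2_powers[OF h]] by blast
    have [measurable]: "g \<in> borel_measurable borel" using PAc[OF g(1)] by simp
    have "n2 (\<lambda>z. h (u z) - g (u z)) < e" using n2_compose_u[of "\<lambda>z. h z - g z"] g(2) by simp
    then show "\<exists>g\<in>PA. n2 (\<lambda>z. h (u z) - g z) < e" using PAc[OF g(1)] by auto
  qed
  then show ?thesis using hu by (simp add: PB_def)
qed

lemma PA_eq_compose_u:
  assumes "p \<in> PA" shows "\<exists>h\<in>Hinf. \<forall>z. p z = h (u z)"
proof -
  have "\<exists>h\<in>Hinf. \<forall>z. p z = h (u z)" if "p \<in> cspan {\<lambda>z. u z ^ k | k. True}" for p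
    using that
  proof induction
    case zero
    have "(\<lambda>z. 0) \<in> Hinf" using Linf_const H2_const by (auto simp: Hinf_iff)
    then show ?case by auto
  next
    case (add f g c)
    then obtain k h where g: "g = (\<lambda>z. u z ^ k)" and h: "h \<in> Hinf" "\<And>z. f z = h (u z)" by auto
    have zk: "(\<lambda>z. z ^ k) \<in> H2"
    proof (induction k)
      case (Suc k)
      then show ?case using H2_z(1) by simp
    qed (simp add: H2_const)
    have zL: "(\<lambda>z. z ^ k) \<in> Linf" by (rule LinfI[where C=1]) (auto intro!: AE_mT simp: norm_power)
    have "(\<lambda>z. h z + c * z ^ k) \<in> Hinf"
      using h(1) zk zL linear_subspaceD(2)[OF H2_subspace _ linear_subspaceD(3)[OF H2_subspace zk, of c]]
        linear_subspaceD(2)[OF Linf_subspace _ linear_subspaceD(3)[OF Linf_subspace zL, of c]]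
      by (auto simp: Hinf_iff)
    then show ?case using h(2) by (intro bexI[of _ "\<lambda>z. h z + c * z ^ k"]) (auto simp: g)
  qed
  then show ?thesis using assms by (simp add: PA_def)
qed

end

section \<open>The invariant subspace\<close>

locale invariant_subspace = gauge \<alpha> + finite_blaschke a n
  for \<alpha> :: "(complex \<Rightarrow> complex) \<Rightarrow> real" and a n +
  fixes M :: "(complex \<Rightarrow> complex) set"
  assumes M_sub: "linear_subspace M" and M_H: "M \<subseteq> Halpha \<alpha>" and M_closed: "aclosure \<alpha> M = M"
    and M_inv: "\<And>f. f \<in> M \<Longrightarrow> (\<lambda>z. blaschke a z * f z) \<in> M"
begin

lemma M_Lalpha: "f \<in> M \<Longrightarrow> f \<in> Lalpha \<alpha>"
  using M_H Halpha_Lalpha by blast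

lemma M_integrable: "f \<in> M \<Longrightarrow> integrable mT f"
  using M_Lalpha Lalpha_integrable by blast

lemma M_measurable: "f \<in> M \<Longrightarrow> f \<in> borel_measurable borel"
  using borel_measurable_integrable[OF M_integrable] by simp

lemma M_AE: "f \<in> M \<Longrightarrow> g \<in> borel_measurable borel \<Longrightarrow> AE z in mT. f z = g z \<Longrightarrow> g \<in> M"
  using aclosure_cong_AE[of f M g] M_closed by simp

lemma M_limit:
  "f \<in> borel_measurable borel \<Longrightarrow> (\<And>e. e > 0 \<Longrightarrow> \<exists>g\<in>M. ext (\<lambda>z. f z - g z) < ennreal e) \<Longrightarrow> f \<in> M"
  using aclosureI[of f M] M_closed by simp

lemma M_u_pow: "f \<in> M \<Longrightarrow> (\<lambda>z. u z ^ k * f z) \<in> M"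
proof (induction k)
  case (Suc k)
  then have "(\<lambda>z. blaschke a z * (u z ^ k * f z)) \<in> M" by (intro M_inv) simp
  moreover have "AE z in mT. blaschke a z * (u z ^ k * f z) = u z ^ Suc k * f z"
    using u_AE_blaschke by eventually_elim simp
  moreover have "(\<lambda>z. u z ^ Suc k * f z) \<in> borel_measurable borel" using M_measurable[OF Suc.prems]
      by measurable
  ultimately show ?case using M_AE by blast
qed simp

lemma M_PA: assumes "p \<in> PA" "f \<in> M" shows "(\<lambda>z. p z * f z) \<in> M"
proof -
  have "(\<lambda>z. f z * p z) \<in> M"
    using assms(1) unfolding PA_def
    by (rule cspan_mult_image[OF _ M_sub]) (use M_u_pow[OF assms(2)] in \<open>auto simp: mult.commute\<close>)
  then show ?thesis by (simp add: mult.commute)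
qed

text \<open>Invariance under \<open>u\<close> gives multiplication by polynomials. Their passage to
  the limit \<open>q\<close> uses the common bound from \<open>PB_approx\<close>, as
  \<open>f\<close> itself may be unbounded.\<close>

lemma M_PB: assumes q: "q \<in> PB" and f: "f \<in> M" shows "(\<lambda>z. q z * f z) \<in> M"
proof -
  obtain C s where C: "C \<ge> 0" "AE z in mT. cmod (q z) \<le> C" and s: "\<And>N. s N \<in> PA" "\<And>N z. cmod (s N z) \<le> C"
    and lim: "(\<lambda>N. n2 (\<lambda>z. s N z - q z)) \<longlonglongrightarrow> 0" by (rule PB_approx[OF q], rule that)
  have qL: "q \<in> L2" using q by (auto simp: PB_def cl2_L2)
  have sL: "s N \<in> L2" for N using s PA_L2 by blast
  note [measurable] = M_measurable[OF f] L2_measurable[OF qL] L2_measurable[OF sL]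
  show ?thesis
  proof (rule M_limit)
    fix e :: real assume e: "e > 0"
    have C2: "2 * C \<ge> 0" using C by simp
    obtain \<eta> where eta: "\<eta> > 0" "\<And>b. b \<in> borel_measurable borel \<Longrightarrow> AE z in mT. cmod (b z) \<le> 2 * C \<Longrightarrow>
      integral\<^sup>L mT (\<lambda>z. cmod (b z)) < \<eta> \<Longrightarrow> ext (\<lambda>z. b z * f z) < ennreal e"
      using ext_small[OF M_Lalpha[OF f] C2 e] by blast
    have "eventually (\<lambda>N. n2 (\<lambda>z. s N z - q z) < \<eta>) sequentially" by (rule order_tendstoD(2)[OF lim eta(1)])
    then obtain N where N: "n2 (\<lambda>z. s N z - q z) < \<eta>" by (auto simp: eventually_sequentially)
    have "ext (\<lambda>z. (q z - s N z) * f z) < ennreal e"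
    proof (rule eta(2))
      show "AE z in mT. cmod (q z - s N z) \<le> 2 * C" using C(2)
      proof eventually_elim
        case (elim z)
        show ?case using norm_triangle_ineq4[of "q z" "s N z"] s(2)[of N z] elim by linarith
      qed
      have "integral\<^sup>L mT (\<lambda>z. cmod (q z - s N z)) \<le> n2 (\<lambda>z. q z - s N z)"
          by (rule L1_le_n2[OF L2_diff[OF qL sL]])
      then show "integral\<^sup>L mT (\<lambda>z. cmod (q z - s N z)) < \<eta>" using N n2_diff_commute[of q "s N"] by simp
    qed measurable
    then show "\<exists>g\<in>M. ext (\<lambda>z. q z * f z - g z) < ennreal e"
      using M_PA[OF s(1) f] by (intro bexI[of _ "\<lambda>z. s N z * f z"]) (simp_all add: left_diff_distrib)
  qed measurable
qed

section \<open>Bounded elements of M and their L2-closure\<close>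

definition Minf :: "(complex \<Rightarrow> complex) set" where
  "Minf = M \<inter> Linf"

lemma Minf_sub: "linear_subspace Minf"
  using M_sub Linf_subspace by (auto simp: Minf_def linear_subspace_def)

lemma Minf_H2: "Minf \<subseteq> H2"
  using M_H Halpha_moment Linf_L2 by (auto simp: Minf_def H2_def)

lemma Minf_L2: "Minf \<subseteq> L2"
  using Minf_H2 H2_L2 by blast

lemma Minf_u: "f \<in> Minf \<Longrightarrow> (\<lambda>z. u z * f z) \<in> Minf"
  using M_u_pow[of f 1] Linf_mult[OF u_pow_Linf[of 1]] by (auto simp: Minf_def)

text \<open>The multiplier is the square of \<open>q\<close>, since \<open>truncation\<close> with
  |f| as weight controls |q|^2 |f|. Both factors act inside \<open>M\<close> by
  \<open>M_PB\<close>.\<close>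

lemma Minf_dense:
  assumes f: "f \<in> M" and e: "\<epsilon> > 0"
  shows "\<exists>g\<in>Minf. ext (\<lambda>z. f z - g z) < ennreal \<epsilon>"
proof -
  note [measurable] = M_measurable[OF f]
  have F: "integrable mT (\<lambda>z. cmod (f z))" using M_integrable[OF f] by simp
  obtain C where C: "C \<ge> 0" and tr: "\<forall>\<delta>>0. \<exists>q\<in>PB. \<exists>D\<ge>0. n2 (\<lambda>z. q z - 1) < \<delta> \<and> (AE z in mT. cmod (q z) \<le> C)
      \<and> (AE z in mT. (cmod (q z))\<^sup>2 * cmod (f z) \<le> D)"
    using truncation[OF F] by auto
  \<comment> \<open>This bound on |1 - q^2| must be fixed before \<eta> is chosen, which is possible
    because \<open>C\<close> does not depend on \<delta>.\<close>
  have C2: "1 + C * C \<ge> 0" using C by simp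
  obtain \<eta> where eta: "\<eta> > 0" "\<And>b. b \<in> borel_measurable borel \<Longrightarrow> AE z in mT. cmod (b z) \<le> 1 + C * C \<Longrightarrow>
      integral\<^sup>L mT (\<lambda>z. cmod (b z)) < \<eta> \<Longrightarrow> ext (\<lambda>z. b z * f z) < ennreal \<epsilon>"
    using ext_small[OF M_Lalpha[OF f] C2 e] by blast
  have "\<eta> / (1 + C) > 0" using eta(1) C by simp
  then obtain q D where q: "q \<in> PB" "n2 (\<lambda>z. q z - 1) < \<eta> / (1 + C)" "AE z in mT. cmod (q z) \<le> C"
    "AE z in mT. (cmod (q z))\<^sup>2 * cmod (f z) \<le> D" using tr by blast
  have qL: "q \<in> L2" and qi: "q \<in> Linf" using q(1) by (auto simp: PB_def cl2_L2)
  note [measurable] = L2_measurable[OF qL]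
  let ?g = "\<lambda>z. q z * (q z * f z)"
  have "?g \<in> M" by (intro M_PB q f)
  moreover have "?g \<in> Linf"
    by (rule LinfI[where C=D]) (use q(4) in \<open>auto simp: norm_mult power2_eq_square mult.assoc\<close>)
  ultimately have gM: "?g \<in> Minf" by (simp add: Minf_def)
  have "ext (\<lambda>z. (1 - q z * q z) * f z) < ennreal \<epsilon>"
  proof (rule eta(2))
    show "AE z in mT. cmod (1 - q z * q z) \<le> 1 + C * C" using q(3)
    proof eventually_elim
      case (elim z)
      have "cmod (1 - q z * q z) \<le> cmod 1 + cmod (q z * q z)" by (rule norm_triangle_ineq4)
      also have "\<dots> \<le> 1 + C * C" using elim C by (auto simp: norm_mult intro!: mult_mono)
      finally show ?case .
    qed
    have "integral\<^sup>L mT (\<lambda>z. cmod (1 - q z * q z)) \<le> integral\<^sup>L mT (\<lambda>z. (1 + C) * cmod (q z - 1))"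
    proof (rule integral_mono_AE)
      show "integrable mT (\<lambda>z. cmod (1 - q z * q z))"
        using L2_integrable[OF L2_diff[OF L2_const[of 1] Linf_L2[OF Linf_mult[OF qi qi]]]] by simp
      show "integrable mT (\<lambda>z. (1 + C) * cmod (q z - 1))"
        using L2_integrable[OF L2_diff[OF qL L2_const[of 1]]] by simp
      show "AE z in mT. cmod (1 - q z * q z) \<le> (1 + C) * cmod (q z - 1)" using q(3)
      proof eventually_elim
        case (elim z)
        have "1 - q z * q z = (1 + q z) * - (q z - 1)" by (simp add: algebra_simps)
        then have "cmod (1 - q z * q z) = cmod (1 + q z) * cmod (q z - 1)"
            by (simp only: norm_mult norm_minus_cancel)
        also have "\<dots> \<le> (1 + C) * cmod (q z - 1)"
          using norm_triangle_ineq[of 1 "q z"] elim by (intro mult_right_mono) auto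
        finally show ?case .
      qed
    qed
    also have "\<dots> = (1 + C) * integral\<^sup>L mT (\<lambda>z. cmod (q z - 1))" by simp
    also have "\<dots> \<le> (1 + C) * n2 (\<lambda>z. q z - 1)"
      using C L1_le_n2[OF L2_diff[OF qL L2_const[of 1]]] by (intro mult_left_mono) auto
    also have "\<dots> < \<eta>" using q(2) C by (simp add: less_divide_eq mult.commute)
    finally show "integral\<^sup>L mT (\<lambda>z. cmod (1 - q z * q z)) < \<eta>" .
  qed measurable
  then show ?thesis using gM by (intro bexI[of _ ?g]) (simp_all add: algebra_simps)
qed

definition K :: "(complex \<Rightarrow> complex) set" where
  "K = cl2 Minf"

lemma K_sub: "linear_subspace K"
  unfolding K_def by (rule cl2_subspace[OF Minf_sub Minf_L2])

lemma K_L2: "K \<subseteq> L2"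
  unfolding K_def using cl2_L2 by blast

lemma cl2_K: "cl2 K = K"
  unfolding K_def by (rule cl2_cl2[OF Minf_L2])

lemma K_H2: "K \<subseteq> H2"
  unfolding K_def using cl2_mono[OF Minf_H2] cl2_H2 by blast

lemma K_u: "f \<in> K \<Longrightarrow> (\<lambda>z. u z * f z) \<in> K"
  unfolding K_def by (rule cl2_mult[OF _ Minf_L2, where C=1]) (auto intro: Minf_u)

lemma K_u_pow: "f \<in> K \<Longrightarrow> (\<lambda>z. u z ^ k * f z) \<in> K"
proof (induction k)
  case (Suc k)
  then show ?case using K_u[of "\<lambda>z. u z ^ k * f z"] by (simp add: mult.assoc)
qed simp

lemma K_AE: "f \<in> K \<Longrightarrow> g \<in> borel_measurable borel \<Longrightarrow> AE z in mT. f z = g z \<Longrightarrow> g \<in> K"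
  unfolding K_def using cl2_AE[OF _ _ _ Minf_L2] by blast

text \<open>Bounded functions \<open>f j\<close> in \<open>M\<close> may tend to \<open>J\<close> in \<open>L2\<close> without uniform bound; multiplying by \<open>q\<close> with
  \<open>|q|^2 * (\<Sum>j. |J - f j|^2)\<close> bounded restores one.\<close>

lemma K_Linf_M:
  assumes J: "J \<in> K" "J \<in> Linf" shows "J \<in> M"
proof -
  have JL: "J \<in> L2" using J K_L2 by blast
  \<comment> \<open>A geometric rate makes the squared errors summable, so that one integrable
    weight dominates all of them.\<close>
  have "\<exists>f\<in>Minf. n2 (\<lambda>z. J z - f z) < (1/2) ^ j" for j :: nat
    using cl2D[OF J(1)[unfolded K_def], of "(1/2) ^ j"] by simp
  then obtain f where f: "\<And>j. f j \<in> Minf" and fn: "\<And>j. n2 (\<lambda>z. J z - f j z) < (1/2) ^ j" by metis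
  have fL: "f j \<in> L2" for j using f Minf_L2 by blast
  have fi: "f j \<in> Linf" and fM: "f j \<in> M" for j using f by (auto simp: Minf_def)
  have dL: "(\<lambda>z. J z - f j z) \<in> L2" for j using L2_diff[OF JL fL] .
  note [measurable] = L2_measurable[OF JL] L2_measurable[OF fL]
  define G where "G z = (\<Sum>j. ennreal ((cmod (J z - f j z))\<^sup>2))" for z
  have [measurable]: "G \<in> borel_measurable borel" unfolding G_def by measurable
  have "(\<integral>\<^sup>+z. G z \<partial>mT) = (\<Sum>j. \<integral>\<^sup>+z. ennreal ((cmod (J z - f j z))\<^sup>2) \<partial>mT)"
    unfolding G_def by (rule nn_integral_suminf) auto
  also have "\<dots> \<le> (\<Sum>j. ennreal ((1/2) ^ j))"
  proof (rule suminf_le)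
    fix j
    have "(n2 (\<lambda>z. J z - f j z))\<^sup>2 \<le> ((1/2) ^ j)\<^sup>2" using fn[of j] by (intro power_mono) auto
    also have "\<dots> \<le> (1/2) ^ j" by (simp add: power2_eq_square mult_left_le power_le_one)
    finally show "(\<integral>\<^sup>+z. ennreal ((cmod (J z - f j z))\<^sup>2) \<partial>mT) \<le> ennreal ((1/2) ^ j)"
      using L2_sq_integrable[OF dL[of j]] by (subst nn_integral_eq_integral) (auto simp: n2_sq)
  qed auto
  also have "\<dots> = ennreal (\<Sum>j. (1/2) ^ j)" by (rule suminf_ennreal2) (auto intro: summable_geometric)
  finally have Gi: "(\<integral>\<^sup>+z. G z \<partial>mT) < \<infinity>" using ennreal_less_top le_less_trans by fastforce
  then have Gfin: "AE z in mT. G z \<noteq> \<infinity>" by (intro nn_integral_noteq_infinite) auto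
  \<comment> \<open>\<open>G\<close> may be infinite on a null set, where \<open>enn2real\<close>
    puts 0 instead.\<close>
  define F where "F z = enn2real (G z)" for z
  have [measurable]: "F \<in> borel_measurable borel" unfolding F_def by measurable
  have F0: "F z \<ge> 0" for z by (simp add: F_def)
  have "(\<integral>\<^sup>+z. ennreal (F z) \<partial>mT) \<le> (\<integral>\<^sup>+z. G z \<partial>mT)"
    by (rule nn_integral_mono) (simp add: F_def enn2real_le ennreal_enn2real_if)
  then have "(\<integral>\<^sup>+z. ennreal (F z) \<partial>mT) < \<infinity>" using Gi by (rule le_less_trans)
  then have Fi: "integrable mT F" by (intro integrableI_bounded) (auto simp: F0)
  have Fb: "AE z in mT. \<forall>j. (cmod (J z - f j z))\<^sup>2 \<le> F z" using Gfin
  proof eventually_elim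
    case (elim z)
    have "(\<Sum>j\<in>{j}. ennreal ((cmod (J z - f j z))\<^sup>2)) \<le> G z" for j
      unfolding G_def by (rule sum_le_suminf) simp_all
    moreover have "G z = ennreal (F z)" using elim by (simp add: F_def less_top)
    ultimately show ?case using F0[of z] by simp
  qed
  obtain C where C: "C \<ge> 0" and tr: "\<forall>\<delta>>0. \<exists>q\<in>PB. \<exists>D\<ge>0. n2 (\<lambda>z. q z - 1) < \<delta> \<and> (AE z in mT. cmod (q z) \<le> C)
      \<and> (AE z in mT. (cmod (q z))\<^sup>2 * F z \<le> D)"
    using truncation[OF Fi F0] by auto
  \<comment> \<open>Here \<open>q\<close> stays fixed while \<open>f j\<close> approaches
    \<open>J\<close>: q (J - f j) is bounded by \<open>sqrt D\<close> for every j and tends to 0 in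
    L2, hence in \<alpha>. It is harmless that \<open>D\<close> varies with
    \<open>q\<close>.\<close>
  have qJ: "(\<lambda>z. q z * J z) \<in> M" if q: "q \<in> PB" "AE z in mT. cmod (q z) \<le> C" and D: "D \<ge> 0" "AE z
      in mT. (cmod (q z))\<^sup>2 * F z \<le> D" for q D
  proof -
    have qi: "q \<in> Linf" using q by (simp add: PB_def)
    note [measurable] = LinfD[OF qi]
    show ?thesis
    proof (rule M_limit)
      fix e :: real assume e: "e > 0"
      obtain \<eta> where eta: "\<eta> > 0" "\<And>g. g \<in> Linf \<Longrightarrow> AE z in mT. cmod (g z) \<le> sqrt D \<Longrightarrow> integral\<^sup>L mT (\<lambda>z. cmod
          (g z)) < \<eta> \<Longrightarrow> \<alpha> g < e"
        using al_small[of "sqrt D" e] D(1) e by auto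
      have "\<eta> / (C + 1) > 0" using eta(1) C by simp
      then obtain j where j: "(1/2) ^ j < \<eta> / (C + 1)" using real_arch_pow_inv[of "\<eta> / (C + 1)" "1/2"] by auto
      let ?g = "\<lambda>z. q z * (J z - f j z)"
      have gm: "(\<lambda>z. q z * (J z + (-1) * f j z)) \<in> Linf"
        by (intro Linf_mult[OF qi] Linf_add J Linf_mult[OF Linf_const] fi)
      then have gL: "?g \<in> Linf" by simp
      have "\<alpha> ?g < e"
      proof (rule eta(2)[OF gL])
        show "AE z in mT. cmod (?g z) \<le> sqrt D" using Fb D(2)
        proof eventually_elim
          case (elim z)
          have "(cmod (?g z))\<^sup>2 = (cmod (q z))\<^sup>2 * (cmod (J z - f j z))\<^sup>2"
              by (simp add: norm_mult power_mult_distrib)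
          also have "\<dots> \<le> (cmod (q z))\<^sup>2 * F z" using elim by (intro mult_left_mono) auto
          also have "\<dots> \<le> D" using elim by simp
          finally show ?case by (rule real_le_rsqrt)
        qed
        have "integral\<^sup>L mT (\<lambda>z. cmod (?g z)) \<le> n2 ?g" by (rule L1_le_n2[OF Linf_L2[OF gL]])
        also have "\<dots> \<le> C * n2 (\<lambda>z. J z - f j z)" by (rule n2_mult_bounded[OF dL _ q(2) C]) measurable
        also have "\<dots> \<le> C * (1/2) ^ j" using fn[of j] C by (intro mult_left_mono) auto
        also have "\<dots> \<le> (C + 1) * (1/2) ^ j" by (intro mult_right_mono) auto
        also have "\<dots> < \<eta>" using j C by (simp add: less_divide_eq mult.commute)
        finally show "integral\<^sup>L mT (\<lambda>z. cmod (?g z)) < \<eta>" .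
      qed
      then have "ext ?g < ennreal e" using ext_Linf[OF gL] e by (meson ennreal_lessI le_less_trans)
      then show "\<exists>g\<in>M. ext (\<lambda>z. q z * J z - g z) < ennreal e"
        using M_PB[OF q(1) fM[of j]]
            by (intro bexI[of _ "\<lambda>z. q z * f j z"]) (simp_all add: right_diff_distrib)
    qed measurable
  qed
  \<comment> \<open>Next \<open>q\<close> approaches 1, now under the bound (1 + C) CJ, which is the
    same for all \<open>q\<close>.\<close>
  obtain CJ where CJ: "CJ \<ge> 0" "AE z in mT. cmod (J z) \<le> CJ" using Linf_bound[OF J(2)] by auto
  show ?thesis
  proof (rule M_limit)
    fix e :: real assume e: "e > 0"
    have B0: "(1 + C) * CJ \<ge> 0" using C CJ by simp
    obtain \<eta> where eta: "\<eta> > 0" "\<And>g. g \<in> Linf \<Longrightarrow> AE z in mT. cmod (g z) \<le> (1 + C) * CJ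
        \<Longrightarrow> integral\<^sup>L mT (\<lambda>z. cmod (g z)) < \<eta> \<Longrightarrow> \<alpha> g < e"
      using al_small[OF B0 e] by auto
    have "\<eta> / (CJ + 1) > 0" using eta(1) CJ by simp
    then obtain q D where q: "q \<in> PB" "n2 (\<lambda>z. q z - 1) < \<eta> / (CJ + 1)" "AE z in mT. cmod (q z) \<le> C"
      "D \<ge> 0" "AE z in mT. (cmod (q z))\<^sup>2 * F z \<le> D" using tr by blast
    have qi: "q \<in> Linf" using q by (simp add: PB_def)
    note [measurable] = LinfD[OF qi]
    have q1: "(\<lambda>z. q z - 1) \<in> L2" using L2_diff[OF Linf_L2[OF qi] L2_const] .
    let ?g = "\<lambda>z. J z * (q z - 1)"
    have gm: "(\<lambda>z. J z * (q z + (-1))) \<in> Linf"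
      by (intro Linf_mult[OF J(2)] Linf_add qi Linf_const)
    then have gL: "?g \<in> Linf" by simp
    have "\<alpha> ?g < e"
    proof (rule eta(2)[OF gL])
      show "AE z in mT. cmod (?g z) \<le> (1 + C) * CJ" using q(3) CJ(2)
      proof eventually_elim
        case (elim z)
        have "cmod (q z - 1) \<le> 1 + C" using norm_triangle_ineq4[of "q z" 1] elim by simp
        then have "cmod (q z - 1) * cmod (J z) \<le> (1 + C) * CJ" using elim C by (intro mult_mono) auto
        then show ?case by (simp add: norm_mult mult.commute)
      qed
      have "integral\<^sup>L mT (\<lambda>z. cmod (?g z)) \<le> n2 ?g" by (rule L1_le_n2[OF Linf_L2[OF gL]])
      also have "\<dots> \<le> CJ * n2 (\<lambda>z. q z - 1)" by (rule n2_mult_bounded[OF q1 _ CJ(2) CJ(1)]) measurable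
      also have "\<dots> \<le> (CJ + 1) * n2 (\<lambda>z. q z - 1)" by (intro mult_right_mono) auto
      also have "\<dots> < \<eta>" using q(2) CJ by (simp add: less_divide_eq mult.commute)
      finally show "integral\<^sup>L mT (\<lambda>z. cmod (?g z)) < \<eta>" .
    qed
    then have "ext ?g < ennreal e" using ext_Linf[OF gL] e by (meson ennreal_lessI le_less_trans)
    moreover have "ext (\<lambda>z. J z - q z * J z) = ext ?g"
    proof (intro ext_cong_cmod AE_I2)
      fix z
      have "J z - q z * J z = - (J z * (q z - 1))" by (simp add: algebra_simps)
      then show "cmod (J z - q z * J z) = cmod (J z * (q z - 1))" by (simp only: norm_minus_cancel)
    qed
    ultimately show "\<exists>g\<in>M. ext (\<lambda>z. J z - g z) < ennreal e"
      using qJ[OF q(1,3,4,5)] by (intro bexI[of _ "\<lambda>z. q z * J z"]) simp_all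
  qed measurable
qed

end

section \<open>The wandering subspace\<close>

context invariant_subspace
begin

definition W :: "(complex \<Rightarrow> complex) set" where
  "W = {w \<in> K. \<forall>g\<in>K. ip w (\<lambda>z. u z * g z) = 0}"

lemma W_K: "w \<in> W \<Longrightarrow> w \<in> K"
  by (simp add: W_def)

lemma W_L2: "w \<in> W \<Longrightarrow> w \<in> L2"
  using W_K K_L2 by blast

lemma W_cmult: "w \<in> W \<Longrightarrow> (\<lambda>z. c * w z) \<in> W"
  using linear_subspaceD(3)[OF K_sub] by (auto simp: W_def ip_cmult_left)

lemma W_orthogonal:
  assumes w: "w \<in> W" and g: "g \<in> K" and k: "k \<ge> 1"
  shows "ip w (\<lambda>z. u z ^ k * g z) = 0" "ip (\<lambda>z. u z ^ k * g z) w = 0"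
proof -
  obtain j where j: "k = Suc j" using k by (cases k) auto
  have "ip w (\<lambda>z. u z * (u z ^ j * g z)) = 0" using w K_u_pow[OF g, of j] by (simp add: W_def)
  then show "ip w (\<lambda>z. u z ^ k * g z) = 0" by (simp add: j mult.assoc)
  then show "ip (\<lambda>z. u z ^ k * g z) w = 0" using ip_cnj[of "\<lambda>z. u z ^ k * g z" w] by simp
qed

lemma W_Linf: assumes w: "w \<in> W" shows "w \<in> Linf"
proof -
  have "integral\<^sup>L mT (\<lambda>z. complex_of_real ((cmod (w z))\<^sup>2) * u z ^ k) = 0" if "k \<ge> 1" for k
    using W_orthogonal(2)[OF w W_K[OF w] that] unfolding complex_norm_square by (simp add: ip_def mult_ac)
  moreover obtain C where "\<forall>\<phi>\<in>L2. (\<forall>k\<ge>1. integral\<^sup>L mT (\<lambda>z. complex_of_real ((cmod (\<phi> z))\<^sup>2) * u z ^ k) = 0) \<longrightarrow>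
     (AE z in mT. cmod (\<phi> z) \<le> C * n2 \<phi>)"
    using flat_bounded by (elim exE conjE)
  ultimately have "AE z in mT. cmod (w z) \<le> C * n2 w" using W_L2[OF w] by blast
  then show ?thesis using L2_measurable[OF W_L2[OF w]] by (intro LinfI)
qed

section \<open>Orthonormal families of wandering functions\<close>

definition wfam :: "nat \<Rightarrow> (nat \<Rightarrow> complex \<Rightarrow> complex) \<Rightarrow> bool" where
  "wfam r J \<longleftrightarrow> (\<forall>i<r. J i \<in> W) \<and> (\<forall>i<r. \<forall>j<r. ip (J i) (J j) = (if i = j then 1 else 0))"

text \<open>A surplus power of \<open>u\<close> can be moved to one side of the pairing, where it
  lands in u K and is orthogonal to the other side.\<close>

lemma wfam_system:
  assumes J: "wfam r J" shows "unitary_system u r J"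
  unfolding unitary_system_def
proof (intro conjI allI impI)
  show "J i \<in> Linf" if "i < r" for i using J that W_Linf by (auto simp: wfam_def)
  fix i j p q assume ij: "i < r" "j < r"
  then have W: "J i \<in> W" "J j \<in> W" using J by (auto simp: wfam_def)
  let ?f = "\<lambda>z. J i z * cnj (J j z) * (u z ^ p * cnj (u z) ^ q)"
  consider "q < p" | "p = q" | "p < q" by linarith
  then show "integral\<^sup>L mT ?f = (if i = j \<and> p = q then 1 else 0)"
  proof cases
    case 1
    then have "?f = (\<lambda>z. u z ^ (p - q) * J i z * cnj (J j z))" by (simp add: u_power_cases mult_ac)
    then show ?thesis using W_orthogonal(2)[OF W(2) W_K[OF W(1)], of "p - q"] 1 by (simp add: ip_def)
  next
    case 2
    then have "?f = (\<lambda>z. J i z * cnj (J j z))" by (simp add: u_power_cases)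
    then show ?thesis using J ij 2 by (simp add: wfam_def ip_def)
  next
    case 3
    then have "?f = (\<lambda>z. J i z * cnj (u z ^ (q - p) * J j z))" by (simp add: u_power_cases mult_ac)
    then show ?thesis using W_orthogonal(1)[OF W(1) W_K[OF W(2)], of "q - p"] 3 by (simp add: ip_def)
  qed
qed

text \<open>Family sizes are bounded by \<open>n\<close>, so a largest family exists. A nonzero
  wandering function orthogonal to it could be normalised and appended.\<close>

lemma wandering_basis_exists:
  "\<exists>r J. wfam r J \<and> (\<forall>w\<in>W. (\<forall>i<r. ip w (J i) = 0) \<longrightarrow> (AE z in mT. w z = 0))"
proof -
  define R where "R = {r. \<exists>J. wfam r J}"
  have "R \<subseteq> {..n}" using unitary_system_size[OF wfam_system] by (auto simp: R_def)
  then have fin: "finite R" by (rule finite_subset) simp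
  have "0 \<in> R" by (auto simp: R_def wfam_def)
  then have "Max R \<in> R" using Max_in[OF fin] by blast
  then obtain J where J: "wfam (Max R) J" by (auto simp: R_def)
  define r where "r = Max R"
  have "AE z in mT. w z = 0" if w: "w \<in> W" and o: "\<And>i. i < r \<Longrightarrow> ip w (J i) = 0" for w
  proof (rule ccontr)
    assume "\<not> (AE z in mT. w z = 0)"
    then have n0: "n2 w \<noteq> 0" using n2_zero_AE[OF W_L2[OF w]] by blast
    define v where "v z = complex_of_real (1 / n2 w) * w z" for z
    have vW: "v \<in> W" unfolding v_def by (rule W_cmult[OF w])
    have vv: "ip v v = 1"
    proof -
      have "n2 v = 1" unfolding v_def n2_cmult using n0 by (simp add: norm_divide)
      then show ?thesis using n2_sq_ip[of v] by simp
    qed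
    have vJ: "ip v (J i) = 0" "ip (J i) v = 0" if "i < r" for i
    proof -
      show "ip v (J i) = 0" unfolding v_def ip_cmult_left using o[OF that] by simp
      then show "ip (J i) v = 0" using ip_cnj[of "J i" v] by simp
    qed
    have "wfam (Suc r) (J(r := v))"
      unfolding wfam_def using J vW vv vJ by (auto simp: wfam_def r_def less_Suc_eq)
    then have "Suc r \<in> R" by (auto simp: R_def)
    then have "Suc r \<le> Max R" using fin by simp
    then show False by (simp add: r_def)
  qed
  then show ?thesis using J[folded r_def] by blast
qed

context
  fixes r J
  assumes J: "wfam r J"
    and J_max: "\<And>w. w \<in> W \<Longrightarrow> (\<And>i. i < r \<Longrightarrow> ip w (J i) = 0) \<Longrightarrow> AE z in mT. w z = 0"
begin

lemma J_W: "i < r \<Longrightarrow> J i \<in> W"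
  using J by (simp add: wfam_def)

text \<open>Only nonnegative powers of \<open>u\<close> occur, so that \<open>SA\<close> stays
  inside \<open>K\<close>.\<close>

definition SA :: "(complex \<Rightarrow> complex) set" where
  "SA = cspan {\<lambda>z. u z ^ k * J i z | i k. i < r}"

lemma SA_K: "SA \<subseteq> K"
  unfolding SA_def by (rule cspan_least[OF K_sub]) (auto intro: K_u_pow[OF W_K[OF J_W]])

lemma SA_system_span: "SA \<subseteq> system_span r J"
  unfolding SA_def
proof (rule cspan_least)
  show "linear_subspace (system_span r J)" unfolding system_span_def by (rule cspan_subspace)
  show "{\<lambda>z. u z ^ k * J i z | i k. i < r} \<subseteq> system_span r J"
  proof safe
    fix i k assume "i < r"
    then have "(\<lambda>z. J i z * (u z ^ k * cnj (u z) ^ 0)) \<in> system_span r J"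
      unfolding system_span_def by (intro cspan_base) blast
    then show "(\<lambda>z. u z ^ k * J i z) \<in> system_span r J" by (simp add: mult.commute)
  qed
qed

lemma SA_base: "i < r \<Longrightarrow> (\<lambda>z. u z ^ k * J i z) \<in> SA"
  unfolding SA_def by (rule cspan_base) auto

text \<open>The remainder of \<open>h\<close> after projection to u K is wandering and orthogonal to
  every \<open>J i\<close>, hence zero: \<open>h\<close> is itself u times an element of
  \<open>K\<close>. The second conclusion allows the division to be repeated.\<close>

lemma div_u_K:
  assumes h: "h \<in> K" and o: "\<And>i k. i < r \<Longrightarrow> ip h (\<lambda>z. u z ^ k * J i z) = 0"
  shows "(\<lambda>z. cnj (u z) * h z) \<in> K" "\<And>i k. i < r \<Longrightarrow> ip (\<lambda>z. cnj (u z) * h z) (\<lambda>z. u z ^ k * J i z) = 0"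
proof -
  define UK where "UK = (\<lambda>g z. u z * g z) ` K"
  have UKK: "UK \<subseteq> K" unfolding UK_def using K_u by blast
  then have UKL: "UK \<subseteq> L2" using K_L2 by blast
  have UKs: "linear_subspace UK"
    unfolding linear_subspace_def
  proof (intro conjI ballI allI)
    show "(\<lambda>z. 0) \<in> UK" unfolding UK_def using linear_subspaceD(1)[OF K_sub]
        by (auto intro!: image_eqI[of _ _ "\<lambda>z. 0"])
    fix f assume "f \<in> UK"
    then obtain p where p: "p \<in> K" "f = (\<lambda>z. u z * p z)" by (auto simp: UK_def)
    show "(\<lambda>z. c * f z) \<in> UK" for c
      unfolding UK_def using linear_subspaceD(3)[OF K_sub p(1), of c]
      by (intro image_eqI[of _ _ "\<lambda>z. c * p z"]) (auto simp: p mult_ac)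
    fix g assume "g \<in> UK"
    then obtain p' where p': "p' \<in> K" "g = (\<lambda>z. u z * p' z)" by (auto simp: UK_def)
    show "(\<lambda>z. f z + g z) \<in> UK"
      unfolding UK_def using linear_subspaceD(2)[OF K_sub p(1) p'(1)]
      by (intro image_eqI[of _ _ "\<lambda>z. p z + p' z"]) (auto simp: p p' algebra_simps)
  qed
  have hL: "h \<in> L2" using h K_L2 by blast
  obtain s where s: "s \<in> cl2 UK" "\<And>g. g \<in> UK \<Longrightarrow> ip (\<lambda>z. h z - s z) g = 0"
    using L2_projection[OF UKs UKL hL] by blast
  have sK: "s \<in> K" using s(1) cl2_mono[OF UKK] cl2_K by blast
  have sL: "s \<in> L2" using sK K_L2 by blast
  note [measurable] = L2_measurable[OF hL] L2_measurable[OF sL]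
  \<comment> \<open>Multiplication by \<open>cnj u\<close> undoes that by \<open>u\<close>
    continuously, so a limit of elements of u K is u times an element of \<open>K\<close>.\<close>
  have us: "(\<lambda>z. cnj (u z) * s z) \<in> K"
  proof -
    have "(\<lambda>z. cnj (u z) * s z) \<in> cl2 K"
    proof (rule cl2_mult[OF s(1) UKL, where C=1])
      fix g assume "g \<in> UK"
      then obtain p where p: "p \<in> K" "g = (\<lambda>z. u z * p z)" by (auto simp: UK_def)
      have "(\<lambda>z. cnj (u z) * g z) = p" by (simp add: p mult.assoc[symmetric] u_mult_cnj)
      then show "(\<lambda>z. cnj (u z) * g z) \<in> K" using p by simp
    qed auto
    then show ?thesis by (simp add: cl2_K)
  qed
  let ?w = "\<lambda>z. h z - s z"
  have w: "?w \<in> W"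
    unfolding W_def using linear_subspaceD(4)[OF K_sub h sK] s(2) by (auto simp: UK_def)
  have "AE z in mT. ?w z = 0"
  proof (rule J_max[OF w])
    fix i assume i: "i < r"
    have JL: "J i \<in> L2" using J_W[OF i] W_L2 by blast
    have "ip s (J i) = 0"
    proof (rule cl2_ip_zero[OF s(1) UKL JL])
      fix g assume "g \<in> UK"
      then obtain p where p: "p \<in> K" "g = (\<lambda>z. u z * p z)" by (auto simp: UK_def)
      show "ip g (J i) = 0" using W_orthogonal(2)[OF J_W[OF i] p(1), of 1] by (simp add: p)
    qed
    moreover have "ip h (J i) = 0" using o[OF i, of 0] by simp
    ultimately show "ip ?w (J i) = 0" by (simp add: ip_diff_left hL sL JL)
  qed
  then have "AE z in mT. cnj (u z) * s z = cnj (u z) * h z" by eventually_elim simp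
  then show "(\<lambda>z. cnj (u z) * h z) \<in> K" by (intro K_AE[OF us]) auto
  show "ip (\<lambda>z. cnj (u z) * h z) (\<lambda>z. u z ^ k * J i z) = 0" if "i < r" for i k
    using o[OF that, of "Suc k"] by (simp add: ip_def mult_ac)
qed

text \<open>The part of \<open>f\<close> orthogonal to \<open>SA\<close> can be divided by
  \<open>u\<close> indefinitely inside \<open>K\<close>. As \<open>K\<close> lies in
  \<open>H2\<close>, there is no nonzero function of this kind.\<close>

lemma Wold:
  assumes f: "f \<in> K" shows "f \<in> cl2 (system_span r J)"
proof -
  have SL: "SA \<subseteq> L2" using SA_K K_L2 by blast
  have fL: "f \<in> L2" using f K_L2 by blast
  obtain p where p: "p \<in> cl2 SA" "\<And>g. g \<in> SA \<Longrightarrow> ip (\<lambda>z. f z - p z) g = 0"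
    using L2_projection[OF _ SL fL] cspan_subspace unfolding SA_def by blast
  have pK: "p \<in> K" using p(1) cl2_mono[OF SA_K] cl2_K by blast
  let ?g = "\<lambda>z. f z - p z"
  have gK: "?g \<in> K" by (rule linear_subspaceD(4)[OF K_sub f pK])
  have "(\<lambda>z. cnj (u z) ^ k * ?g z) \<in> K \<and> (\<forall>i j. i < r \<longrightarrow> ip (\<lambda>z. cnj (u z) ^ k * ?g z) (\<lambda>z. u z ^ j * J i z)
      = 0)" for k
  proof (induction k)
    case 0
    then show ?case using gK p(2)[OF SA_base] by simp
  next
    case (Suc k)
    then show ?case using div_u_K[of "\<lambda>z. cnj (u z) ^ k * ?g z"] by (simp add: mult.assoc)
  qed
  then have "AE z in mT. ?g z = 0" using gK K_H2 by (intro H2_divisible_zero) blast+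
  then have "AE z in mT. p z = f z" by eventually_elim simp
  then have "f \<in> cl2 SA" using cl2_AE[OF p(1) L2_measurable[OF fL] _ SL] by simp
  then show ?thesis using cl2_mono[OF SA_system_span] by blast
qed

text \<open>\<open>M_alpha\<close> is built from the product itself and \<open>PA\<close> from its
  unimodular version \<open>u\<close>; the two compositions differ on a null set, so a single
  approximant has distance 0.\<close>

lemma PA_M_alpha: assumes p: "p \<in> PA" shows "p \<in> M_alpha \<alpha> (blaschke a)"
proof -
  obtain h where h: "h \<in> Hinf" "\<And>z. p z = h (u z)" using PA_eq_compose_u[OF p] by blast
  have hm [measurable]: "h \<in> borel_measurable borel" using h(1) by (simp add: Hinf_def Linf_def)
  have "(\<lambda>z. h (blaschke a z)) \<in> Hinf_B (blaschke a)" using h(1) by (auto simp: Hinf_B_def)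
  moreover have "ext (\<lambda>z. p z - h (blaschke a z)) = 0"
    by (rule ext_AE_zero) (use u_AE_blaschke in eventually_elim, simp add: h)
  moreover have "p \<in> borel_measurable borel" using p PA_Linf LinfD by blast
  ultimately show ?thesis unfolding M_alpha_def by (intro aclosureI) (auto intro!: bexI)
qed

lemma Hinf_B_PB:
  assumes "g \<in> Hinf_B (blaschke a)"
  obtains q where "q \<in> PB" "AE z in mT. g z = q z" "g \<in> borel_measurable borel"
proof -
  obtain h where h: "h \<in> Hinf" "g = (\<lambda>z. h (blaschke a z))" using assms by (auto simp: Hinf_B_def)
  have [measurable]: "h \<in> borel_measurable borel" using h(1) by (simp add: Hinf_def Linf_def)
  have "AE z in mT. g z = h (u z)" using u_AE_blaschke by eventually_elim (simp add: h)
  moreover have "g \<in> borel_measurable borel" unfolding h by measurable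
  ultimately show ?thesis using that[OF compose_u_PB[OF h(1)]] by blast
qed

text \<open>Multiplication by a bounded \<open>f\<close> is continuous for \<open>ext\<close>, which
  reduces the claim to g = h(B) and so to \<open>M_PB\<close>.\<close>

lemma M_alpha_mult_M:
  assumes f: "f \<in> M" "f \<in> Linf" and g: "g \<in> M_alpha \<alpha> (blaschke a)"
  shows "(\<lambda>z. f z * g z) \<in> M"
proof (rule M_limit)
  have g': "g \<in> aclosure \<alpha> (Hinf_B (blaschke a))" using g by (simp add: M_alpha_def)
  note [measurable] = LinfD[OF f(2)] aclosure_measurable[OF g']
  show "(\<lambda>z. f z * g z) \<in> borel_measurable borel" by measurable
  fix \<epsilon> :: real assume e: "\<epsilon> > 0"
  obtain C where C: "C \<ge> 0" "AE z in mT. cmod (f z) \<le> C" using Linf_bound[OF f(2)] by auto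
  have Cb: "AE z in mT. cmod (f z) \<le> C + 1" using C(2) by eventually_elim simp
  have "\<epsilon> / (C + 1) > 0" using C e by simp
  then obtain h where h: "h \<in> Hinf_B (blaschke a)" "ext (\<lambda>z. g z - h z) < ennreal (\<epsilon> / (C + 1))"
    using aclosureD[OF g'] by blast
  obtain q where q: "q \<in> PB" "AE z in mT. h z = q z" "h \<in> borel_measurable borel" using Hinf_B_PB[OF h(1)] .
  note [measurable] = q(3)
  have "AE z in mT. q z * f z = f z * h z" using q(2) by eventually_elim simp
  then have fh: "(\<lambda>z. f z * h z) \<in> M" by (intro M_AE[OF M_PB[OF q(1) f(1)]]) auto
  have "ext (\<lambda>z. f z * (g z - h z)) \<le> ennreal (C + 1) * ext (\<lambda>z. g z - h z)"
    by (rule ext_mult[OF Cb]) (use C in simp)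
  also have "\<dots> < ennreal (C + 1) * ennreal (\<epsilon> / (C + 1))"
    using h(2) C by (intro ennreal_mult_strict_left_mono) (auto simp del: ennreal_plus)
  also have "\<dots> = ennreal ((C + 1) * (\<epsilon> / (C + 1)))" using C e by (intro ennreal_mult[symmetric]) auto
  also have "(C + 1) * (\<epsilon> / (C + 1)) = \<epsilon>" using C by simp
  finally show "\<exists>h\<in>M. ext (\<lambda>z. f z * g z - h z) < ennreal \<epsilon>"
    using fh by (intro bexI[of _ "\<lambda>z. f z * h z"]) (simp_all add: right_diff_distrib)
qed

lemma sum_space_M: "sum_space \<alpha> (blaschke a) r J \<subseteq> M"
proof
  fix f assume "f \<in> sum_space \<alpha> (blaschke a) r J"
  then obtain g where g: "f = (\<lambda>z. \<Sum>i<r. J i z * g i z)" "\<And>i. i < r \<Longrightarrow> g i \<in> M_alpha \<alpha> (blaschke a)"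
    by (auto simp: sum_space_def)
  have "(\<lambda>z. J i z * g i z) \<in> M" if "i < r" for i
    by (rule M_alpha_mult_M) (use that g(2) W_Linf[OF J_W] K_Linf_M[OF W_K[OF J_W]] in auto)
  then show "f \<in> M" unfolding g(1) by (intro linear_subspace_sum[OF M_sub]) auto
qed

text \<open>For bounded \<open>f\<close> the Fejer sums of its Wold expansion are bounded uniformly
  in \<open>N\<close>, so their L2 convergence is also convergence in \<alpha>.\<close>

lemma Minf_sum_space:
  assumes f: "f \<in> Minf" and e: "\<epsilon> > 0"
  shows "\<exists>g\<in>sum_space \<alpha> (blaschke a) r J. ext (\<lambda>z. f z - g z) < ennreal \<epsilon>"
proof -
  note sys = wfam_system[OF J]
  have fi: "f \<in> Linf" using f by (simp add: Minf_def)
  have fK: "f \<in> K" unfolding K_def using f subset_cl2[OF Minf_L2] by blast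
  have fL: "f \<in> L2" using Linf_L2[OF fi] .
  obtain C where C: "C \<ge> 0" "AE z in mT. cmod (f z) \<le> C" using Linf_bound[OF fi] by auto
  have "\<forall>i. \<exists>D. i < r \<longrightarrow> D \<ge> 0 \<and> (AE z in mT. cmod (J i z) \<le> D)"
    using Linf_bound[OF W_Linf[OF J_W]] by blast
  from choice[OF this] obtain D where D: "\<And>i. i < r \<Longrightarrow> D i \<ge> 0" "\<And>i. i < r \<Longrightarrow> AE z in mT. cmod (J i z) \<le> D i"
    by blast
  \<comment> \<open>The Fejer mean of \<open>f * cnj (J i)\<close> is bounded by
    \<open>C * D i\<close>, and multiplication by \<open>J i\<close> contributes another factor
    \<open>D i\<close>.\<close>
  define B where "B = C + (\<Sum>i<r. D i * (C * D i))"
  have B0: "B \<ge> 0" unfolding B_def using C D by (intro add_nonneg_nonneg sum_nonneg mult_nonneg_nonneg) auto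
  have AED: "AE z in mT. \<forall>i\<in>{..<r}. cmod (J i z) \<le> D i"
    by (rule AE_finite_allI) (use D in auto)
  have b: "AE z in mT. cmod (f z - Phi r J N f z) \<le> B" if N: "N \<ge> 1" for N
    using AED C(2)
  proof eventually_elim
    case (elim z)
    have "cmod (Phi r J N f z) \<le> (\<Sum>i<r. D i * (C * D i))"
      unfolding Phi_def
    proof (rule sum_norm_le)
      fix i assume "i \<in> {..<r}"
      then have i: "i < r" by simp
      have "cmod (sig N (\<lambda>z. f z * cnj (J i z)) z) \<le> C * D i"
      proof (rule sig_bound[OF L2_integrable[OF sys_prod_L2[OF sys fL i]] _ N])
        show "AE z in mT. cmod (f z * cnj (J i z)) \<le> C * D i" using C(2) D(2)[OF i]
          by eventually_elim (auto simp: norm_mult C(1) intro!: mult_mono)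
      qed
      then show "cmod (J i z * sig N (\<lambda>z. f z * cnj (J i z)) z) \<le> D i * (C * D i)"
        unfolding norm_mult using elim i D(1)[OF i] by (intro mult_mono) auto
    qed
    then show ?case using norm_triangle_ineq4[of "f z" "Phi r J N f z"] elim(2) by (simp add: B_def)
  qed
  obtain \<eta> where eta: "\<eta> > 0" "\<And>g. g \<in> Linf \<Longrightarrow> AE z in mT. cmod (g z) \<le> B \<Longrightarrow> integral\<^sup>L mT (\<lambda>z. cmod (g z))
      < \<eta> \<Longrightarrow> \<alpha> g < \<epsilon>"
    using al_small[OF B0 e] by auto
  have "eventually (\<lambda>N. n2 (\<lambda>z. Phi r J N f z - f z) < \<eta>) sequentially"
    by (rule order_tendstoD(2)[OF Phi_tendsto[OF sys Wold[OF fK]] eta(1)])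
  then obtain N0 where N0: "\<And>N. N \<ge> N0 \<Longrightarrow> n2 (\<lambda>z. Phi r J N f z - f z) < \<eta>"
      by (auto simp: eventually_sequentially)
  define N where "N = max 1 N0"
  have N: "N \<ge> 1" "N \<ge> N0" by (auto simp: N_def)
  let ?d = "\<lambda>z. f z - Phi r J N f z"
  have dL2: "?d \<in> L2" using L2_diff[OF fL Phi_L2[OF sys]] .
  have dL: "?d \<in> Linf" by (rule LinfI[OF L2_measurable[OF dL2] b[OF N(1)]])
  have "\<alpha> ?d < \<epsilon>"
  proof (rule eta(2)[OF dL b[OF N(1)]])
    show "integral\<^sup>L mT (\<lambda>z. cmod (?d z)) < \<eta>"
      using L1_le_n2[OF dL2] N0[OF N(2)] n2_diff_commute[of f "Phi r J N f"] by simp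
  qed
  then have "ext ?d < ennreal \<epsilon>" using ext_Linf[OF dL] e by (meson ennreal_lessI le_less_trans)
  moreover have "Phi r J N f \<in> sum_space \<alpha> (blaschke a) r J"
  proof -
    \<comment> \<open>\<open>J i\<close> is orthogonal to the positive powers of \<open>u\<close>
      times \<open>f\<close>, so the coefficient function has no negative frequencies.\<close>
    have "sig N (\<lambda>z. f z * cnj (J i z)) \<in> M_alpha \<alpha> (blaschke a)" if i: "i < r" for i
    proof (rule PA_M_alpha[OF sig_PA])
      fix k :: nat assume "k \<ge> 1"
      from W_orthogonal(2)[OF J_W[OF i] fK this] show "integral\<^sup>L mT (\<lambda>z. f z * cnj (J i z) * u z ^ k) = 0"
        by (simp add: ip_def mult_ac)
    qed
    then show ?thesis unfolding sum_space_def Phi_def[abs_def]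
        by (intro CollectI exI[of _ "\<lambda>i. sig N (\<lambda>z. f z * cnj (J i z))"]) auto
  qed
  ultimately show ?thesis by blast
qed

lemma M_eq: "M = aclosure \<alpha> (sum_space \<alpha> (blaschke a) r J)"
proof
  show "aclosure \<alpha> (sum_space \<alpha> (blaschke a) r J) \<subseteq> M"
    using aclosure_mono[OF sum_space_M] M_closed by simp
  have "M \<subseteq> aclosure \<alpha> (aclosure \<alpha> (sum_space \<alpha> (blaschke a) r J))"
  proof
    fix f assume f: "f \<in> M"
    show "f \<in> aclosure \<alpha> (aclosure \<alpha> (sum_space \<alpha> (blaschke a) r J))"
    proof (rule aclosureI[OF M_measurable[OF f]])
      fix \<epsilon> :: real assume "\<epsilon> > 0"
      then obtain g where g: "g \<in> Minf" "ext (\<lambda>z. f z - g z) < ennreal \<epsilon>" using Minf_dense[OF f] by blast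
      have "g \<in> aclosure \<alpha> (sum_space \<alpha> (blaschke a) r J)"
        by (rule aclosureI) (use g Minf_sum_space[OF g(1)] in \<open>auto simp: Minf_def LinfD\<close>)
      then show "\<exists>g\<in>aclosure \<alpha> (sum_space \<alpha> (blaschke a) r J). ext (\<lambda>z. f z - g z) < ennreal \<epsilon>" using g(2)
          by blast
    qed
  qed
  also have "\<dots> \<subseteq> aclosure \<alpha> (sum_space \<alpha> (blaschke a) r J)"
    by (rule aclosure_aclosure) (use sum_space_M M_measurable in blast)
  finally show "M \<subseteq> aclosure \<alpha> (sum_space \<alpha> (blaschke a) r J)" .
qed

text \<open>Elements of \<open>M_alpha\<close> need not lie in L2. Approximation by polynomials in
  the L1 norm takes over in the proof of directness.\<close>

lemma M_alpha_L1:
  assumes g: "g \<in> M_alpha \<alpha> (blaschke a)"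
  shows "integrable mT g" "\<And>\<epsilon>. \<epsilon> > 0 \<Longrightarrow> \<exists>p\<in>PA. integral\<^sup>L mT (\<lambda>z. cmod (g z - p z)) < \<epsilon>"
proof -
  have g': "g \<in> aclosure \<alpha> (Hinf_B (blaschke a))" using g by (simp add: M_alpha_def)
  note [measurable] = aclosure_measurable[OF g']
  have PBi: "integrable mT q" if "q \<in> PB" for q using that by (auto simp: PB_def intro: L2_integrable Linf_L2)
  show gi: "integrable mT g"
  proof (rule aclosure_integrable[OF g'])
    fix h assume "h \<in> Hinf_B (blaschke a)"
    then obtain q where q: "q \<in> PB" "AE z in mT. h z = q z" "h \<in> borel_measurable borel" using Hinf_B_PB
        by blast
    have qm: "q \<in> borel_measurable borel" using borel_measurable_integrable[OF PBi[OF q(1)]] by simp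
    have "integrable mT h = integrable mT q" by (rule integrable_cong_AE) (use q qm in auto)
    then show "integrable mT h" using PBi[OF q(1)] by simp
  qed
  fix \<epsilon> :: real assume e: "\<epsilon> > 0"
  then have e2: "\<epsilon> / 2 > 0" by simp
  obtain h where h: "h \<in> Hinf_B (blaschke a)" "ext (\<lambda>z. g z - h z) < ennreal (\<epsilon> / 2)"
      using aclosureD[OF g' e2] by blast
  obtain q where q: "q \<in> PB" "AE z in mT. h z = q z" "h \<in> borel_measurable borel" using Hinf_B_PB[OF h(1)] .
  note [measurable] = q(3)
  have qi: "integrable mT q" by (rule PBi[OF q(1)])
  have [measurable]: "q \<in> borel_measurable borel" using borel_measurable_integrable[OF qi] by simp
  obtain p where p: "p \<in> PA" "n2 (\<lambda>z. q z - p z) < \<epsilon> / 2" using cl2D[of q PA "\<epsilon> / 2"] q(1) e2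
      by (auto simp: PB_def)
  have pi: "integrable mT p" using p(1) PA_L2 L2_integrable by blast
  have pqL: "(\<lambda>z. q z - p z) \<in> L2" using q(1) p(1) PA_L2 L2_diff by (auto simp: PB_def cl2_L2)
  have "integral\<^sup>L mT (\<lambda>z. cmod (g z - q z)) = integral\<^sup>L mT (\<lambda>z. cmod (g z - h z))"
    by (rule integral_cong_AE) (use q(2) in \<open>auto elim: eventually_mono\<close>)
  then have 1: "integral\<^sup>L mT (\<lambda>z. cmod (g z - q z)) < \<epsilon> / 2" using L1_le_ext(2)[OF _ h(2) e2] by simp
  have "integral\<^sup>L mT (\<lambda>z. cmod (g z - p z)) \<le> integral\<^sup>L mT (\<lambda>z. cmod (g z - q z) + cmod (q z - p z))"
  proof (rule integral_mono)
    show "integrable mT (\<lambda>z. cmod (g z - p z))" "integrable mT (\<lambda>z. cmod (g z - q z) + cmod (q z - p z))"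
      using gi qi pi by auto
    show "cmod (g z - p z) \<le> cmod (g z - q z) + cmod (q z - p z)" for z
      using norm_triangle_ineq[of "g z - q z" "q z - p z"] by simp
  qed
  also have "\<dots> = integral\<^sup>L mT (\<lambda>z. cmod (g z - q z)) + integral\<^sup>L mT (\<lambda>z. cmod (q z - p z))"
    using gi qi pi by (intro Bochner_Integration.integral_add) auto
  also have "\<dots> < \<epsilon>" using 1 L1_le_n2[OF pqL] p(2) by linarith
  finally show "\<exists>p\<in>PA. integral\<^sup>L mT (\<lambda>z. cmod (g z - p z)) < \<epsilon>" using p(1) by blast
qed

text \<open>If a polynomial \<open>p\<close> is close to \<open>g\<close> in L1, then
  \<open>sig N p\<close> equals \<open>sig N\<close> of p - g and is small, because Fejer means
  contract L1. It also tends to \<open>p\<close>, so \<open>p\<close> and with it \<open>g\<close>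
  must be small.\<close>

lemma M_alpha_zero:
  assumes g: "g \<in> M_alpha \<alpha> (blaschke a)" and z: "\<And>i j. cf g i j = 0"
  shows "AE z in mT. g z = 0"
proof -
  have gi: "integrable mT g" by (rule M_alpha_L1(1)[OF g])
  have "integral\<^sup>L mT (\<lambda>z. cmod (g z)) \<le> 0 + \<epsilon>" if e: "\<epsilon> > 0" for \<epsilon>
  proof -
    have e3: "\<epsilon> / 3 > 0" using e by simp
    obtain p where p: "p \<in> PA" "integral\<^sup>L mT (\<lambda>z. cmod (g z - p z)) < \<epsilon> / 3" using M_alpha_L1(2)[OF g e3]
        by blast
    have pL: "p \<in> L2" using p(1) PA_L2 by blast
    have pi: "integrable mT p" using pL L2_integrable by blast
    have "p \<in> cl2 (cspan {\<lambda>z. u z ^ p * cnj (u z) ^ q | p q. True})"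
      using subset_cl2[OF PA_L2] cl2_mono[OF PA_trig] p(1) by blast
    from order_tendstoD(2)[OF sig_tendsto[OF this] e3]
    obtain N0 where N0: "\<And>N. N \<ge> N0 \<Longrightarrow> n2 (\<lambda>z. sig N p z - p z) < \<epsilon> / 3"
        by (auto simp: eventually_sequentially)
    define N where "N = max 1 N0"
    have N: "N \<ge> 1" "N \<ge> N0" by (auto simp: N_def)
    have si: "integrable mT (sig N p)" using L2_integrable[OF Linf_L2[OF sig_Linf]] .
    have "sig N p z = sig N (\<lambda>z. p z - g z) z" for z
      using sig_diff[OF pi gi, of N z] z by (simp add: sig_def[of N g])
    then have "integral\<^sup>L mT (\<lambda>z. cmod (sig N p z)) = integral\<^sup>L mT (\<lambda>z. cmod (sig N (\<lambda>z. p z - g z) z))"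
        by simp
    also have "\<dots> \<le> integral\<^sup>L mT (\<lambda>z. cmod (p z - g z))" by (rule sig_L1[OF _ N(1)]) (use pi gi in auto)
    finally have 1: "integral\<^sup>L mT (\<lambda>z. cmod (sig N p z)) < \<epsilon> / 3" using p(2)
        by (simp add: norm_minus_commute)
    have 2: "integral\<^sup>L mT (\<lambda>z. cmod (sig N p z - p z)) < \<epsilon> / 3"
      using L1_le_n2[OF L2_diff[OF Linf_L2[OF sig_Linf] pL], of N p] N0[OF N(2)] by linarith
    have "integral\<^sup>L mT (\<lambda>z. cmod (g z)) \<le> integral\<^sup>L mT (\<lambda>z. cmod (g z - p z) + (cmod (sig N p z - p z)
        + cmod (sig N p z)))"
    proof (rule integral_mono)
      show "integrable mT (\<lambda>z. cmod (g z))" "integrable mT (\<lambda>z. cmod (g z - p z) + (cmod (sig N p z - p z)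
          + cmod (sig N p z)))"
        using gi pi si by auto
      fix z
      have "g z = (g z - p z) - (sig N p z - p z) + sig N p z" by simp
      then show "cmod (g z) \<le> cmod (g z - p z) + (cmod (sig N p z - p z) + cmod (sig N p z))"
        using norm_triangle_ineq[of "(g z - p z) - (sig N p z - p z)" "sig N p z"] norm_triangle_ineq4[of
            "g z - p z" "sig N p z - p z"] by simp
    qed
    also have "\<dots> = integral\<^sup>L mT (\<lambda>z. cmod (g z - p z)) + (integral\<^sup>L mT (\<lambda>z. cmod (sig N p z - p z))
        + integral\<^sup>L mT (\<lambda>z. cmod (sig N p z)))"
      using gi pi si by simp
    finally show ?thesis using 1 2 p(2) by linarith
  qed
  then have "integral\<^sup>L mT (\<lambda>z. cmod (g z)) \<le> 0" by (rule field_le_epsilon)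
  then have "integral\<^sup>L mT (\<lambda>z. cmod (g z)) = 0" by (intro antisym Bochner_Integration.integral_nonneg) auto
  moreover have "integrable mT (\<lambda>z. cmod (g z))" using gi by simp
  ultimately show ?thesis using integral_nonneg_eq_0_iff_AE[of mT "\<lambda>z. cmod (g z)"] by simp
qed

text \<open>For polynomials \<open>g\<close> this is the orthonormality of the system. Both sides
  are continuous in L1, the left one because \<open>J i * cnj (J l)\<close> is bounded, so
  \<open>M_alpha_L1\<close> extends the identity.\<close>

lemma M_alpha_pairing:
  assumes g: "g \<in> M_alpha \<alpha> (blaschke a)" and i: "i < r" and l: "l < r"
  shows "cf (\<lambda>z. J i z * cnj (J l z) * g z) p q = (if i = l then cf g p q else 0)"
proof -
  note sys = wfam_system[OF J]
  let ?b = "\<lambda>z. J i z * cnj (J l z)"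
  have bL: "?b \<in> Linf" by (intro Linf_mult Linf_cnj W_Linf J_W i l)
  obtain D where D: "D \<ge> 0" "AE z in mT. cmod (?b z) \<le> D" using Linf_bound[OF bL] by auto
  have int: "integrable mT (\<lambda>z. ?b z * f z)" if "integrable mT f" for f
    using integrable_mult_bounded[OF that LinfD[OF bL] D(2)] by (simp add: mult.commute)
  define \<Delta> where "\<Delta> f = cf (\<lambda>z. ?b z * f z) p q - (if i = l then cf f p q else 0)" for f
  have PA0: "\<Delta> f = 0" if "f \<in> PA" for f
    using that unfolding PA_def
  proof induction
    case zero
    then show ?case by (simp add: \<Delta>_def cf_def)
  next
    case (add f g c)
    then obtain k where gk: "g = (\<lambda>z. u z ^ k)" by auto
    have fi: "integrable mT f" using add(1) PA_L2 L2_integrable by (auto simp: PA_def)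
    have gi: "integrable mT g" unfolding gk using L2_integrable[OF Linf_L2[OF u_pow_Linf]] .
    have "cf (\<lambda>z. ?b z * g z) p q = integral\<^sup>L mT (\<lambda>z. ?b z * (u z ^ (k + q) * cnj (u z) ^ p))"
      by (simp add: cf_def gk power_add mult_ac)
    also have "\<dots> = (if i = l \<and> k + q = p then 1 else 0)" by (rule sys_int[OF sys i l])
    finally have 1: "cf (\<lambda>z. ?b z * g z) p q = (if i = l \<and> k + q = p then 1 else 0)" .
    have 2: "cf g p q = (if k + q = p then 1 else 0)"
      using integral_u_pows[of "k + q" p] by (simp add: cf_def gk power_add mult_ac)
    have "\<Delta> g = 0" by (simp add: \<Delta>_def 1 2)
    moreover have "\<Delta> (\<lambda>z. f z + c * g z) = \<Delta> f + c * \<Delta> g"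
    proof -
      have "cf (\<lambda>z. ?b z * (f z + c * g z)) p q = cf (\<lambda>z. ?b z * f z + c * (?b z * g z)) p q"
        by (simp add: algebra_simps)
      also have "\<dots> = cf (\<lambda>z. ?b z * f z) p q + c * cf (\<lambda>z. ?b z * g z) p q"
        using int[OF fi] int[OF gi] by (simp add: cf_add cf_cmult)
      finally show ?thesis using fi gi by (simp add: \<Delta>_def cf_add cf_cmult algebra_simps)
    qed
    ultimately show ?case using add.IH by simp
  qed
  have cfb: "cmod (cf f p q) \<le> integral\<^sup>L mT (\<lambda>z. cmod (f z))" for f
    unfolding cf_def by (rule order_trans[OF integral_norm_bound]) (simp add: norm_mult norm_power)
  have gi: "integrable mT g" by (rule M_alpha_L1(1)[OF g])
  have "cmod (\<Delta> g) \<le> 0 + \<epsilon>" if e: "\<epsilon> > 0" for \<epsilon>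
  proof -
    have "\<epsilon> / (D + 1) > 0" using D e by simp
    then obtain f where f: "f \<in> PA" "integral\<^sup>L mT (\<lambda>z. cmod (g z - f z)) < \<epsilon> / (D + 1)"
        using M_alpha_L1(2)[OF g] by blast
    have fi: "integrable mT f" using f(1) PA_L2 L2_integrable by blast
    have di: "integrable mT (\<lambda>z. g z - f z)" using gi fi by simp
    have "cf (\<lambda>z. ?b z * g z) p q = cf (\<lambda>z. ?b z * (g z - f z) + ?b z * f z) p q" by (simp add: algebra_simps)
    also have "\<dots> = cf (\<lambda>z. ?b z * (g z - f z)) p q + cf (\<lambda>z. ?b z * f z) p q"
      by (rule cf_add[OF int[OF di] int[OF fi]])
    finally have 1: "cf (\<lambda>z. ?b z * g z) p q = cf (\<lambda>z. ?b z * (g z - f z)) p q + cf (\<lambda>z. ?b z * f z) p q" .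
    have 2: "cf g p q = cf (\<lambda>z. g z - f z) p q + cf f p q" using cf_add[OF di fi] by simp
    have "\<Delta> g = \<Delta> (\<lambda>z. g z - f z)" using PA0[OF f(1)] unfolding \<Delta>_def 1 2 by (simp split: if_splits)
    then have "cmod (\<Delta> g) \<le> cmod (cf (\<lambda>z. ?b z * (g z - f z)) p q) + cmod (cf (\<lambda>z. g z - f z) p q)"
      unfolding \<Delta>_def using norm_triangle_ineq4[of "cf (\<lambda>z. ?b z * (g z - f z)) p q" "cf (\<lambda>z. g z
          - f z) p q"] by auto
    also have "\<dots> \<le> integral\<^sup>L mT (\<lambda>z. cmod (?b z * (g z - f z))) + integral\<^sup>L mT (\<lambda>z. cmod (g z - f z))"
      by (intro add_mono cfb)
    also have "integral\<^sup>L mT (\<lambda>z. cmod (?b z * (g z - f z))) \<le> integral\<^sup>L mT (\<lambda>z. D * cmod (g z - f z))"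
    proof (rule integral_mono_AE)
      show "integrable mT (\<lambda>z. cmod (?b z * (g z - f z)))" using int[OF di] by (rule integrable_norm)
      show "integrable mT (\<lambda>z. D * cmod (g z - f z))" using di by simp
      show "AE z in mT. cmod (?b z * (g z - f z)) \<le> D * cmod (g z - f z)" using D(2)
      proof eventually_elim
        case (elim z)
        show ?case unfolding norm_mult[of "?b z"] by (rule mult_right_mono[OF elim]) simp
      qed
    qed
    also have "integral\<^sup>L mT (\<lambda>z. D * cmod (g z - f z)) = D * integral\<^sup>L mT (\<lambda>z. cmod (g z - f z))" by simp
    also have "\<dots> + integral\<^sup>L mT (\<lambda>z. cmod (g z - f z)) = (D + 1) * integral\<^sup>L mT (\<lambda>z. cmod (g z - f z))"
      by (simp add: algebra_simps)
    also have "\<dots> < \<epsilon>" using f(2) D by (simp add: less_divide_eq mult.commute)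
    finally show ?thesis by simp
  qed
  then have "cmod (\<Delta> g) \<le> 0" by (rule field_le_epsilon)
  then show ?thesis by (simp add: \<Delta>_def split: if_splits)
qed

text \<open>Multiplying the vanishing sum by \<open>cnj (J l)\<close> and taking coefficients along
  \<open>u\<close> isolates the coefficients of \<open>g l\<close>; by \<open>M_alpha_zero\<close>
  they determine it.\<close>

lemma direct_sum: "is_direct_sum \<alpha> (blaschke a) r J"
  unfolding is_direct_sum_def
proof (intro allI impI)
  fix g l assume g: "\<forall>i<r. g i \<in> M_alpha \<alpha> (blaschke a)" and s: "AE z in mT. (\<Sum>i<r. J i z * g i z) = 0"
      and l: "l < r"
  have gi: "integrable mT (g i)" if "i < r" for i using g that M_alpha_L1(1) by blast
  have bi: "integrable mT (\<lambda>z. J i z * cnj (J l z) * g i z)" if i: "i < r" for i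
  proof -
    have bL: "(\<lambda>z. J i z * cnj (J l z)) \<in> Linf" by (intro Linf_mult Linf_cnj W_Linf J_W i l)
    obtain D where D: "AE z in mT. cmod (J i z * cnj (J l z)) \<le> D" using Linf_bound[OF bL] by auto
    show ?thesis using integrable_mult_bounded[OF gi[OF i] LinfD[OF bL] D] by (simp add: mult.commute)
  qed
  have "cf (g l) p q = 0" for p q
  proof -
    have "(\<Sum>i<r. cf (\<lambda>z. J i z * cnj (J l z) * g i z) p q) = integral\<^sup>L mT (\<lambda>z. \<Sum>i<r. J i z * cnj (J l z)
        * g i z * (cnj (u z) ^ p * u z ^ q))"
      unfolding cf_def by (rule Bochner_Integration.integral_sum[symmetric]) (use integrable_u_mult[OF bi]
          in auto)
    also have "\<dots> = integral\<^sup>L mT (\<lambda>z. 0)"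
    proof (rule integral_cong_AE)
      show "(\<lambda>z. \<Sum>i<r. J i z * cnj (J l z) * g i z * (cnj (u z) ^ p * u z ^ q)) \<in> borel_measurable mT"
        by (rule borel_measurable_sum) (use borel_measurable_integrable[OF integrable_u_mult[OF bi]] in auto)
      show "AE z in mT. (\<Sum>i<r. J i z * cnj (J l z) * g i z * (cnj (u z) ^ p * u z ^ q)) = 0" using s
      proof eventually_elim
        case (elim z)
        have "(\<Sum>i<r. J i z * cnj (J l z) * g i z * (cnj (u z) ^ p * u z ^ q)) = (\<Sum>i<r. J i z * g i z)
            * (cnj (J l z) * (cnj (u z) ^ p * u z ^ q))"
          unfolding sum_distrib_right by (simp add: mult_ac)
        then show ?case using elim by simp
      qed
    qed simp
    finally have "(\<Sum>i<r. cf (\<lambda>z. J i z * cnj (J l z) * g i z) p q) = 0" by simp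
    moreover have "(\<Sum>i<r. cf (\<lambda>z. J i z * cnj (J l z) * g i z) p q) = (\<Sum>i<r. if i = l then cf (g l) p q else
        0)"
      by (rule sum.cong) (use M_alpha_pairing g l in auto)
    ultimately show ?thesis using l by simp
  qed
  then have "AE z in mT. g l z = 0" by (intro M_alpha_zero) (use g l in auto)
  then show "AE z in mT. J l z * g l z = 0" by eventually_elim simp
qed

lemma J_B_inner: assumes i: "i < r" shows "B_inner (blaschke a) (J i)"
proof -
  note sys = wfam_system[OF J]
  have JL: "J i \<in> Linf" using W_Linf[OF J_W[OF i]] .
  note [measurable] = LinfD[OF JL]
  have "J i \<in> Hinf" using JL W_K[OF J_W[OF i]] K_H2 by (auto simp: Hinf_iff)
  moreover have "integral\<^sup>L mT (\<lambda>z. (blaschke a z ^ m * J i z) * cnj (blaschke a z ^ k * J i z)) = (if m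
      = k then 1 else 0)" for m k
  proof -
    have "integral\<^sup>L mT (\<lambda>z. (blaschke a z ^ m * J i z) * cnj (blaschke a z ^ k * J i z))
        = integral\<^sup>L mT (\<lambda>z. J i z * cnj (J i z) * (u z ^ m * cnj (u z) ^ k))"
    proof (rule integral_cong_AE)
      show "AE z in mT. (blaschke a z ^ m * J i z) * cnj (blaschke a z ^ k * J i z) = J i z * cnj (J i z)
          * (u z ^ m * cnj (u z) ^ k)"
        using u_AE_blaschke by eventually_elim (simp add: mult_ac)
    qed measurable
    then show ?thesis using sys_int[OF sys i i] by simp
  qed
  ultimately show ?thesis by (simp add: B_inner_def)
qed

end

lemma decomposition:
  "\<exists>r\<le>n. \<exists>J. (\<forall>i<r. B_inner (blaschke a) (J i)) \<and> is_direct_sum \<alpha> (blaschke a) r J \<and>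
     M = aclosure \<alpha> (sum_space \<alpha> (blaschke a) r J)"
proof -
  obtain r J where J1: "wfam r J" and J2: "\<forall>w\<in>W. (\<forall>i<r. ip w (J i) = 0) \<longrightarrow> (AE z in mT. w z = 0)"
    using wandering_basis_exists by (elim exE conjE)
  have J: "wfam r J" "\<And>w. w \<in> W \<Longrightarrow> (\<And>i. i < r \<Longrightarrow> ip w (J i) = 0) \<Longrightarrow> AE z in mT. w z = 0"
    using J1 J2 by blast+
  have "r \<le> n" by (rule unitary_system_size[OF wfam_system[OF J(1)]])
  moreover have "\<forall>i<r. B_inner (blaschke a) (J i)" using J_B_inner[OF J] by blast
  ultimately show ?thesis using direct_sum[OF J] M_eq[OF J] by blast
qed

end

theorem theorem3p6:
  fixes \<alpha> :: "(complex \<Rightarrow> complex) \<Rightarrow> real"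
    and a :: "complex list" and n :: nat
    and M :: "(complex \<Rightarrow> complex) set"
  assumes "dominating_gauge_norm \<alpha>" and "continuous_gauge \<alpha>"
    and "length a = n" and "n \<ge> 1" and "\<forall>i<n. cmod (a ! i) < 1" and "a ! 0 = 0"
    and "linear_subspace M" and "M \<subseteq> Halpha \<alpha>" and "aclosure \<alpha> M = M"
    and "\<forall>f\<in>M. (\<lambda>z. blaschke a z * f z) \<in> M"
  shows "\<exists>r\<le>n. \<exists>J :: nat \<Rightarrow> complex \<Rightarrow> complex.
           (\<forall>i<r. B_inner (blaschke a) (J i)) \<and>
           is_direct_sum \<alpha> (blaschke a) r J \<and>
           M = aclosure \<alpha> (sum_space \<alpha> (blaschke a) r J)"
proof -
  interpret invariant_subspace \<alpha> a n M
    by unfold_locales (use assms in auto)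
  show ?thesis by (rule decomposition)
qed

end
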